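(* Let $G$ be a Lie group, $\delta\in\mathrm{Aut}(G)$ a Lie group automorphism and $\lambda\in(0,+\infty)\setminus\{1\}$. The following statements are equivalent: (i) there is an admissible distance on $G$ for which $\delta$ is a dilation of factor $\lambda$; (ii) $G$ is connected and simply connected; the (complex) eigenvalues of $\delta_*$ have modulus smaller than or equal to $\lambda$ if $\lambda<1$, and greater than or equal to $\lambda$ if $\lambda>1$; and the complexification of $\delta_*$ is diagonalizable on the generalized eigenspaces of the eigenvalues of modulus equal to $\lambda$.
   Context: Lie groups are real and finite-dimensional. $\delta_*$ is the automorphism of the Lie algebra of $G$ induced by $\delta$. A distance $d$ on $G$ is admissible if it is left-invariant ($d(gx,gy)=d(x,y)$) and induces the manifold topology. $\delta$ is a dilation of factor $\lambda$ for $d$ if $\delta$ is bijective and $d(\delta x,\delta y)=\lambda d(x,y)$ for all $x,y\in G$. *)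

theory Defs
  imports
    "HOL-Analysis.Analysis"
    "HOL-Algebra.Group"
    "HOL-Library.Function_Algebras"
begin

section \<open>Smooth manifolds and Lie groups\<close>

text \<open>
  For an open set \<open>S\<close> of a finite-dimensional space: \<open>f\<close> is of class \<open>C\<^sup>k\<close> on \<open>S\<close>,
  the derivatives being taken as iterated directional derivatives.
\<close>

fun Ck_on :: "nat \<Rightarrow> 'e::real_normed_vector set \<Rightarrow> ('e \<Rightarrow> 'f::real_normed_vector) \<Rightarrow> bool" where
  "Ck_on 0 S f \<longleftrightarrow> continuous_on S f"
| "Ck_on (Suc k) S f \<longleftrightarrow>
     (\<forall>x\<in>S. f differentiable (at x)) \<and>
     (\<forall>v. Ck_on k S (\<lambda>x. frechet_derivative f (at x) v))"

definition smooth_on :: "'e::real_normed_vector set \<Rightarrow> ('e \<Rightarrow> 'f::real_normed_vector) \<Rightarrow> bool" where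
  "smooth_on S f \<longleftrightarrow> (\<forall>k. Ck_on k S f)"

text \<open>
  A chart is a pair of a domain and a coordinate map; only the values of the coordinate map on the
  domain matter.
\<close>

type_synonym ('a, 'e) chart = "'a set \<times> ('a \<Rightarrow> 'e)"

text \<open>
  The model space is an arbitrary finite-dimensional real normed space. The class
  \<open>euclidean_space\<close> is not used because it excludes dimension \<open>0\<close>. The atlas need not be maximal.
  Second countability is not required: it is automatic for connected Lie groups.
\<close>

locale smooth_manifold =
  fixes T :: "'a topology" and A :: "('a, 'e::real_normed_vector) chart set"
  assumes finite_dim: "\<exists>B::'e set. finite B \<and> span B = UNIV"
    and Hausdorff: "Hausdorff_space T"
    and covers: "(\<Union>(U, \<phi>)\<in>A. U) = topspace T"
    and chart_domain: "\<And>U \<phi>. (U, \<phi>) \<in> A \<Longrightarrow> openin T U"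
    and chart_image: "\<And>U \<phi>. (U, \<phi>) \<in> A \<Longrightarrow> open (\<phi> ` U)"
    and chart_homeomorphic: "\<And>U \<phi>. (U, \<phi>) \<in> A \<Longrightarrow>
          homeomorphic_map (subtopology T U) (top_of_set (\<phi> ` U)) \<phi>"
    and compatible: "\<And>U \<phi> V \<psi>. (U, \<phi>) \<in> A \<Longrightarrow> (V, \<psi>) \<in> A \<Longrightarrow>
          smooth_on (\<phi> ` (U \<inter> V)) (\<psi> \<circ> inv_into U \<phi>)"

definition smooth_map ::
  "'a topology \<Rightarrow> ('a, 'e::real_normed_vector) chart set \<Rightarrow>
   'b topology \<Rightarrow> ('b, 'f::real_normed_vector) chart set \<Rightarrow> ('a \<Rightarrow> 'b) \<Rightarrow> bool" where
  "smooth_map T A T' A' f \<longleftrightarrow>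
     continuous_map T T' f \<and>
     (\<forall>(U, \<phi>)\<in>A. \<forall>(V, \<psi>)\<in>A'. smooth_on (\<phi> ` (U \<inter> f -` V)) (\<psi> \<circ> f \<circ> inv_into U \<phi>))"

definition prod_atlas ::
  "('a, 'e) chart set \<Rightarrow> ('b, 'f) chart set \<Rightarrow> ('a \<times> 'b, 'e \<times> 'f) chart set" where
  "prod_atlas A A' = {(U \<times> V, map_prod \<phi> \<psi>) | U \<phi> V \<psi>. (U, \<phi>) \<in> A \<and> (V, \<psi>) \<in> A'}"

locale lie_group = group G + smooth_manifold T A
  for G :: "('a, 'm) monoid_scheme" (structure)
    and T :: "'a topology" and A :: "('a, 'e::real_normed_vector) chart set" +
  assumes topspace_eq_carrier: "topspace T = carrier G"
    and smooth_mult: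
      "smooth_map (prod_topology T T) (prod_atlas A A) T A (\<lambda>(x, y). x \<otimes> y)"
    and smooth_inv: "smooth_map T A T A (\<lambda>x. inv x)"

definition lie_group_automorphism ::
  "('a, 'm) monoid_scheme \<Rightarrow> 'a topology \<Rightarrow> ('a, 'e::real_normed_vector) chart set \<Rightarrow>
   ('a \<Rightarrow> 'a) \<Rightarrow> bool" where
  "lie_group_automorphism G T A \<delta> \<longleftrightarrow>
     \<delta> \<in> iso G G \<and> smooth_map T A T A \<delta> \<and> smooth_map T A T A (inv_into (carrier G) \<delta>)"


section \<open>The Lie algebra and the induced automorphism\<close>

text \<open>
  The real-valued smooth functions on the manifold; their values outside the space are irrelevant.
\<close>

definition smooth_functions ::
  "'a topology \<Rightarrow> ('a, 'e::real_normed_vector) chart set \<Rightarrow> ('a \<Rightarrow> real) set" where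
  "smooth_functions T A = {f. smooth_map T A euclideanreal {(UNIV, id)} f}"

text \<open>
  Smooth vector fields are the derivations of the algebra of smooth functions. As HOL functions are
  total, a vector field is made to vanish on non-smooth functions and outside the space, so that
  equality of fields is equality of HOL functions.
\<close>

type_synonym 'a vfield = "('a \<Rightarrow> real) \<Rightarrow> ('a \<Rightarrow> real)"

definition smooth_vector_fields ::
  "'a topology \<Rightarrow> ('a, 'e::real_normed_vector) chart set \<Rightarrow> 'a vfield set" where
  "smooth_vector_fields T A =
     {X. (\<forall>f\<in>smooth_functions T A. X f \<in> smooth_functions T A) \<and>
         (\<forall>f\<in>smooth_functions T A. \<forall>g\<in>smooth_functions T A. \<forall>a b.
            X (\<lambda>x. a * f x + b * g x) = (\<lambda>x. a * X f x + b * X g x)) \<and>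
         (\<forall>f\<in>smooth_functions T A. \<forall>g\<in>smooth_functions T A.
            X (\<lambda>x. f x * g x) = (\<lambda>x. f x * X g x + X f x * g x)) \<and>
         (\<forall>f x. f \<notin> smooth_functions T A \<or> x \<notin> topspace T \<longrightarrow> X f x = 0)}"

text \<open>
  The Lie algebra consists of the left-invariant smooth vector fields. Its bracket is the commutator
  \<open>X \<circ> Y - Y \<circ> X\<close>; only the underlying vector space is needed for spectral properties.
\<close>

definition lie_algebra ::
  "('a, 'm) monoid_scheme \<Rightarrow> 'a topology \<Rightarrow> ('a, 'e::real_normed_vector) chart set \<Rightarrow>
   'a vfield set" where
  "lie_algebra G T A =
     {X \<in> smooth_vector_fields T A.
        \<forall>g\<in>carrier G. \<forall>f\<in>smooth_functions T A. \<forall>x\<in>carrier G.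
          X (\<lambda>y. f (g \<otimes>\<^bsub>G\<^esub> y)) x = X f (g \<otimes>\<^bsub>G\<^esub> x)}"

definition vf_scale :: "real \<Rightarrow> 'a vfield \<Rightarrow> 'a vfield" where
  "vf_scale r X = (\<lambda>f x. r * X f x)"

text \<open>
  The push-forward of vector fields by \<open>\<delta>\<close>, that is
  \<open>(\<delta>\<^sub>* X) f = X (f \<circ> \<delta>) \<circ> \<delta>\<^sup>-\<^sup>1\<close>.
\<close>

definition induced_aut ::
  "('a, 'm) monoid_scheme \<Rightarrow> ('a \<Rightarrow> 'a) \<Rightarrow> 'a vfield \<Rightarrow> 'a vfield" where
  "induced_aut G \<delta> X =
     (\<lambda>f x. if x \<in> carrier G then X (f \<circ> \<delta>) (inv_into (carrier G) \<delta> x) else 0)"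

lemma vector_space_vf_scale: "vector_space (vf_scale :: real \<Rightarrow> 'a vfield \<Rightarrow> 'a vfield)"
  by unfold_locales (auto simp: vf_scale_def fun_eq_iff algebra_simps)


section \<open>Complexification and spectral notions\<close>

text \<open>
  The pair \<open>(u, v)\<close> stands for \<open>u + \<i> v\<close>. The complexification of a subspace \<open>V\<close> is
  \<open>V \<times> V\<close> and that of a linear map \<open>L\<close> is \<open>map_prod L L\<close>.
\<close>

definition cplx_scale :: "(real \<Rightarrow> 'v \<Rightarrow> 'v) \<Rightarrow> complex \<Rightarrow> 'v \<times> 'v \<Rightarrow> 'v \<times> 'v::ab_group_add" where
  "cplx_scale s z = (\<lambda>(u, v). (s (Re z) u - s (Im z) v, s (Re z) v + s (Im z) u))"

lemma vector_space_cplx_scale: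
  assumes "vector_space s"
  shows "vector_space (cplx_scale s)"
proof -
  interpret vector_space s by fact
  show ?thesis
    by unfold_locales
      (auto simp: cplx_scale_def scale_left_distrib scale_right_distrib
        scale_left_diff_distrib scale_right_diff_distrib algebra_simps)
qed

definition lie_algebra_cplx ::
  "('a, 'm) monoid_scheme \<Rightarrow> 'a topology \<Rightarrow> ('a, 'e::real_normed_vector) chart set \<Rightarrow>
   ('a vfield \<times> 'a vfield) set" where
  "lie_algebra_cplx G T A = lie_algebra G T A \<times> lie_algebra G T A"

definition vf_cplx_scale ::
  "complex \<Rightarrow> 'a vfield \<times> 'a vfield \<Rightarrow> 'a vfield \<times> 'a vfield" where
  "vf_cplx_scale = cplx_scale vf_scale"

definition induced_aut_cplx ::
  "('a, 'm) monoid_scheme \<Rightarrow> ('a \<Rightarrow> 'a) \<Rightarrow>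
   'a vfield \<times> 'a vfield \<Rightarrow> 'a vfield \<times> 'a vfield" where
  "induced_aut_cplx G \<delta> = map_prod (induced_aut G \<delta>) (induced_aut G \<delta>)"

lemma vector_space_vf_cplx_scale:
  "vector_space (vf_cplx_scale :: complex \<Rightarrow> 'a vfield \<times> 'a vfield \<Rightarrow> 'a vfield \<times> 'a vfield)"
  unfolding vf_cplx_scale_def by (rule vector_space_cplx_scale[OF vector_space_vf_scale])

definition eigenvalue_on ::
  "('k::field \<Rightarrow> 'v::ab_group_add \<Rightarrow> 'v) \<Rightarrow> 'v set \<Rightarrow> ('v \<Rightarrow> 'v) \<Rightarrow> 'k \<Rightarrow> bool" where
  "eigenvalue_on s V L z \<longleftrightarrow> (\<exists>v\<in>V. v \<noteq> 0 \<and> L v = s z v)"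

definition generalized_eigenspace ::
  "('k::field \<Rightarrow> 'v::ab_group_add \<Rightarrow> 'v) \<Rightarrow> 'v set \<Rightarrow> ('v \<Rightarrow> 'v) \<Rightarrow> 'k \<Rightarrow> 'v set" where
  "generalized_eigenspace s V L z = {v\<in>V. \<exists>k. ((\<lambda>w. L w - s z w) ^^ k) v = 0}"

definition diagonalizable_on ::
  "('k::field \<Rightarrow> 'v::ab_group_add \<Rightarrow> 'v) \<Rightarrow> 'v set \<Rightarrow> ('v \<Rightarrow> 'v) \<Rightarrow> bool" where
  "diagonalizable_on s W L \<longleftrightarrow>
     (\<exists>B. \<not> module.dependent s B \<and> module.span s B = W \<and> (\<forall>b\<in>B. \<exists>z. L b = s z b))"


section \<open>Simple connectedness, admissible distances and dilations\<close>

text \<open>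
  The library defines \<open>simply_connected\<close> for subsets of a type of class \<open>topological_space\<close> only;
  this is the same definition for abstract topologies.
\<close>

definition simply_connected_space :: "'a topology \<Rightarrow> bool" where
  "simply_connected_space T \<longleftrightarrow>
     (\<forall>p q. pathin T p \<and> p 1 = p 0 \<and> pathin T q \<and> q 1 = q 0 \<longrightarrow>
        homotopic_with (\<lambda>r. r 1 = r 0) (top_of_set {0..1::real}) T p q)"

lemma simply_connected_space_top_of_set:
  "simply_connected_space (top_of_set S) \<longleftrightarrow> simply_connected S"
  unfolding simply_connected_space_def simply_connected_def homotopic_loops_def
    pathin_def path_def path_image_def pathstart_def pathfinish_def
  by (auto simp: image_subset_iff_funcset)

definition admissible_distance ::
  "('a, 'm) monoid_scheme \<Rightarrow> 'a topology \<Rightarrow> ('a \<Rightarrow> 'a \<Rightarrow> real) \<Rightarrow> bool" where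
  "admissible_distance G T d \<longleftrightarrow>
     Metric_space (carrier G) d \<and>
     (\<forall>g\<in>carrier G. \<forall>x\<in>carrier G. \<forall>y\<in>carrier G.
        d (g \<otimes>\<^bsub>G\<^esub> x) (g \<otimes>\<^bsub>G\<^esub> y) = d x y) \<and>
     Metric_space.mtopology (carrier G) d = T"

definition dilation :: "'a set \<Rightarrow> ('a \<Rightarrow> 'a \<Rightarrow> real) \<Rightarrow> real \<Rightarrow> ('a \<Rightarrow> 'a) \<Rightarrow> bool" where
  "dilation M d c f \<longleftrightarrow> bij_betw f M M \<and> (\<forall>x\<in>M. \<forall>y\<in>M. d (f x) (f y) = c * d x y)"

end

theory Submission
  imports Defs "HOL-Computational_Algebra.Fundamental_Theorem_Algebra"
begin

text \<open>
  Fix a chart at the identity and let \<open>L\<close> be the derivative of \<open>\<delta>\<close> there. Replacing \<open>\<delta>\<close> by its inverse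
  and \<open>c\<close> by \<open>1 / c\<close> reduces everything to \<open>c < 1\<close>, and then both sides of the equivalence are
  compared with the growth bound \<open>norm (L\<^sup>n v) \<le> C * c\<^sup>n * norm v\<close>.

  Growth and spectrum (\<open>powers_bounded_iff_spectral\<close>). Every vector is annihilated by a product of factors
  \<open>L - z\<close> over the complex numbers. A factor with \<open>cmod z < c\<close> can be removed without affecting growth of
  order \<open>c\<^sup>n\<close>; what is left is a sum of eigenvectors for eigenvalues of modulus \<open>c\<close>, provided that no
  eigenvalue has larger modulus and no Jordan chain of length two occurs at modulus \<open>c\<close>. Conversely a
  larger eigenvalue or such a chain violates the bound. These are conditions on \<open>\<delta>\<^sub>*\<close> because a left-invariant derivation is a directional derivative
  in the chart at the identity, by bump functions and Hadamard's lemma; this identifies the Lie algebra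
  with the model space and \<open>\<delta>\<^sub>*\<close> with \<open>L\<close> (\<open>lie_algebra_eq_left_fields\<close>, \<open>induced_aut_left_field\<close>).

  From a distance to the bound (\<open>linear_part_powers_bounded\<close>). Near the identity multiplication is
  addition up to half the norm of the second factor, hence the coordinates of \<open>x\<^sup>m\<close> are comparable in
  norm to \<open>m\<close> times those of \<open>x\<close>.
  Since \<open>d \<one> (x\<^sup>m) \<le> m * d \<one> x\<close>, a left-invariant distance dominates the norm of the coordinates near
  the identity. Comparing \<open>x\<^sup>m\<close> with \<open>(\<delta>\<^sup>n x)\<^sup>m = \<delta>\<^sup>n (x\<^sup>m)\<close> in the same way turns
  \<open>d \<one> (\<delta>\<^sup>n x) = c\<^sup>n * d \<one> x\<close> into a bound of order \<open>c\<^sup>n\<close> on the coordinates of \<open>\<delta>\<^sup>n x\<close> that is linear in those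
  of \<open>x\<close>, and differentiation at the identity gives the bound on \<open>L\<^sup>n\<close>. Connectedness and simple
  connectedness hold because for large \<open>n\<close> the map \<open>\<delta>\<^sup>n\<close> moves a given bounded set into a
  chart ball: segments in that ball, pulled back by \<open>\<delta>\<^sup>-\<^sup>n\<close>, join points and deform loops.

  From the bound to a distance (\<open>ex_dilated_distance\<close>). The chain distance \<open>e\<close> built from the norm of the
  coordinates is left-invariant and induces the topology, and near the identity \<open>e \<one> x\<close> is at most the
  larger of the norms of the coordinates of \<open>x\<close> and of its inverse. The second order estimate for \<open>\<delta>\<close>
  upgrades the bound on \<open>L\<^sup>n\<close> to orbits: \<open>e \<one> (\<delta>\<^sup>n x) \<le> K * c\<^sup>n\<close> for \<open>x\<close> near
  the identity, hence for all \<open>x\<close>, since the elements with this property form an open subgroup of a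
  connected group. The supremum of \<open>c\<^sup>-\<^sup>n * min 1 (e (\<delta>\<^sup>n x) (\<delta>\<^sup>n y))\<close> over all integers \<open>n\<close> is then the
  required distance: shifting \<open>n\<close> gives the dilation property, the terms with \<open>n \<ge> 0\<close> are controlled by
  the orbit estimate and those with \<open>n < 0\<close> by the truncation at \<open>1\<close>.
\<close>

section \<open>Finite-dimensional normed spaces\<close>

text \<open>
  The model space of a manifold may have dimension \<open>0\<close>, so it is described by a basis rather than by the
  class \<open>euclidean_space\<close>.
\<close>

definition finite_basis :: "'e::real_normed_vector set \<Rightarrow> bool" where
  "finite_basis B \<longleftrightarrow> finite B \<and> independent B \<and> span B = UNIV"

lemma ex_finite_basis:
  assumes "\<exists>S::'e::real_normed_vector set. finite S \<and> span S = UNIV"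
  shows "\<exists>B::'e set. finite_basis B"
proof -
  obtain S :: "'e set" where S: "finite S" "span S = UNIV" using assms by blast
  obtain B where B: "B \<subseteq> S" "independent B" "S \<subseteq> span B"
    using real_vector.maximal_independent_subset[of S] by blast
  have "span B = UNIV" using B(3) S(2) real_vector.span_minimal[OF B(3)] by auto
  moreover have "finite B" using B(1) S(1) by (rule finite_subset)
  ultimately show ?thesis using B(2) unfolding finite_basis_def by blast
qed

lemma finite_basis_prod:
  assumes "finite_basis (B::'e::real_normed_vector set)" "finite_basis (C::'f::real_normed_vector set)"
  shows "\<exists>D::('e\<times>'f) set. finite_basis D"
proof (rule ex_finite_basis, intro exI conjI)
  let ?S = "(\<lambda>b. (b, 0::'f)) ` B \<union> (\<lambda>b. (0::'e, b)) ` C"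
  show "finite ?S" using assms by (auto simp: finite_basis_def)
  have l1: "linear (\<lambda>u::'e. (u, 0::'f))" and l2: "linear (\<lambda>u::'f. (0::'e, u))"
    by (auto intro!: linearI)
  have "(u, v) \<in> span ?S" for u v
  proof -
    have "u \<in> span B" "v \<in> span C" using assms by (auto simp: finite_basis_def)
    then have "(u, 0) \<in> span ((\<lambda>b. (b, 0::'f)) ` B)" "(0, v) \<in> span ((\<lambda>b. (0::'e, b)) ` C)"
      using linear_span_image[OF l1, of B] linear_span_image[OF l2, of C] by auto
    then have "(u, 0) \<in> span ?S" "(0, v) \<in> span ?S"
      using span_mono[of _ ?S] by (meson Un_upper1 Un_upper2 subsetD span_mono)+
    then have "(u, 0) + (0, v) \<in> span ?S" by (rule span_add)
    then show ?thesis by simp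
  qed
  then show "span ?S = UNIV" by auto
qed

lemma finite_basis_real: "\<exists>B::real set. finite_basis B"
proof (rule ex_finite_basis, intro exI conjI)
  show "finite {1::real}" by simp
  have "x \<in> span {1}" for x :: real
    using span_scale[of "1::real" "{1}" x] span_base[of "1::real" "{1}"] by auto
  then show "span {1::real} = UNIV" by auto
qed

text \<open>
  Tychonoff's theorem for the topology of pointwise convergence; it provides the compact coordinate boxes
  from which compactness in the model space is derived.
\<close>

lemma compact_PiE_UNIV:
  fixes S :: "'i \<Rightarrow> 'b::topological_space set"
  assumes "\<And>i. compact (S i)"
  shows "compact {g. \<forall>i. g i \<in> S i}"
proof -
  have "compactin (product_topology (\<lambda>i. euclidean) UNIV) (PiE UNIV S)"
    using assms by (simp add: compactin_PiE)
  then have "compact (PiE UNIV S)" by (simp add: euclidean_product_topology)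
  moreover have "PiE UNIV S = {g. \<forall>i. g i \<in> S i}" by auto
  ultimately show ?thesis by simp
qed

lemma continuous_on_fun_apply [continuous_intros]:
  "continuous_on S (\<lambda>g::'i \<Rightarrow> 'b::topological_space. g i)"
  by (rule continuous_on_subset[OF continuous_on_product_coordinates]) simp

text \<open>
  The norm of a linear combination is continuous and, by independence, positive on the compact set of
  coefficient vectors of \<open>l\<^sup>1\<close>-norm \<open>1\<close>; scaling gives the general case. This makes coordinates continuous.
\<close>

lemma independent_coeff_bound:
  fixes B :: "'e::real_normed_vector set"
  assumes fin: "finite B" and ind: "independent B"
  shows "\<exists>c>0. \<forall>a. c * (\<Sum>b\<in>B. \<bar>a b\<bar>) \<le> norm (\<Sum>b\<in>B. a b *\<^sub>R b)"
proof -
  define P where "P = {g::'e\<Rightarrow>real. \<forall>b. g b \<in> (if b \<in> B then {-1..1} else {0})}"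
  define K where "K = P \<inter> {g. (\<Sum>b\<in>B. \<bar>g b\<bar>) = 1}"
  let ?N = "\<lambda>g::'e\<Rightarrow>real. norm (\<Sum>b\<in>B. g b *\<^sub>R b)"
  have "compact P" unfolding P_def by (rule compact_PiE_UNIV) simp
  moreover have "closed {g::'e\<Rightarrow>real. (\<Sum>b\<in>B. \<bar>g b\<bar>) = 1}"
    by (intro closed_Collect_eq continuous_intros)
  ultimately have cK: "compact K" unfolding K_def by (rule compact_Int_closed)
  have cN: "continuous_on K ?N" by (intro continuous_intros)
  have pos: "?N g > 0" if "g \<in> K" for g
  proof (rule ccontr)
    assume "\<not> ?N g > 0"
    then have "(\<Sum>b\<in>B. g b *\<^sub>R b) = 0" by simp
    then have "\<forall>b\<in>B. g b = 0" using ind fin by (auto simp: dependent_finite)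
    then show False using that by (simp add: K_def)
  qed
  obtain c where c: "c > 0" "\<And>g. g \<in> K \<Longrightarrow> c \<le> ?N g"
  proof (cases "K = {}")
    case True then show ?thesis using that[of 1] by auto
  next
    case False
    then obtain g where "g \<in> K" "\<forall>h\<in>K. ?N g \<le> ?N h"
      using continuous_attains_inf[OF cK _ cN] by blast
    then show ?thesis using that[of "?N g"] pos by blast
  qed
  have "c * (\<Sum>b\<in>B. \<bar>a b\<bar>) \<le> ?N a" for a
  proof (cases "(\<Sum>b\<in>B. \<bar>a b\<bar>) = 0")
    case False
    define S where "S = (\<Sum>b\<in>B. \<bar>a b\<bar>)"
    have "S \<ge> 0" unfolding S_def by (rule sum_nonneg) simp
    moreover have "S \<noteq> 0" using False by (simp add: S_def)
    ultimately have S: "S > 0" by simp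
    define g where "g b = (if b \<in> B then a b / S else 0)" for b
    have le: "\<bar>a b\<bar> \<le> S" if "b \<in> B" for b
      unfolding S_def using that fin by (intro member_le_sum) auto
    have "g b \<in> {-1..1}" if "b \<in> B" for b
    proof -
      have "- S \<le> a b" "a b \<le> S" using le[OF that] by linarith+
      then show ?thesis using S that by (simp add: g_def field_simps)
    qed
    then have "g \<in> P" by (auto simp: P_def g_def)
    moreover have "(\<Sum>b\<in>B. \<bar>g b\<bar>) = (\<Sum>b\<in>B. \<bar>a b\<bar>) / S"
      unfolding sum_divide_distrib using S by (intro sum.cong) (auto simp: g_def)
    then have "(\<Sum>b\<in>B. \<bar>g b\<bar>) = 1" using S by (simp add: S_def)
    ultimately have "g \<in> K" by (simp add: K_def)
    then have "c \<le> ?N g" by (rule c)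
    also have "(\<Sum>b\<in>B. g b *\<^sub>R b) = (1/S) *\<^sub>R (\<Sum>b\<in>B. a b *\<^sub>R b)"
      unfolding scaleR_sum_right by (intro sum.cong) (auto simp: g_def)
    finally show ?thesis using S by (simp add: S_def[symmetric] field_simps)
  qed simp
  then show ?thesis using c(1) by blast
qed

context
  fixes B :: "'e::real_normed_vector set"
  assumes B: "finite_basis B"
begin

lemma finite_basis_finite: "finite B" using B by (simp add: finite_basis_def)

lemma finite_basis_expand: "(\<Sum>b\<in>B. representation B v b *\<^sub>R b) = v"
  using B by (intro real_vector.sum_representation_eq) (auto simp: finite_basis_def)

lemma finite_basis_bounded_linear_coord: "bounded_linear (\<lambda>v. representation B v b)"
proof -
  obtain c where c: "c > 0" "\<And>a. c * (\<Sum>b\<in>B. \<bar>a b\<bar>) \<le> norm (\<Sum>b\<in>B. a b *\<^sub>R b)"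
    using independent_coeff_bound[of B] B by (auto simp: finite_basis_def)
  have bd: "\<bar>representation B v b\<bar> \<le> norm v * (1/c)" for v
  proof (cases "b \<in> B")
    case True
    have "\<bar>representation B v b\<bar> \<le> (\<Sum>b\<in>B. \<bar>representation B v b\<bar>)"
      using True finite_basis_finite by (intro member_le_sum) auto
    also have "\<dots> \<le> norm v / c" using c(2)[of "representation B v"] c(1)
      by (simp add: finite_basis_expand field_simps)
    finally show ?thesis by simp
  next
    case False
    then have "representation B v b = 0" using real_vector.representation_ne_zero by blast
    then show ?thesis using c(1) by simp
  qed
  show ?thesis
  proof (rule bounded_linear_intro)
    show "representation B (x + y) b = representation B x b + representation B y b" for x y
      using B by (simp add: finite_basis_def real_vector.representation_add)
    show "representation B (r *\<^sub>R x) b = r *\<^sub>R representation B x b" for r x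
      using B by (simp add: finite_basis_def real_vector.representation_scale)
    show "norm (representation B x b) \<le> norm x * (1/c)" for x using bd[of x] by simp
  qed
qed

lemma finite_basis_linear_expand:
  assumes "linear (f::'e \<Rightarrow> 'f::real_normed_vector)"
  shows "f v = (\<Sum>b\<in>B. representation B v b *\<^sub>R f b)"
proof -
  have "f v = f (\<Sum>b\<in>B. representation B v b *\<^sub>R b)" by (simp add: finite_basis_expand)
  then show ?thesis by (simp add: linear_sum[OF assms] linear_cmul[OF assms])
qed

lemma finite_basis_linear_bounded:
  assumes "linear (f::'e \<Rightarrow> 'f::real_normed_vector)"
  shows "bounded_linear f"
proof -
  have "bounded_linear (\<lambda>v. \<Sum>b\<in>B. representation B v b *\<^sub>R f b)"
    by (intro bounded_linear_sum bounded_linear_scaleR_const finite_basis_bounded_linear_coord)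
  moreover have "f = (\<lambda>v. \<Sum>b\<in>B. representation B v b *\<^sub>R f b)"
    by (rule ext) (rule finite_basis_linear_expand[OF assms])
  ultimately show ?thesis by simp
qed

lemma finite_basis_norm_bound:
  obtains C where "C \<ge> 0" "\<And>(f::'e \<Rightarrow> 'f::real_normed_vector) M v. linear f \<Longrightarrow>
    (\<And>b. b \<in> B \<Longrightarrow> norm (f b) \<le> M) \<Longrightarrow> norm (f v) \<le> C * M * norm v"
proof -
  have "\<exists>K\<ge>0. \<forall>v. \<bar>representation B v b\<bar> \<le> norm v * K" for b
    using bounded_linear.nonneg_bounded[OF finite_basis_bounded_linear_coord[of b]] by simp
  then obtain K where K: "\<And>b. K b \<ge> 0" "\<And>b v. \<bar>representation B v b\<bar> \<le> norm v * K b" by metis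
  show ?thesis
  proof (rule that[of "sum K B"])
    show "0 \<le> sum K B" by (simp add: K sum_nonneg)
    fix f :: "'e \<Rightarrow> 'f" and M v assume f: "linear f" and M: "\<And>b. b \<in> B \<Longrightarrow> norm (f b) \<le> M"
    have "norm (f v) \<le> (\<Sum>b\<in>B. norm (representation B v b *\<^sub>R f b))"
      unfolding finite_basis_linear_expand[OF f, of v] by (rule norm_sum)
    also have "\<dots> \<le> (\<Sum>b\<in>B. (norm v * K b) * M)"
      unfolding norm_scaleR using K M by (intro sum_mono mult_mono) auto
    finally show "norm (f v) \<le> sum K B * M * norm v"
      by (simp add: sum_distrib_right sum_distrib_left mult_ac)
  qed
qed

text \<open>
  A ball lies in the continuous image of a compact box of coordinates.
\<close>

lemma finite_basis_compact_cball: "compact (cball (a::'e) r)"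
proof -
  define R where "R = norm a + r"
  have "\<exists>K\<ge>0. \<forall>v. \<bar>representation B v b\<bar> \<le> norm v * K" for b
    using bounded_linear.nonneg_bounded[OF finite_basis_bounded_linear_coord[of b]] by simp
  then obtain K where K: "\<And>b. K b \<ge> 0" "\<And>b v. \<bar>representation B v b\<bar> \<le> norm v * K b" by metis
  let ?P = "{g::'e\<Rightarrow>real. \<forall>b. g b \<in> {- (R * K b) .. R * K b}}"
  let ?F = "\<lambda>g::'e\<Rightarrow>real. \<Sum>b\<in>B. g b *\<^sub>R b"
  have "compact ?P" by (rule compact_PiE_UNIV) simp
  moreover have "continuous_on ?P ?F" by (intro continuous_intros)
  ultimately have cF: "compact (?F ` ?P)" by (rule compact_continuous_image[rotated])
  have "cball a r \<subseteq> ?F ` ?P"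
  proof
    fix v assume "v \<in> cball a r"
    then have "norm v \<le> R"
      using norm_triangle_sub[of v a] by (simp add: R_def dist_norm norm_minus_commute)
    then have "norm v * K b \<le> R * K b" for b using K(1) by (rule mult_right_mono)
    then have "\<bar>representation B v b\<bar> \<le> R * K b" for b using K(2)[of v b] by (meson order_trans)
    then have "representation B v \<in> ?P" by (auto simp: abs_le_iff minus_le_iff)
    then show "v \<in> ?F ` ?P" by (rule image_eqI[rotated]) (simp add: finite_basis_expand)
  qed
  then have "(?F ` ?P) \<inter> cball a r = cball a r" by (rule Int_absorb1)
  moreover have "compact ((?F ` ?P) \<inter> cball a r)" by (rule compact_Int_closed[OF cF closed_cball])
  ultimately show ?thesis by (rule subst)
qed

end

section \<open>Calculus of maps of class C^k\<close>

lemma Ck_on_cong: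
  assumes "open S" "\<And>x. x \<in> S \<Longrightarrow> f x = g x"
  shows "Ck_on k S f \<longleftrightarrow> Ck_on k S g"
proof -
  have "Ck_on k S g" if "Ck_on k S f" "\<forall>x\<in>S. f x = g x" for f g
    using that
  proof (induction k arbitrary: f g)
    case 0 then show ?case by (auto cong: continuous_on_cong)
  next
    case (Suc k)
    have d: "f differentiable (at x)" if "x \<in> S" for x using Suc.prems that by simp
    have fd: "frechet_derivative f (at x) = frechet_derivative g (at x)" if "x \<in> S" for x
      using frechet_derivative_transform_within_open[OF d[OF that] assms(1) that] Suc.prems by blast
    have gd: "g differentiable (at x)" if "x \<in> S" for x
    proof -
      have "(f has_derivative frechet_derivative f (at x)) (at x)"
        using d[OF that] frechet_derivative_works by blast
      then have "(g has_derivative frechet_derivative f (at x)) (at x)"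
        by (rule has_derivative_transform_within_open[OF _ assms(1) that]) (use Suc.prems in auto)
      then show ?thesis by (auto simp: differentiable_def)
    qed
    have "Ck_on k S (\<lambda>x. frechet_derivative g (at x) v)" for v
      by (rule Suc.IH[of "\<lambda>x. frechet_derivative f (at x) v"]) (use Suc.prems fd in auto)
    then show ?case using gd by simp
  qed
  from this[of f g] this[of g f] show ?thesis using assms(2) by auto
qed

text \<open>
  The definition of \<open>Ck_on\<close> refers to \<open>frechet_derivative\<close>; this is the form in which a derivative that is
  already known can be used.
\<close>

lemma Ck_on_SucI:
  assumes "open S" "\<And>x. x \<in> S \<Longrightarrow> (f has_derivative f' x) (at x)"
    and "\<And>v. Ck_on k S (\<lambda>x. f' x v)"
  shows "Ck_on (Suc k) S f"
proof -
  have "Ck_on k S (\<lambda>x. frechet_derivative f (at x) v)" for v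
    using assms(3)[of v]
    by (subst Ck_on_cong[OF assms(1), of _ "\<lambda>x. f' x v"])
       (auto simp: frechet_derivative_at[OF assms(2), symmetric])
  then show ?thesis using assms(2) by (auto simp: differentiable_def)
qed

lemma Ck_on_SucD: "Ck_on (Suc k) S f \<Longrightarrow> Ck_on k S f"
proof (induction k arbitrary: f)
  case 0
  then have "\<forall>x\<in>S. f differentiable (at x)" by simp
  then show ?case
    using differentiable_imp_continuous_within continuous_at_imp_continuous_on by (metis Ck_on.simps(1))
next
  case (Suc k)
  then have "\<forall>x\<in>S. f differentiable (at x)" "\<And>v. Ck_on (Suc k) S (\<lambda>x. frechet_derivative f (at x) v)"
    using Ck_on.simps(2)[of "Suc k" S f] by blast+
  then show ?case using Suc.IH by (auto simp only: Ck_on.simps(2)[of k S f])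
qed

lemma Ck_on_has_derivative:
  "Ck_on (Suc k) S f \<Longrightarrow> x \<in> S \<Longrightarrow> (f has_derivative frechet_derivative f (at x)) (at x)"
  using frechet_derivative_works by auto

lemma Ck_on_subset: "Ck_on k S f \<Longrightarrow> R \<subseteq> S \<Longrightarrow> Ck_on k R f"
proof (induction k arbitrary: f)
  case 0 then show ?case by (auto intro: continuous_on_subset)
next
  case (Suc k) then show ?case by (metis Ck_on.simps(2) subsetD)
qed

lemma Ck_on_local:
  assumes "\<And>x. x \<in> S \<Longrightarrow> \<exists>U. open U \<and> x \<in> U \<and> Ck_on k U f"
  shows "Ck_on k S f"
  using assms
proof (induction k arbitrary: f)
  case 0
  have "isCont f x" if "x \<in> S" for x
    using 0[OF that] continuous_on_eq_continuous_at by auto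
  then show ?case by (simp add: continuous_at_imp_continuous_on)
next
  case (Suc k)
  have "Ck_on k S (\<lambda>x. frechet_derivative f (at x) v)" for v
    by (rule Suc.IH) (metis Suc.prems Ck_on.simps(2))
  moreover have "\<forall>x\<in>S. f differentiable (at x)" using Suc.prems Ck_on.simps(2) by metis
  ultimately show ?case by simp
qed

lemma Ck_on_const: "Ck_on k S (\<lambda>x. c)"
proof (induction k arbitrary: c)
  case (Suc k)
  have "frechet_derivative (\<lambda>x. c) (at x) = (\<lambda>v. 0)" for x :: 'a by simp
  then show ?case using Suc by simp
qed (simp add: continuous_on_const)

lemma Ck_on_bounded_linear: "bounded_linear f \<Longrightarrow> open S \<Longrightarrow> Ck_on k S f"
proof (cases k)
  case (Suc m)
  assume f: "bounded_linear f" and S: "open S"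
  show ?thesis unfolding Suc
    by (rule Ck_on_SucI[OF S, of _ "\<lambda>x. f"])
       (use f Ck_on_const in \<open>auto intro: bounded_linear_imp_has_derivative\<close>)
qed (simp add: linear_continuous_on)

lemma Ck_on_bounded_linear_compose:
  assumes h: "bounded_linear h" and S: "open S"
  shows "Ck_on k S f \<Longrightarrow> Ck_on k S (\<lambda>x. h (f x))"
proof (induction k arbitrary: f)
  case 0
  then show ?case
    using continuous_on_compose2[OF linear_continuous_on[OF h, of UNIV]] by fastforce
next
  case (Suc k)
  show ?case
    by (rule Ck_on_SucI[OF S, of _ "\<lambda>x v. h (frechet_derivative f (at x) v)"])
       (use Suc Ck_on_has_derivative[OF Suc.prems] h in \<open>auto intro: bounded_linear.has_derivative\<close>)
qed

lemma Ck_on_add: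
  assumes S: "open S"
  shows "Ck_on k S f \<Longrightarrow> Ck_on k S g \<Longrightarrow> Ck_on k S (\<lambda>x. f x + g x)"
proof (induction k arbitrary: f g)
  case 0 then show ?case by (auto intro: continuous_intros)
next
  case (Suc k)
  show ?case
    by (rule Ck_on_SucI[OF S, of _ "\<lambda>x v. frechet_derivative f (at x) v + frechet_derivative g (at x) v"])
      (use Suc Ck_on_has_derivative[OF Suc.prems(1)] Ck_on_has_derivative[OF Suc.prems(2)]
        in \<open>auto intro!: has_derivative_add\<close>)
qed

lemma Ck_on_sum:
  assumes "open S" "\<And>i. i \<in> I \<Longrightarrow> Ck_on k S (f i)"
  shows "Ck_on k S (\<lambda>x. \<Sum>i\<in>I. f i x)"
  using assms(2)
  by (induction I rule: infinite_finite_induct)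
     (auto intro: Ck_on_const Ck_on_add[OF assms(1)])

lemma Ck_on_bilinear:
  assumes pr: "bounded_bilinear pr" and S: "open S"
  shows "Ck_on k S f \<Longrightarrow> Ck_on k S g \<Longrightarrow> Ck_on k S (\<lambda>x. pr (f x) (g x))"
proof (induction k arbitrary: f g)
  case 0 then show ?case by (auto intro: bounded_bilinear.continuous_on[OF pr])
next
  case (Suc k)
  have "Ck_on k S f" "Ck_on k S g" using Suc.prems Ck_on_SucD by blast+
  then show ?case using Suc
    by (intro Ck_on_SucI[OF S, of _
        "\<lambda>x v. pr (f x) (frechet_derivative g (at x) v) + pr (frechet_derivative f (at x) v) (g x)"]
        bounded_bilinear.FDERIV[OF pr] Ck_on_add[OF S] Suc.IH Ck_on_has_derivative) auto
qed

lemma Ck_on_Pair: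
  assumes S: "open S" and "Ck_on k S f" "Ck_on k S g"
  shows "Ck_on k S (\<lambda>x. (f x, g x))"
proof -
  have "bounded_linear (\<lambda>u::'b. (u, 0::'c))" "bounded_linear (\<lambda>u::'c. (0::'b, u))"
    by (intro bounded_linear_Pair bounded_linear_ident bounded_linear_zero)+
  then have "Ck_on k S (\<lambda>x. (f x, 0) + (0, g x))"
    by (intro Ck_on_add[OF S] Ck_on_bounded_linear_compose[OF _ S, of "\<lambda>u. (u, 0)"]
        Ck_on_bounded_linear_compose[OF _ S, of "\<lambda>u. (0, u)"] assms(2,3))
  then show ?thesis by simp
qed

text \<open>
  In \<open>v \<mapsto> g' (f x) (f' x v)\<close> the direction \<open>f' x v\<close> at which \<open>g'\<close> is evaluated moves with \<open>x\<close>, whereas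
  \<open>Ck_on\<close> speaks of fixed directions. Expanding \<open>f' x v\<close> in a basis leaves only derivatives of \<open>g\<close> in fixed
  directions, multiplied by coordinate functions, to which the induction hypothesis applies.
\<close>

lemma Ck_on_compose:
  fixes f :: "'d::real_normed_vector \<Rightarrow> 'e::real_normed_vector" and g :: "'e \<Rightarrow> 'f::real_normed_vector"
  assumes B: "finite_basis (B::'e set)" and S: "open S"
  shows "Ck_on k S f \<Longrightarrow> Ck_on k R g \<Longrightarrow> f ` S \<subseteq> R \<Longrightarrow> Ck_on k S (\<lambda>x. g (f x))"
proof (induction k arbitrary: f g)
  case 0 then show ?case by (auto intro: continuous_on_compose2)
next
  case (Suc k)
  let ?f' = "\<lambda>x. frechet_derivative f (at x)" and ?g' = "\<lambda>y. frechet_derivative g (at y)"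
  have der: "((\<lambda>x. g (f x)) has_derivative (\<lambda>v. ?g' (f x) (?f' x v))) (at x)" if "x \<in> S" for x
    using has_derivative_compose[of f "?f' x" x UNIV g "?g' (f x)"]
      Ck_on_has_derivative[OF Suc.prems(1) that] Ck_on_has_derivative[OF Suc.prems(2), of "f x"]
      Suc.prems(3) that by auto
  have k: "Ck_on k S (\<lambda>x. ?g' (f x) (?f' x v))" for v
  proof -
    have "Ck_on k S (\<lambda>x. \<Sum>b\<in>B. representation B (?f' x v) b *\<^sub>R ?g' (f x) b)"
    proof (intro Ck_on_sum[OF S] Ck_on_bilinear[OF bounded_bilinear_scaleR S])
      fix b
      show "Ck_on k S (\<lambda>x. representation B (?f' x v) b)"
        by (rule Ck_on_bounded_linear_compose[OF finite_basis_bounded_linear_coord[OF B] S])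
           (use Suc.prems in simp)
      show "Ck_on k S (\<lambda>x. ?g' (f x) b)"
        by (rule Suc.IH) (use Suc.prems Ck_on_SucD[OF Suc.prems(1)] in auto)
    qed
    moreover have "?g' (f x) (?f' x v) = (\<Sum>b\<in>B. representation B (?f' x v) b *\<^sub>R ?g' (f x) b)"
      if "x \<in> S" for x
      by (rule finite_basis_linear_expand[OF B])
         (use Ck_on_has_derivative[OF Suc.prems(2), of "f x"] Suc.prems(3) that
            has_derivative_linear in blast)
    ultimately show ?thesis by (subst Ck_on_cong[OF S]) auto
  qed
  show ?case by (rule Ck_on_SucI[OF S der k])
qed

section \<open>Smooth maps\<close>

lemma smooth_on_cong:
  "open S \<Longrightarrow> (\<And>x. x \<in> S \<Longrightarrow> f x = g x) \<Longrightarrow> smooth_on S f \<longleftrightarrow> smooth_on S g"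
  unfolding smooth_on_def using Ck_on_cong by blast

lemma smooth_on_subset: "smooth_on S f \<Longrightarrow> R \<subseteq> S \<Longrightarrow> smooth_on R f"
  unfolding smooth_on_def using Ck_on_subset by blast

lemma smooth_on_local:
  "(\<And>x. x \<in> S \<Longrightarrow> \<exists>U. open U \<and> x \<in> U \<and> smooth_on U f) \<Longrightarrow> smooth_on S f"
  unfolding smooth_on_def using Ck_on_local by (metis (no_types, lifting))

lemma smooth_on_const: "smooth_on S (\<lambda>x. c)"
  by (simp add: smooth_on_def Ck_on_const)

lemma smooth_on_bounded_linear: "bounded_linear f \<Longrightarrow> open S \<Longrightarrow> smooth_on S f"
  by (simp add: smooth_on_def Ck_on_bounded_linear)

lemma smooth_on_id: "open S \<Longrightarrow> smooth_on S (\<lambda>x. x)"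
  by (simp add: smooth_on_bounded_linear bounded_linear_ident)

lemma smooth_on_bounded_linear_compose:
  "bounded_linear h \<Longrightarrow> open S \<Longrightarrow> smooth_on S f \<Longrightarrow> smooth_on S (\<lambda>x. h (f x))"
  by (simp add: smooth_on_def Ck_on_bounded_linear_compose)

lemma smooth_on_add: "open S \<Longrightarrow> smooth_on S f \<Longrightarrow> smooth_on S g \<Longrightarrow> smooth_on S (\<lambda>x. f x + g x)"
  by (simp add: smooth_on_def Ck_on_add)

lemma smooth_on_diff: "open S \<Longrightarrow> smooth_on S f \<Longrightarrow> smooth_on S g \<Longrightarrow> smooth_on S (\<lambda>x. f x - g x)"
  using smooth_on_add[of S f "\<lambda>x. - g x"]
    smooth_on_bounded_linear_compose[OF bounded_linear_minus[OF bounded_linear_ident], of S g] by simp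

lemma smooth_on_sum:
  "open S \<Longrightarrow> (\<And>i. i \<in> I \<Longrightarrow> smooth_on S (f i)) \<Longrightarrow> smooth_on S (\<lambda>x. \<Sum>i\<in>I. f i x)"
  by (simp add: smooth_on_def Ck_on_sum)

lemma smooth_on_bilinear:
  "bounded_bilinear pr \<Longrightarrow> open S \<Longrightarrow> smooth_on S f \<Longrightarrow> smooth_on S g \<Longrightarrow> smooth_on S (\<lambda>x. pr (f x) (g x))"
  by (simp add: smooth_on_def Ck_on_bilinear)

lemma smooth_on_mult:
  fixes f g :: "'e::real_normed_vector \<Rightarrow> real"
  shows "open S \<Longrightarrow> smooth_on S f \<Longrightarrow> smooth_on S g \<Longrightarrow> smooth_on S (\<lambda>x. f x * g x)"
  by (rule smooth_on_bilinear[OF bounded_bilinear_mult])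

lemma smooth_on_Pair:
  "open S \<Longrightarrow> smooth_on S f \<Longrightarrow> smooth_on S g \<Longrightarrow> smooth_on S (\<lambda>x. (f x, g x))"
  by (simp add: smooth_on_def Ck_on_Pair)

lemma smooth_on_compose:
  fixes f :: "'d::real_normed_vector \<Rightarrow> 'e::real_normed_vector"
  assumes "finite_basis (B::'e set)" "open S" "smooth_on S f" "smooth_on R g" "f ` S \<subseteq> R"
  shows "smooth_on S (\<lambda>x. g (f x))"
  using assms by (auto simp: smooth_on_def intro: Ck_on_compose)

lemma smooth_on_has_derivative:
  "smooth_on S f \<Longrightarrow> x \<in> S \<Longrightarrow> (f has_derivative frechet_derivative f (at x)) (at x)"
  by (rule Ck_on_has_derivative[of 0]) (simp_all only: smooth_on_def)

lemma smooth_on_linear_derivative: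
  "smooth_on S f \<Longrightarrow> x \<in> S \<Longrightarrow> linear (frechet_derivative f (at x))"
  using smooth_on_has_derivative has_derivative_linear by blast

lemma smooth_on_deriv: "smooth_on S f \<Longrightarrow> smooth_on S (\<lambda>x. frechet_derivative f (at x) v)"
  unfolding smooth_on_def by (metis Ck_on.simps(2))

lemma smooth_on_continuous: "smooth_on S f \<Longrightarrow> continuous_on S f"
  unfolding smooth_on_def by (metis Ck_on.simps(1))

text \<open>
  On a compact set the finitely many directional derivatives along a basis are bounded, and with them
  the operator norm of the derivative; the mean value inequality does the rest.
\<close>

lemma smooth_on_lipschitz:
  fixes h :: "'e::real_normed_vector \<Rightarrow> 'f::real_normed_vector"
  assumes B: "finite_basis (B::'e set)" and h: "smooth_on S h"
    and K: "compact K" "convex K" "K \<subseteq> S"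
  shows "\<exists>M\<ge>0. \<forall>y\<in>K. \<forall>z\<in>K. norm (h z - h y) \<le> M * norm (z - y)"
proof -
  have "\<exists>M. \<forall>x\<in>K. norm (frechet_derivative h (at x) b) \<le> M" for b
  proof -
    have "compact ((\<lambda>x. frechet_derivative h (at x) b) ` K)"
      using smooth_on_continuous[OF smooth_on_deriv[OF h]] K
      by (intro compact_continuous_image) (auto intro: continuous_on_subset)
    from compact_imp_bounded[OF this] obtain M
      where "\<forall>y\<in>(\<lambda>x. frechet_derivative h (at x) b) ` K. norm y \<le> M" unfolding bounded_iff by blast
    then show ?thesis by blast
  qed
  then obtain m where m: "\<And>b x. x \<in> K \<Longrightarrow> norm (frechet_derivative h (at x) b) \<le> m b" by metis
  define M where "M = (\<Sum>b\<in>B. \<bar>m b\<bar>)"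
  have le: "norm (frechet_derivative h (at x) b) \<le> M" if "x \<in> K" "b \<in> B" for x b
  proof -
    have "\<bar>m b\<bar> \<le> M" unfolding M_def using that finite_basis_finite[OF B] by (intro member_le_sum) auto
    then show ?thesis using m[OF that(1), of b] by linarith
  qed
  obtain C where C: "C \<ge> 0" "\<And>(f::'e\<Rightarrow>'f) M v. linear f \<Longrightarrow> (\<And>b. b \<in> B \<Longrightarrow> norm (f b) \<le> M) \<Longrightarrow>
      norm (f v) \<le> C * M * norm v"
    by (rule finite_basis_norm_bound[OF B]) blast
  have "norm (h z - h y) \<le> C * M * norm (z - y)" if "y \<in> K" "z \<in> K" for y z
  proof (rule differentiable_bound[OF K(2) _ _ that(2) that(1)])
    fix x assume x: "x \<in> K"
    show "(h has_derivative frechet_derivative h (at x)) (at x within K)"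
      using smooth_on_has_derivative[OF h] x K has_derivative_at_withinI by blast
    show "onorm (frechet_derivative h (at x)) \<le> C * M"
    proof (rule onorm_bound)
      show "norm (frechet_derivative h (at x) v) \<le> C * M * norm v" for v
        by (rule C(2)[OF smooth_on_linear_derivative[OF h] le[OF x]]) (use x K in auto)
    qed (use C in \<open>simp add: M_def sum_nonneg\<close>)
  qed
  moreover have "C * M \<ge> 0" using C by (simp add: M_def sum_nonneg)
  ultimately show ?thesis by blast
qed

lemma smooth_on_lipschitz_deriv:
  fixes h :: "'e::real_normed_vector \<Rightarrow> 'f::real_normed_vector"
  assumes B: "finite_basis (B::'e set)" and h: "smooth_on S h"
    and K: "compact K" "convex K" "K \<subseteq> S"
  shows "\<exists>M\<ge>0. \<forall>y\<in>K. \<forall>z\<in>K. \<forall>w.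
    norm (frechet_derivative h (at z) w - frechet_derivative h (at y) w) \<le> M * norm (z - y) * norm w"
proof -
  let ?D = "\<lambda>x. frechet_derivative h (at x)"
  have "\<exists>M\<ge>0. \<forall>y\<in>K. \<forall>z\<in>K. norm (?D z b - ?D y b) \<le> M * norm (z - y)" for b
    by (rule smooth_on_lipschitz[OF B smooth_on_deriv[OF h] K])
  then obtain m where m: "\<And>b. m b \<ge> 0"
    "\<And>b y z. y \<in> K \<Longrightarrow> z \<in> K \<Longrightarrow> norm (?D z b - ?D y b) \<le> m b * norm (z - y)" by metis
  obtain C where C: "C \<ge> 0" "\<And>(f::'e\<Rightarrow>'f) M v. linear f \<Longrightarrow> (\<And>b. b \<in> B \<Longrightarrow> norm (f b) \<le> M) \<Longrightarrow>
      norm (f v) \<le> C * M * norm v"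
    by (rule finite_basis_norm_bound[OF B]) blast
  define M where "M = (\<Sum>b\<in>B. m b)"
  have "norm (?D z w - ?D y w) \<le> C * (M * norm (z - y)) * norm w" if "y \<in> K" "z \<in> K" for y z w
  proof (rule C(2))
    show "linear (\<lambda>w. ?D z w - ?D y w)"
      using smooth_on_linear_derivative[OF h] that K by (intro linear_compose_sub) auto
    have "m b \<le> M" if "b \<in> B" for b
      unfolding M_def using that finite_basis_finite[OF B] m by (intro member_le_sum) auto
    then show "norm (?D z b - ?D y b) \<le> M * norm (z - y)" if "b \<in> B" for b
      using m(2)[OF \<open>y \<in> K\<close> \<open>z \<in> K\<close>, of b] that mult_right_mono[of "m b" M "norm (z - y)"] by fastforce
  qed
  then show ?thesis using C(1) m(1) by (intro exI[of _ "C*M"]) (auto simp: M_def sum_nonneg mult_ac)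
qed

text \<open>
  The mean value inequality for \<open>x \<mapsto> h x - h' y x\<close> on the segment from \<open>y\<close> to \<open>z\<close>, whose derivative
  \<open>h' x - h' y\<close> is small by Lipschitz continuity of \<open>h'\<close>.
\<close>

lemma smooth_on_taylor2:
  fixes h :: "'e::real_normed_vector \<Rightarrow> 'f::real_normed_vector"
  assumes B: "finite_basis (B::'e set)" and h: "smooth_on S h"
    and K: "compact K" "convex K" "K \<subseteq> S"
  shows "\<exists>M\<ge>0. \<forall>y\<in>K. \<forall>z\<in>K.
    norm (h z - h y - frechet_derivative h (at y) (z - y)) \<le> M * (norm (z - y))\<^sup>2"
proof -
  let ?D = "\<lambda>x. frechet_derivative h (at x)"
  obtain M where M: "M \<ge> 0" "\<And>y z w. y \<in> K \<Longrightarrow> z \<in> K \<Longrightarrow> norm (?D z w - ?D y w) \<le> M * norm (z - y) * norm w"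
    using smooth_on_lipschitz_deriv[OF assms] by blast
  have "norm (h z - h y - ?D y (z - y)) \<le> M * (norm (z - y))\<^sup>2" if yz: "y \<in> K" "z \<in> K" for y z
  proof -
    have sub: "closed_segment y z \<subseteq> K" using yz K(2) by (simp add: closed_segment_subset)
    have "norm ((h z - ?D y z) - (h y - ?D y y)) \<le> (M * norm (z - y)) * norm (z - y)"
    proof (rule differentiable_bound[of "closed_segment y z" "\<lambda>x. h x - ?D y x" "\<lambda>x w. ?D x w - ?D y w"])
      fix x assume x: "x \<in> closed_segment y z"
      then have xK: "x \<in> K" using sub by blast
      have "(h has_derivative ?D x) (at x)" using smooth_on_has_derivative[OF h] xK K by blast
      moreover have "bounded_linear (?D y)"
        using smooth_on_has_derivative[OF h, of y] yz K has_derivative_bounded_linear by blast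
      ultimately show "((\<lambda>x. h x - ?D y x) has_derivative (\<lambda>w. ?D x w - ?D y w)) (at x within closed_segment y z)"
        by (rule has_derivative_at_withinI[OF has_derivative_diff[OF _ bounded_linear_imp_has_derivative]])
      have "norm (x - y) \<le> norm (z - y)" using segment_bound1[OF x] by simp
      then have "M * norm (x - y) * norm w \<le> M * norm (z - y) * norm w" for w
        using M(1) by (intro mult_right_mono mult_left_mono) auto
      then show "onorm (\<lambda>w. ?D x w - ?D y w) \<le> M * norm (z - y)"
        using M(1) by (intro onorm_bound order_trans[OF M(2)[OF yz(1) xK]]) auto
    qed auto
    moreover have "linear (?D y)" using smooth_on_linear_derivative[OF h, of y] yz K by blast
    then have "h z - h y - ?D y (z - y) = (h z - ?D y z) - (h y - ?D y y)" by (simp add: linear_diff)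
    ultimately show ?thesis by (simp only: power2_eq_square mult.assoc)
  qed
  then show ?thesis using M(1) by blast
qed

section \<open>Charts\<close>

locale topological_chart =
  fixes T :: "'a topology" and U :: "'a set" and \<psi> :: "'a \<Rightarrow> 'e::real_normed_vector"
  assumes open_U: "openin T U"
    and \<psi>_homeo: "homeomorphic_map (subtopology T U) (top_of_set (\<psi> ` U)) \<psi>"
    and open_image: "open (\<psi> ` U)"
begin

lemma U_subset: "U \<subseteq> topspace T"
  by (rule openin_subset[OF open_U])

lemma U_topspace: "topspace (subtopology T U) = U"
  using U_subset by (simp add: Int_absorb1)

lemma \<psi>_inj: "inj_on \<psi> U"
  using homeomorphic_imp_injective_map[OF \<psi>_homeo] by (simp only: U_topspace)

lemma \<psi>_continuous: "continuous_map (subtopology T U) (top_of_set (\<psi> ` U)) \<psi>"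
  using \<psi>_homeo by (rule homeomorphic_imp_continuous_map)

lemma \<psi>_inverse_continuous: "continuous_map (top_of_set (\<psi> ` U)) T (inv_into U \<psi>)"
proof -
  obtain g where g: "homeomorphic_maps (subtopology T U) (top_of_set (\<psi> ` U)) \<psi> g"
    using \<psi>_homeo unfolding homeomorphic_map_maps by blast
  then have g1: "continuous_map (top_of_set (\<psi> ` U)) (subtopology T U) g" and g2: "\<And>x. x \<in> U \<Longrightarrow> g (\<psi> x) = x"
    unfolding homeomorphic_maps_def U_topspace by blast+
  have "g y = inv_into U \<psi> y" if "y \<in> topspace (top_of_set (\<psi> ` U))" for y
    using that g2 \<psi>_inj by auto
  then have "continuous_map (top_of_set (\<psi> ` U)) (subtopology T U) (inv_into U \<psi>)"
    by (rule continuous_map_eq[OF g1])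
  then show ?thesis by (rule continuous_map_into_fulltopology)
qed

lemma chart_preimage_open:
  assumes "open O'" shows "openin T {x \<in> U. \<psi> x \<in> O'}"
proof -
  have "openin (top_of_set (\<psi> ` U)) (\<psi> ` U \<inter> O')" using assms by auto
  then have "openin (subtopology T U) {x \<in> topspace (subtopology T U). \<psi> x \<in> \<psi> ` U \<inter> O'}"
    by (rule openin_continuous_map_preimage[OF \<psi>_continuous])
  moreover have "{x \<in> topspace (subtopology T U). \<psi> x \<in> \<psi> ` U \<inter> O'} = {x \<in> U. \<psi> x \<in> O'}"
    unfolding U_topspace by auto
  ultimately show ?thesis using open_U openin_trans_full by metis
qed

lemma chart_image_open:
  assumes "openin T W" shows "open (\<psi> ` (U \<inter> W))"
proof -
  have "openin (subtopology T U) (U \<inter> W)" using assms by (metis inf_commute openin_subtopology)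
  then have "openin (top_of_set (\<psi> ` U)) (\<psi> ` (U \<inter> W))"
    using homeomorphic_map_openness_eq[OF \<psi>_homeo] by blast
  then show ?thesis using open_image by (simp add: openin_open_eq)
qed

end

section \<open>Smooth bump functions\<close>

text \<open>
  For \<open>p = 1\<close> this is the classical flat function \<open>exp (- 1 / t)\<close>. Allowing a polynomial in \<open>1 / t\<close> as a factor
  makes the family closed under differentiation, so that smoothness is a single induction.
\<close>

definition flat_exp :: "real poly \<Rightarrow> real \<Rightarrow> real" where
  "flat_exp p t = (if t > 0 then poly p (inverse t) * exp (- inverse t) else 0)"

lemma poly_times_exp_tendsto_0: "((\<lambda>s::real. poly p s * exp (- s)) \<longlongrightarrow> 0) at_top"
proof -
  have "((\<lambda>s::real. \<Sum>i\<le>degree p. coeff p i * (s ^ i / exp s)) \<longlongrightarrow> (\<Sum>i\<le>degree p. coeff p i * 0)) at_top"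
    by (intro tendsto_sum tendsto_mult tendsto_const tendsto_power_div_exp_0)
  then show ?thesis
    by (simp add: poly_altdef sum_distrib_right exp_minus divide_inverse mult.assoc)
qed

lemma flat_exp_tendsto_0: "(flat_exp p \<longlongrightarrow> 0) (at 0)"
proof (rule filterlim_split_at)
  have "\<forall>\<^sub>F t in at_left (0::real). flat_exp p t = 0"
    by (simp add: eventually_at_filter flat_exp_def)
  then show "(flat_exp p \<longlongrightarrow> 0) (at_left 0)" by (rule tendsto_eventually)
  have "((\<lambda>t::real. poly p (inverse t) * exp (- inverse t)) \<longlongrightarrow> 0) (at_right 0)"
    by (rule filterlim_compose[OF poly_times_exp_tendsto_0 filterlim_inverse_at_top_right])
  moreover have "\<forall>\<^sub>F t in at_right (0::real). poly p (inverse t) * exp (- inverse t) = flat_exp p t"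
    by (simp add: eventually_at_filter flat_exp_def)
  ultimately show "(flat_exp p \<longlongrightarrow> 0) (at_right 0)" by (rule Lim_transform_eventually)
qed

lemma flat_exp_has_derivative:
  "(flat_exp p has_real_derivative flat_exp (monom 1 2 * (p - pderiv p)) t) (at t)"
proof -
  consider "t > 0" | "t < 0" | "t = 0" by linarith
  then show ?thesis
  proof cases
    case 1
    have "((\<lambda>t. poly p (inverse t) * exp (- inverse t)) has_real_derivative
        flat_exp (monom 1 2 * (p - pderiv p)) t) (at t)"
      using 1 by (auto intro!: derivative_eq_intros DERIV_chain2[where f="poly p", OF poly_DERIV]
          simp: flat_exp_def poly_monom power2_eq_square algebra_simps)
    then show ?thesis
      by (rule has_field_derivative_transform_within_open[where S="{0<..}"]) (use 1 in \<open>auto simp: flat_exp_def\<close>)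
  next
    case 2
    have "((\<lambda>t. 0) has_real_derivative flat_exp (monom 1 2 * (p - pderiv p)) t) (at t)"
      using 2 by (simp add: flat_exp_def)
    then show ?thesis
      by (rule has_field_derivative_transform_within_open[where S="{..<0}"]) (use 2 in \<open>auto simp: flat_exp_def\<close>)
  next
    case 3
    have "(flat_exp p (0 + h) - flat_exp p 0) / h = flat_exp (pCons 0 p) h" for h
      by (auto simp: flat_exp_def field_simps)
    then have "((\<lambda>h. (flat_exp p (0 + h) - flat_exp p 0) / h) \<longlongrightarrow> 0) (at 0)"
      using flat_exp_tendsto_0[of "pCons 0 p"] by (simp only:)
    moreover have "flat_exp q 0 = 0" for q by (simp add: flat_exp_def)
    ultimately show ?thesis unfolding 3 DERIV_def by simp
  qed
qed

lemma smooth_on_flat_exp: "smooth_on UNIV (flat_exp p)"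
proof -
  have "Ck_on k UNIV (flat_exp p)" for k
  proof (induction k arbitrary: p)
    case 0
    show ?case
      using flat_exp_has_derivative[of p] by (auto intro: DERIV_isCont continuous_at_imp_continuous_on)
  next
    case (Suc k)
    show ?case
      by (rule Ck_on_SucI[of _ _ "\<lambda>t v. flat_exp (monom 1 2 * (p - pderiv p)) t * v"])
        (use flat_exp_has_derivative[of p] Suc
          in \<open>auto simp: has_field_derivative_def intro: Ck_on_bounded_linear_compose[OF bounded_linear_mult_left]\<close>)
  qed
  then show ?thesis by (simp add: smooth_on_def)
qed

lemma smooth_on_inverse:
  fixes g :: "'e::real_normed_vector \<Rightarrow> real"
  assumes S: "open S" and g: "smooth_on S g" and nz: "\<And>x. x \<in> S \<Longrightarrow> g x \<noteq> 0"
  shows "smooth_on S (\<lambda>x. inverse (g x))"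
proof -
  have "Ck_on k S (\<lambda>x. inverse (g x))" for k
  proof (induction k)
    case 0
    show ?case using smooth_on_continuous[OF g] nz by (auto intro: continuous_on_inverse)
  next
    case (Suc k)
    show ?case
    proof (rule Ck_on_SucI[OF S])
      fix x assume x: "x \<in> S"
      show "((\<lambda>x. inverse (g x)) has_derivative
          (\<lambda>v. - (inverse (g x) * frechet_derivative g (at x) v * inverse (g x)))) (at x)"
        by (rule Deriv.has_derivative_inverse[OF nz[OF x] smooth_on_has_derivative[OF g x]])
    next
      fix v
      have "Ck_on k S (\<lambda>x. frechet_derivative g (at x) v)"
        using smooth_on_deriv[OF g] by (simp add: smooth_on_def)
      then have "Ck_on k S (\<lambda>x. inverse (g x) * frechet_derivative g (at x) v * inverse (g x))"
        using Suc by (intro Ck_on_bilinear[OF bounded_bilinear_mult S])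
      then show "Ck_on k S (\<lambda>x. - (inverse (g x) * frechet_derivative g (at x) v * inverse (g x)))"
        by (rule Ck_on_bounded_linear_compose[OF bounded_linear_minus[OF bounded_linear_ident] S])
    qed
  qed
  then show ?thesis by (simp add: smooth_on_def)
qed

text \<open>
  With \<open>e\<close> the flat function, the quotient of \<open>e (2 - t)\<close> by \<open>e (2 - t) + e (t - 1)\<close> has a positive denominator
  and is \<open>1\<close> where its second summand vanishes, \<open>0\<close> where its first one does.
\<close>

lemma smooth_step:
  "\<exists>h::real \<Rightarrow> real. smooth_on UNIV h \<and> (\<forall>t\<le>1. h t = 1) \<and> (\<forall>t\<ge>2. h t = 0)"
proof -
  obtain R :: "real set" where R: "finite_basis R" using finite_basis_real by blast
  define e where "e = flat_exp 1"
  have e: "e t > 0" if "t > 0" for t using that by (simp add: e_def flat_exp_def)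
  have e0: "e t = 0" if "t \<le> 0" for t using that by (simp add: e_def flat_exp_def)
  have en: "e t \<ge> 0" for t using e e0 by (metis less_eq_real_def linorder_not_less)
  have se: "smooth_on UNIV e" unfolding e_def by (rule smooth_on_flat_exp)
  have s1: "smooth_on UNIV (\<lambda>t. e (2 - t))"
    by (rule smooth_on_compose[OF R open_UNIV smooth_on_diff[OF open_UNIV smooth_on_const smooth_on_id[OF open_UNIV]] se subset_UNIV])
  have s2: "smooth_on UNIV (\<lambda>t. e (t - 1))"
    by (rule smooth_on_compose[OF R open_UNIV smooth_on_diff[OF open_UNIV smooth_on_id[OF open_UNIV] smooth_on_const] se subset_UNIV])
  have pos: "e (2 - t) + e (t - 1) \<noteq> 0" for t
  proof (cases "t < 2")
    case True then show ?thesis using e[of "2 - t"] en[of "t - 1"] by simp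
  next
    case False then show ?thesis using e[of "t - 1"] en[of "2 - t"] by simp
  qed
  show ?thesis
  proof (intro exI conjI allI impI)
    show "smooth_on UNIV (\<lambda>t. e (2 - t) * inverse (e (2 - t) + e (t - 1)))"
      by (intro smooth_on_mult smooth_on_inverse smooth_on_add s1 s2 pos open_UNIV)
    fix t :: real
    show "e (2 - t) * inverse (e (2 - t) + e (t - 1)) = 1" if "t \<le> 1"
      using e[of "2 - t"] e0[of "t - 1"] that by simp
    show "e (2 - t) * inverse (e (2 - t) + e (t - 1)) = 0" if "2 \<le> t"
      using e0[of "2 - t"] that by simp
  qed
qed

text \<open>
  The norm of the model space need not be smooth, so the step function is applied to a multiple of the
  sum of the squared coordinates. The factor is chosen so that \<open>norm (u - p) \<ge> r\<close> forces the argument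
  to be at least \<open>2\<close>.
\<close>

lemma smooth_bump:
  fixes p :: "'e::real_normed_vector"
  assumes B: "finite_basis (B::'e set)" and r: "r > 0"
  obtains \<beta> :: "'e \<Rightarrow> real" and W where "smooth_on UNIV \<beta>" "open W" "p \<in> W" "\<And>u. u \<in> W \<Longrightarrow> \<beta> u = 1"
    "\<And>u. norm (u - p) \<ge> r \<Longrightarrow> \<beta> u = 0"
proof -
  obtain h :: "real \<Rightarrow> real" where h: "smooth_on UNIV h" "\<And>t. t \<le> 1 \<Longrightarrow> h t = 1" "\<And>t. t \<ge> 2 \<Longrightarrow> h t = 0"
    using smooth_step by blast
  obtain R :: "real set" where R: "finite_basis R" using finite_basis_real by blast
  define N where "N = (\<Sum>b\<in>B. norm b) + 1"
  have N: "N > 0" by (simp add: N_def sum_nonneg add_nonneg_pos)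
  define q where "q u = (2 * N\<^sup>2 / r\<^sup>2) * (\<Sum>b\<in>B. representation B (u - p) b * representation B (u - p) b)" for u
  have sq: "smooth_on UNIV q"
    unfolding q_def
    by (intro smooth_on_mult smooth_on_const smooth_on_sum open_UNIV
        smooth_on_bounded_linear_compose[OF finite_basis_bounded_linear_coord[OF B]] smooth_on_diff smooth_on_id)
  have "q p = 0" by (simp add: q_def real_vector.representation_zero)
  have large: "q u \<ge> 2" if "norm (u - p) \<ge> r" for u
  proof -
    have "\<exists>b\<in>B. r \<le> \<bar>representation B (u - p) b\<bar> * N"
    proof (rule ccontr)
      assume "\<not> ?thesis"
      then have lt: "\<bar>representation B (u - p) b\<bar> \<le> r / N" if "b \<in> B" for b
        using that N by (auto simp: field_simps not_le less_imp_le)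
      have "norm (u - p) = norm (\<Sum>b\<in>B. representation B (u - p) b *\<^sub>R b)"
        by (simp add: finite_basis_expand[OF B])
      also have "\<dots> \<le> (\<Sum>b\<in>B. (r / N) * norm b)"
        by (intro order_trans[OF norm_sum] sum_mono) (use mult_right_mono[OF lt norm_ge_zero] in simp)
      also have "\<dots> = (r / N) * (N - 1)" by (simp add: N_def sum_distrib_left)
      also have "\<dots> < r" using N r by (simp add: field_simps)
      finally show False using that by simp
    qed
    then obtain b where b: "b \<in> B" "r / N \<le> \<bar>representation B (u - p) b\<bar>"
      using N by (auto simp: field_simps)
    have "(r / N)\<^sup>2 \<le> representation B (u - p) b * representation B (u - p) b"
      using power_mono[OF b(2), of 2] r N by (simp add: power2_eq_square abs_mult_self_eq)
    also have "\<dots> \<le> (\<Sum>b\<in>B. representation B (u - p) b * representation B (u - p) b)"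
      using b(1) finite_basis_finite[OF B] by (intro member_le_sum) auto
    finally have "(2 * N\<^sup>2 / r\<^sup>2) * (r / N)\<^sup>2 \<le> q u"
      unfolding q_def by (intro mult_left_mono) auto
    then show ?thesis using r N by (simp add: power_divide)
  qed
  show ?thesis
  proof (rule that[of "\<lambda>u. h (q u)" "q -` {..<1}"])
    show "smooth_on UNIV (\<lambda>u. h (q u))" by (rule smooth_on_compose[OF R _ sq h(1)]) auto
    show "open (q -` {..<1})"
      using smooth_on_continuous[OF sq] by (simp add: continuous_on_open_vimage)
    show "p \<in> q -` {..<1}" by (simp add: \<open>q p = 0\<close>)
  qed (use h large in auto)
qed

section \<open>Hadamard's lemma\<close>

text \<open>
  The coefficient functions in Hadamard's lemma are integrals of derivatives along rays. The power of \<open>t\<close>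
  records the factor that each differentiation under the integral sign produces.
\<close>

definition ray_integral :: "nat \<Rightarrow> ('e::real_normed_vector \<Rightarrow> real) \<Rightarrow> 'e \<Rightarrow> real" where
  "ray_integral a H u = integral {0..1} (\<lambda>t. t ^ a * H (t *\<^sub>R u))"

lemma continuous_on_ray:
  fixes H :: "'e::real_normed_vector \<Rightarrow> real"
  assumes "continuous_on UNIV H"
  shows "continuous_on S (\<lambda>t. t ^ a * (H (t *\<^sub>R u) :: real))"
  by (intro continuous_on_mult continuous_on_power continuous_on_id continuous_on_compose2[OF assms]
      continuous_on_scaleR continuous_on_const) simp

lemma integrable_ray:
  fixes H :: "'e::real_normed_vector \<Rightarrow> real"
  shows "continuous_on UNIV H \<Longrightarrow> (\<lambda>t. t ^ a * (H (t *\<^sub>R u) :: real)) integrable_on {0..1}"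
  by (intro integrable_continuous_real continuous_on_ray)

text \<open>
  Differentiation under the integral sign, with the second order Taylor estimate on a ball containing
  all the rays as the uniform bound on the error.
\<close>

lemma ray_integral_has_derivative:
  fixes H :: "'e::real_normed_vector \<Rightarrow> real"
  assumes B: "finite_basis (B::'e set)" and H: "smooth_on UNIV H"
  shows "(ray_integral a H has_derivative
    (\<lambda>v. ray_integral (Suc a) (\<lambda>y. frechet_derivative H (at y) v) u)) (at u)"
proof -
  let ?D = "\<lambda>y. frechet_derivative H (at y)"
  let ?K = "cball (0::'e) (norm u + 1)"
  have cH: "continuous_on UNIV H" by (rule smooth_on_continuous[OF H])
  have cD: "continuous_on UNIV (\<lambda>y. ?D y v)" for v by (rule smooth_on_continuous[OF smooth_on_deriv[OF H]])
  have lD: "linear (?D y)" for y by (rule smooth_on_linear_derivative[OF H]) simp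
  obtain M where M: "M \<ge> 0" "\<And>y z. y \<in> ?K \<Longrightarrow> z \<in> ?K \<Longrightarrow> norm (H z - H y - ?D y (z - y)) \<le> M * (norm (z - y))\<^sup>2"
    using smooth_on_taylor2[OF B H finite_basis_compact_cball[OF B] convex_cball] by blast
  have lin: "linear (\<lambda>v. ray_integral (Suc a) (\<lambda>y. ?D y v) u)"
  proof (rule linearI)
    fix v w :: 'e and r :: real
    show "ray_integral (Suc a) (\<lambda>y. ?D y (v + w)) u =
        ray_integral (Suc a) (\<lambda>y. ?D y v) u + ray_integral (Suc a) (\<lambda>y. ?D y w) u"
      unfolding ray_integral_def linear_add[OF lD] distrib_left
      by (intro integral_add integrable_ray cD)
    show "ray_integral (Suc a) (\<lambda>y. ?D y (r *\<^sub>R v)) u = r *\<^sub>R ray_integral (Suc a) (\<lambda>y. ?D y v) u"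
      unfolding ray_integral_def linear_cmul[OF lD] by (simp add: mult.left_commute)
  qed
  show ?thesis
  proof (rule has_derivativeI_sandwich[of 1])
    show "bounded_linear (\<lambda>v. ray_integral (Suc a) (\<lambda>y. ?D y v) u)"
      by (rule finite_basis_linear_bounded[OF B lin])
    have "((\<lambda>y. M * norm (y - u)) \<longlongrightarrow> M * norm (u - u)) (at u)"
      by (intro tendsto_intros)
    then show "((\<lambda>y. M * norm (y - u)) \<longlongrightarrow> 0) (at u)" by simp
    fix y assume y: "y \<noteq> u" "dist y u < 1"
    have "ray_integral a H y - ray_integral a H u - ray_integral (Suc a) (\<lambda>x. ?D x (y - u)) u =
      integral {0..1} (\<lambda>t. t ^ a * H (t *\<^sub>R y) - t ^ a * H (t *\<^sub>R u) - t ^ Suc a * ?D (t *\<^sub>R u) (y - u))"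
      unfolding ray_integral_def
      by (simp only: integral_diff integrable_diff integrable_ray[OF cH] integrable_ray[OF cD])
    also have "norm \<dots> \<le> (M * (norm (y - u))\<^sup>2) * (1 - 0)"
    proof (rule integral_bound)
      show "continuous_on {0..1} (\<lambda>t. t ^ a * H (t *\<^sub>R y) - t ^ a * H (t *\<^sub>R u) - t ^ Suc a * ?D (t *\<^sub>R u) (y - u))"
        by (intro continuous_on_diff continuous_on_ray cH cD)
      fix t :: real assume t: "t \<in> {0..1}"
      have in_ball: "t *\<^sub>R x \<in> ?K" if "norm x \<le> norm u + 1" for x
      proof -
        have "\<bar>t\<bar> * norm x \<le> 1 * (norm u + 1)" using t that by (intro mult_mono) auto
        then show ?thesis by simp
      qed
      have "norm y \<le> norm u + 1"
        using y norm_triangle_sub[of y u] by (simp add: dist_norm)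
      then have "norm (H (t *\<^sub>R y) - H (t *\<^sub>R u) - ?D (t *\<^sub>R u) (t *\<^sub>R y - t *\<^sub>R u)) \<le> M * (norm (t *\<^sub>R y - t *\<^sub>R u))\<^sup>2"
        by (intro M(2) in_ball) auto
      also have "norm (t *\<^sub>R y - t *\<^sub>R u) = \<bar>t\<bar> * norm (y - u)"
        by (simp add: scaleR_diff_right[symmetric])
      also have "M * (\<bar>t\<bar> * norm (y - u))\<^sup>2 \<le> M * (1 * norm (y - u))\<^sup>2"
        using t M(1) by (intro mult_left_mono power_mono mult_right_mono) auto
      finally have *: "norm (H (t *\<^sub>R y) - H (t *\<^sub>R u) - ?D (t *\<^sub>R u) (t *\<^sub>R y - t *\<^sub>R u)) \<le> M * (norm (y - u))\<^sup>2" by simp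
      have "t ^ a * H (t *\<^sub>R y) - t ^ a * H (t *\<^sub>R u) - t ^ Suc a * ?D (t *\<^sub>R u) (y - u) =
          t ^ a * (H (t *\<^sub>R y) - H (t *\<^sub>R u) - ?D (t *\<^sub>R u) (t *\<^sub>R y - t *\<^sub>R u))"
        unfolding scaleR_diff_right[symmetric] linear_cmul[OF lD]
        by (simp only: right_diff_distrib real_scaleR_def power_Suc mult_ac)
      also have "norm \<dots> \<le> 1 * norm (H (t *\<^sub>R y) - H (t *\<^sub>R u) - ?D (t *\<^sub>R u) (t *\<^sub>R y - t *\<^sub>R u))"
        unfolding norm_mult using t by (intro mult_right_mono) (auto simp: power_le_one)
      finally show "norm (t ^ a * H (t *\<^sub>R y) - t ^ a * H (t *\<^sub>R u) - t ^ Suc a * ?D (t *\<^sub>R u) (y - u)) \<le> M * (norm (y - u))\<^sup>2"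
        using * by simp
    qed simp
    finally show "norm (ray_integral a H y - ray_integral a H u - ray_integral (Suc a) (\<lambda>x. ?D x (y - u)) u) / norm (y - u) \<le> M * norm (y - u)"
      using y by (simp add: field_simps power2_eq_square)
  qed simp
qed

lemma smooth_on_ray_integral:
  fixes H :: "'e::real_normed_vector \<Rightarrow> real"
  assumes B: "finite_basis (B::'e set)" and H: "smooth_on UNIV H"
  shows "smooth_on UNIV (ray_integral a H)"
proof -
  have "Ck_on k UNIV (ray_integral a H)" for k
    using H
  proof (induction k arbitrary: a H)
    case 0
    show ?case
      using ray_integral_has_derivative[OF B 0]
      by (auto intro: has_derivative_continuous continuous_at_imp_continuous_on)
  next
    case (Suc k)
    show ?case
      by (rule Ck_on_SucI[OF open_UNIV ray_integral_has_derivative[OF B Suc.prems]])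
         (rule Suc.IH[OF smooth_on_deriv[OF Suc.prems]])
  qed
  then show ?thesis by (simp add: smooth_on_def)
qed

text \<open>
  Integrate \<open>t \<mapsto> F' (p + t (u - p)) (u - p)\<close> over the unit interval and expand \<open>u - p\<close> in coordinates.
\<close>

lemma hadamard:
  fixes F :: "'e::real_normed_vector \<Rightarrow> real"
  assumes B: "finite_basis (B::'e set)" and F: "smooth_on UNIV F"
  obtains g where "\<And>b. smooth_on UNIV (g b)" "\<And>b. g b p = frechet_derivative F (at p) b"
    "\<And>u. F u = F p + (\<Sum>b\<in>B. representation B (u - p) b * g b u)"
proof -
  define G where "G v = F (p + v)" for v
  have sh: "smooth_on UNIV (\<lambda>v. p + v)" for p :: 'e
    by (intro smooth_on_add smooth_on_const smooth_on_id open_UNIV)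
  have sG: "smooth_on UNIV G"
    unfolding G_def by (rule smooth_on_compose[OF B open_UNIV sh F]) simp
  let ?D = "\<lambda>y. frechet_derivative G (at y)"
  have DG: "?D 0 = frechet_derivative F (at p)"
  proof -
    have "((\<lambda>v. p + v) has_derivative (\<lambda>v. v)) (at 0)" by (auto intro!: derivative_eq_intros)
    moreover have "(F has_derivative frechet_derivative F (at p)) (at (p + 0))"
      using smooth_on_has_derivative[OF F] by simp
    ultimately have "(G has_derivative frechet_derivative F (at p)) (at 0)"
      unfolding G_def using has_derivative_compose by fastforce
    then show ?thesis using frechet_derivative_at by metis
  qed
  define r where "r b = ray_integral 0 (\<lambda>y. ?D y b)" for b
  have G: "G v = G 0 + (\<Sum>b\<in>B. representation B v b * r b v)" for v
  proof -
    have "((\<lambda>t. ?D (t *\<^sub>R v) v) has_integral (G (1 *\<^sub>R v) - G (0 *\<^sub>R v))) {0..1}"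
    proof (rule fundamental_theorem_of_calculus)
      fix t :: real
      have "((\<lambda>t. t *\<^sub>R v) has_derivative (\<lambda>h. h *\<^sub>R v)) (at t within {0..1})"
        by (auto intro!: derivative_eq_intros)
      from has_derivative_compose[OF this, of G "?D (t *\<^sub>R v)"]
      have "((\<lambda>t. G (t *\<^sub>R v)) has_derivative (\<lambda>h. ?D (t *\<^sub>R v) (h *\<^sub>R v))) (at t within {0..1})"
        using smooth_on_has_derivative[OF sG] by simp
      then show "((\<lambda>t. G (t *\<^sub>R v)) has_vector_derivative ?D (t *\<^sub>R v) v) (at t within {0..1})"
        unfolding has_vector_derivative_def
        using linear_cmul[OF smooth_on_linear_derivative[OF sG]] by simp
    qed simp
    then have "G v - G 0 = integral {0..1} (\<lambda>t. ?D (t *\<^sub>R v) v)" by (simp add: integral_unique)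
    also have "\<dots> = integral {0..1} (\<lambda>t. \<Sum>b\<in>B. representation B v b * ?D (t *\<^sub>R v) b)"
      by (subst finite_basis_linear_expand[OF B smooth_on_linear_derivative[OF sG], of _ v]) auto
    also have "\<dots> = (\<Sum>b\<in>B. representation B v b * r b v)"
      unfolding r_def ray_integral_def
      using integrable_ray[OF smooth_on_continuous[OF smooth_on_deriv[OF sG]], where a=0] finite_basis_finite[OF B]
      by (subst integral_sum) (auto intro!: integrable_on_mult_right)
    finally show ?thesis by simp
  qed
  show ?thesis
  proof (rule that[of "\<lambda>b u. r b (u - p)"])
    fix b
    have "smooth_on UNIV (r b)"
      unfolding r_def by (intro smooth_on_ray_integral[OF B] smooth_on_deriv sG)
    then show "smooth_on UNIV (\<lambda>u. r b (u - p))"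
      using smooth_on_compose[OF B open_UNIV sh[of "- p"]] by fastforce
    show "r b (p - p) = frechet_derivative F (at p) b"
      by (simp add: r_def ray_integral_def DG)
  next
    fix u
    show "F u = F p + (\<Sum>b\<in>B. representation B (u - p) b * r b (u - p))"
      using G[of "u - p"] by (simp add: G_def)
  qed
qed

section \<open>Smooth functions on a manifold\<close>

context smooth_manifold
begin

lemma ex_model_basis: "\<exists>B::'e set. finite_basis B"
  by (rule ex_finite_basis[OF finite_dim])

lemma chart_is_topological: "(U, \<phi>) \<in> A \<Longrightarrow> topological_chart T U \<phi>"
  by unfold_locales (auto intro: chart_domain chart_homeomorphic chart_image)

lemma chart_at:
  assumes "x \<in> topspace T" obtains U \<phi> where "(U, \<phi>) \<in> A" "x \<in> U"
  using assms covers by blast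

lemma chart_inv: "(U, \<phi>) \<in> A \<Longrightarrow> x \<in> U \<Longrightarrow> inv_into U \<phi> (\<phi> x) = x"
  using topological_chart.\<psi>_inj[OF chart_is_topological] by (simp add: inv_into_f_f)

lemma chart_inv_mem: "u \<in> \<phi> ` U \<Longrightarrow> inv_into U \<phi> u \<in> U"
  by (rule inv_into_into)

lemma smooth_functionsD:
  assumes "f \<in> smooth_functions T A" "(U, \<phi>) \<in> A"
  shows "smooth_on (\<phi> ` U) (\<lambda>u. f (inv_into U \<phi> u))"
proof -
  have "\<forall>(U, \<phi>)\<in>A. smooth_on (\<phi> ` U) (id \<circ> f \<circ> inv_into U \<phi>)"
    using assms(1) by (simp add: smooth_functions_def smooth_map_def)
  then show ?thesis using assms(2) by (auto simp: o_def)
qed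

lemma smooth_functionsI:
  fixes f :: "'a \<Rightarrow> real"
  assumes f: "\<And>U \<phi>. (U, \<phi>) \<in> A \<Longrightarrow> smooth_on (\<phi> ` U) (\<lambda>u. f (inv_into U \<phi> u))"
  shows "f \<in> smooth_functions T A"
proof -
  have "continuous_map T euclideanreal f"
  proof (rule pasting_lemma[where I=A and T=fst and f="\<lambda>_. f"])
    fix i assume i: "i \<in> A"
    obtain U \<phi> where U: "i = (U, \<phi>)" by (cases i)
    then have m: "(U, \<phi>) \<in> A" using i by simp
    interpret topological_chart T U \<phi> by (rule chart_is_topological[OF m])
    show "openin T (fst i)" using U open_U by simp
    have "continuous_map (top_of_set (\<phi> ` U)) euclideanreal (\<lambda>u. f (inv_into U \<phi> u))"
      using smooth_on_continuous[OF f[OF m]] by simp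
    from continuous_map_compose[OF \<psi>_continuous this]
    have "continuous_map (subtopology T U) euclideanreal (\<lambda>x. f (inv_into U \<phi> (\<phi> x)))"
      by (simp add: o_def)
    then show "continuous_map (subtopology T (fst i)) euclideanreal f"
      unfolding U fst_conv by (rule continuous_map_eq) (simp add: chart_inv[OF m])
  next
    fix x assume "x \<in> topspace T"
    then obtain U \<phi> where "(U, \<phi>) \<in> A" "x \<in> U" by (rule chart_at)
    then show "\<exists>j. j \<in> A \<and> x \<in> fst j \<and> f x = f x" by (intro exI[of _ "(U, \<phi>)"]) simp
  qed simp
  moreover have "smooth_on (\<phi> ` U) (id \<circ> f \<circ> inv_into U \<phi>)" if "(U, \<phi>) \<in> A" for U \<phi>
    using f[OF that] by (simp add: o_def)
  ultimately show ?thesis by (auto simp: smooth_functions_def smooth_map_def)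
qed

text \<open>
  Smoothness near a point may be tested in one chart there: the transition maps are smooth.
\<close>

lemma smooth_functions_localI:
  fixes f :: "'a \<Rightarrow> real"
  assumes f: "\<And>x. x \<in> topspace T \<Longrightarrow> \<exists>U \<phi> W. (U, \<phi>) \<in> A \<and> openin T W \<and> x \<in> W \<and> W \<subseteq> U \<and>
      smooth_on (\<phi> ` W) (\<lambda>u. f (inv_into U \<phi> u))"
  shows "f \<in> smooth_functions T A"
proof (rule smooth_functionsI)
  fix V \<psi> assume V: "(V, \<psi>) \<in> A"
  interpret V: topological_chart T V \<psi> by (rule chart_is_topological[OF V])
  obtain B :: "'e set" where B: "finite_basis B" using ex_model_basis by blast
  show "smooth_on (\<psi> ` V) (\<lambda>u. f (inv_into V \<psi> u))"
  proof (rule smooth_on_local)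
    fix y assume "y \<in> \<psi> ` V"
    then obtain x where x: "x \<in> V" "y = \<psi> x" by blast
    obtain U \<phi> W where U: "(U, \<phi>) \<in> A" and W: "openin T W" "x \<in> W" "W \<subseteq> U"
      and sm: "smooth_on (\<phi> ` W) (\<lambda>u. f (inv_into U \<phi> u))"
      using f[of x] V.U_subset x(1) by blast
    define N where "N = \<psi> ` (V \<inter> W)"
    have N: "open N" unfolding N_def by (rule V.chart_image_open[OF W(1)])
    have "smooth_on (\<psi> ` (V \<inter> U)) (\<phi> \<circ> inv_into V \<psi>)" by (rule compatible[OF V U])
    then have "smooth_on N (\<phi> \<circ> inv_into V \<psi>)"
      by (rule smooth_on_subset) (use W(3) in \<open>auto simp: N_def\<close>)
    then have tr: "smooth_on N (\<lambda>u. \<phi> (inv_into V \<psi> u))" by (simp add: o_def)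
    have inW: "inv_into V \<psi> u \<in> W" if "u \<in> N" for u
      using that V chart_inv by (auto simp: N_def)
    then have "smooth_on N (\<lambda>u. f (inv_into U \<phi> (\<phi> (inv_into V \<psi> u))))"
      by (intro smooth_on_compose[OF B N tr sm]) auto
    moreover have "inv_into U \<phi> (\<phi> (inv_into V \<psi> u)) = inv_into V \<psi> u" if "u \<in> N" for u
      using inW[OF that] W(3) chart_inv[OF U] by blast
    ultimately have "smooth_on N (\<lambda>u. f (inv_into V \<psi> u))"
      using smooth_on_cong[OF N, of "\<lambda>u. f (inv_into U \<phi> (\<phi> (inv_into V \<psi> u)))" "\<lambda>u. f (inv_into V \<psi> u)"] by simp
    moreover have "y \<in> N" using x W(2) by (auto simp: N_def)
    ultimately show "\<exists>N. open N \<and> y \<in> N \<and> smooth_on N (\<lambda>u. f (inv_into V \<psi> u))" using N by blast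
  qed
qed

lemma smooth_functions_const: "(\<lambda>x. c) \<in> smooth_functions T A"
  by (rule smooth_functionsI) (rule smooth_on_const)

lemma smooth_functions_add:
  "f \<in> smooth_functions T A \<Longrightarrow> g \<in> smooth_functions T A \<Longrightarrow> (\<lambda>x. f x + g x) \<in> smooth_functions T A"
  by (rule smooth_functionsI, rule smooth_on_add[OF chart_image]) (auto intro: smooth_functionsD)

lemma smooth_functions_mult:
  "f \<in> smooth_functions T A \<Longrightarrow> g \<in> smooth_functions T A \<Longrightarrow> (\<lambda>x. f x * g x) \<in> smooth_functions T A"
  by (rule smooth_functionsI, rule smooth_on_mult[OF chart_image]) (auto intro: smooth_functionsD)

lemma smooth_functions_linear:
  "f \<in> smooth_functions T A \<Longrightarrow> g \<in> smooth_functions T A \<Longrightarrow> (\<lambda>x. a * f x + b * g x) \<in> smooth_functions T A"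
  by (intro smooth_functions_add smooth_functions_mult smooth_functions_const)

lemma smooth_functions_sum:
  "(\<And>i. i \<in> I \<Longrightarrow> f i \<in> smooth_functions T A) \<Longrightarrow> (\<lambda>x. \<Sum>i\<in>I. f i x) \<in> smooth_functions T A"
  by (induction I rule: infinite_finite_induct) (auto intro: smooth_functions_const smooth_functions_add)

lemma smooth_functions_cong:
  assumes "f \<in> smooth_functions T A" "\<And>x. x \<in> topspace T \<Longrightarrow> f x = g x"
  shows "g \<in> smooth_functions T A"
proof (rule smooth_functionsI)
  fix U \<phi> assume U: "(U, \<phi>) \<in> A"
  have "f (inv_into U \<phi> u) = g (inv_into U \<phi> u)" if "u \<in> \<phi> ` U" for u
    using chart_inv_mem[OF that] topological_chart.U_subset[OF chart_is_topological[OF U]] assms(2) by blast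
  then show "smooth_on (\<phi> ` U) (\<lambda>u. g (inv_into U \<phi> u))"
    using smooth_on_cong[OF chart_image[OF U], of "\<lambda>u. f (inv_into U \<phi> u)" "\<lambda>u. g (inv_into U \<phi> u)"]
      smooth_functionsD[OF assms(1) U] by blast
qed

lemma smooth_functions_compose:
  assumes h: "smooth_map T A T A h" and f: "f \<in> smooth_functions T A"
  shows "f \<circ> h \<in> smooth_functions T A"
proof (rule smooth_functions_localI)
  fix x assume x: "x \<in> topspace T"
  have ch: "continuous_map T T h" using h by (simp add: smooth_map_def)
  have hx: "h x \<in> topspace T" using continuous_map_image_subset_topspace[OF ch] x by blast
  obtain U \<phi> where U: "(U, \<phi>) \<in> A" "x \<in> U" using chart_at[OF x] .
  obtain V \<psi> where V: "(V, \<psi>) \<in> A" "h x \<in> V" using chart_at[OF hx] .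
  obtain B :: "'e set" where B: "finite_basis B" using ex_model_basis by blast
  interpret U: topological_chart T U \<phi> by (rule chart_is_topological[OF U(1)])
  define W where "W = U \<inter> {x \<in> topspace T. h x \<in> V}"
  have W: "openin T W" unfolding W_def
    by (rule openin_Int[OF U.open_U openin_continuous_map_preimage[OF ch chart_domain[OF V(1)]]])
  have oW: "open (\<phi> ` W)" using U.chart_image_open[OF W] by (simp add: W_def Int_assoc[symmetric])
  have "smooth_on (\<phi> ` (U \<inter> h -` V)) (\<psi> \<circ> h \<circ> inv_into U \<phi>)"
    using h U(1) V(1) by (auto simp: smooth_map_def)
  then have "smooth_on (\<phi> ` W) (\<psi> \<circ> h \<circ> inv_into U \<phi>)"
    by (rule smooth_on_subset) (auto simp: W_def)
  then have sm: "smooth_on (\<phi> ` W) (\<lambda>u. \<psi> (h (inv_into U \<phi> u)))" by (simp add: o_def)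
  have hV: "h (inv_into U \<phi> u) \<in> V" if "u \<in> \<phi> ` W" for u
    using that chart_inv[OF U(1)] by (auto simp: W_def)
  have "smooth_on (\<phi> ` W) (\<lambda>u. f (inv_into V \<psi> (\<psi> (h (inv_into U \<phi> u)))))"
    by (rule smooth_on_compose[OF B oW sm smooth_functionsD[OF f V(1)]]) (use hV in auto)
  moreover have "f (inv_into V \<psi> (\<psi> (h (inv_into U \<phi> u)))) = (f \<circ> h) (inv_into U \<phi> u)" if "u \<in> \<phi> ` W" for u
    using hV[OF that] chart_inv[OF V(1)] by simp
  ultimately have "smooth_on (\<phi> ` W) (\<lambda>u. (f \<circ> h) (inv_into U \<phi> u))"
    using smooth_on_cong[OF oW, of "\<lambda>u. f (inv_into V \<psi> (\<psi> (h (inv_into U \<phi> u))))"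
        "\<lambda>u. (f \<circ> h) (inv_into U \<phi> u)"] by blast
  then show "\<exists>U \<phi> W. (U, \<phi>) \<in> A \<and> openin T W \<and> x \<in> W \<and> W \<subseteq> U \<and>
      smooth_on (\<phi> ` W) (\<lambda>u. (f \<circ> h) (inv_into U \<phi> u))"
    using U W x V(2) by (intro exI[of _ U] exI[of _ \<phi>] exI[of _ W]) (auto simp: W_def)
qed

text \<open>
  Outside the image of the ball under the inverse chart the extension vanishes. This image is compact,
  hence closed by the Hausdorff property, so its complement is a neighbourhood of every point outside
  the chart domain.
\<close>

lemma smooth_extension:
  fixes H :: "'e \<Rightarrow> real"
  assumes U: "(U, \<phi>) \<in> A" and p: "cball p r \<subseteq> \<phi> ` U" and H: "smooth_on UNIV H"
    and supp: "\<And>u. norm (u - p) \<ge> r \<Longrightarrow> H u = 0"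
  shows "(\<lambda>x. if x \<in> U then H (\<phi> x) else 0) \<in> smooth_functions T A"
proof (rule smooth_functions_localI)
  let ?F = "\<lambda>x. if x \<in> U then H (\<phi> x) else 0"
  interpret U: topological_chart T U \<phi> by (rule chart_is_topological[OF U])
  obtain B :: "'e set" where B: "finite_basis B" using ex_model_basis by blast
  define K where "K = inv_into U \<phi> ` cball p r"
  have "compactin (top_of_set (\<phi> ` U)) (cball p r)"
    using finite_basis_compact_cball[OF B] p by (simp add: compactin_subtopology)
  then have "compactin T K" unfolding K_def by (rule image_compactin[OF _ U.\<psi>_inverse_continuous])
  then have K: "closedin T K" using Hausdorff compactin_imp_closedin by blast
  have KU: "K \<subseteq> U" unfolding K_def using p by (auto intro: inv_into_into)
  fix x assume x: "x \<in> topspace T"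
  show "\<exists>V \<psi> W. (V, \<psi>) \<in> A \<and> openin T W \<and> x \<in> W \<and> W \<subseteq> V \<and> smooth_on (\<psi> ` W) (\<lambda>u. ?F (inv_into V \<psi> u))"
  proof (cases "x \<in> U")
    case True
    have "?F (inv_into U \<phi> u) = H u" if "u \<in> \<phi> ` U" for u
      using that chart_inv_mem[OF that] by (simp add: f_inv_into_f)
    then have "smooth_on (\<phi> ` U) (\<lambda>u. ?F (inv_into U \<phi> u))"
      using smooth_on_cong[OF U.open_image, of "\<lambda>u. ?F (inv_into U \<phi> u)" H] smooth_on_subset[OF H] by blast
    then show ?thesis using U True U.open_U by blast
  next
    case False
    obtain V \<psi> where V: "(V, \<psi>) \<in> A" "x \<in> V" using chart_at[OF x] .
    interpret V: topological_chart T V \<psi> by (rule chart_is_topological[OF V(1)])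
    define W where "W = V - K"
    have W: "openin T W" unfolding W_def by (rule openin_diff[OF V.open_U K])
    have oW: "open (\<psi> ` W)" using V.chart_image_open[OF W] by (simp add: W_def Int_absorb1)
    have zero: "?F y = 0" if y: "y \<in> W" for y
    proof (cases "y \<in> U")
      case True
      have "\<not> norm (\<phi> y - p) \<le> r"
      proof
        assume "norm (\<phi> y - p) \<le> r"
        then have "\<phi> y \<in> cball p r" by (simp add: dist_norm norm_minus_commute)
        then have "y \<in> K" unfolding K_def using chart_inv[OF U True] by (metis image_eqI)
        then show False using y by (simp add: W_def)
      qed
      then show ?thesis using supp[of "\<phi> y"] by simp
    qed simp
    have "?F (inv_into V \<psi> u) = 0" if "u \<in> \<psi> ` W" for u
    proof -
      obtain y where y: "y \<in> W" "u = \<psi> y" using \<open>u \<in> \<psi> ` W\<close> by blast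
      then have iy: "inv_into V \<psi> u = y" using chart_inv[OF V(1)] by (simp add: W_def)
      show ?thesis unfolding iy by (rule zero[OF y(1)])
    qed
    then have "smooth_on (\<psi> ` W) (\<lambda>u. ?F (inv_into V \<psi> u))"
      using smooth_on_cong[OF oW, of "\<lambda>u. ?F (inv_into V \<psi> u)" "\<lambda>_. 0"] smooth_on_const by blast
    moreover have "x \<in> W" using V(2) False KU by (auto simp: W_def)
    ultimately show ?thesis using V(1) W by (intro exI[of _ V] exI[of _ \<psi>] exI[of _ W]) (auto simp: W_def)
  qed
qed

lemma smooth_function_bump:
  assumes W: "openin T W" "x \<in> W"
  obtains \<beta> where "\<beta> \<in> smooth_functions T A" "\<beta> x = 1" "\<And>y. y \<notin> W \<Longrightarrow> \<beta> y = 0"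
proof -
  obtain U \<phi> where U: "(U, \<phi>) \<in> A" "x \<in> U" using chart_at[of x] openin_subset[OF W(1)] W(2) by blast
  interpret U: topological_chart T U \<phi> by (rule chart_is_topological[OF U(1)])
  obtain B :: "'e set" where B: "finite_basis B" using ex_model_basis by blast
  have "open (\<phi> ` (U \<inter> W))" by (rule U.chart_image_open[OF W(1)])
  moreover have "\<phi> x \<in> \<phi> ` (U \<inter> W)" using U(2) W(2) by blast
  ultimately obtain r where r: "r > 0" "cball (\<phi> x) r \<subseteq> \<phi> ` (U \<inter> W)" using open_contains_cball by blast
  obtain H :: "'e \<Rightarrow> real" and N where H: "smooth_on UNIV H" "open N" "\<phi> x \<in> N" "\<And>u. u \<in> N \<Longrightarrow> H u = 1"
    "\<And>u. norm (u - \<phi> x) \<ge> r \<Longrightarrow> H u = 0" using smooth_bump[OF B r(1)] by blast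
  show ?thesis
  proof (rule that)
    show "(\<lambda>y. if y \<in> U then H (\<phi> y) else 0) \<in> smooth_functions T A"
      by (rule smooth_extension[OF U(1) _ H(1,5)]) (use r in auto)
    show "(if x \<in> U then H (\<phi> x) else 0) = 1" using U(2) H(3,4) by simp
    fix y assume y: "y \<notin> W"
    show "(if y \<in> U then H (\<phi> y) else 0) = 0"
    proof (cases "y \<in> U")
      case True
      have "\<not> norm (\<phi> y - \<phi> x) \<le> r"
      proof
        assume "norm (\<phi> y - \<phi> x) \<le> r"
        then have "\<phi> y \<in> cball (\<phi> x) r" by (simp add: dist_norm norm_minus_commute)
        then obtain z where z: "z \<in> U" "z \<in> W" "\<phi> y = \<phi> z" using r(2) by blast
        then have "y = z" using True U.\<psi>_inj by (auto dest: inj_onD)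
        then show False using y z by simp
      qed
      then show ?thesis using H(5)[of "\<phi> y"] by simp
    qed simp
  qed
qed

section \<open>Derivations are local and first order\<close>

context
  fixes Y assumes Y: "Y \<in> smooth_vector_fields T A"
begin

lemma derivation_linear:
  "f \<in> smooth_functions T A \<Longrightarrow> g \<in> smooth_functions T A \<Longrightarrow>
    Y (\<lambda>x. a * f x + b * g x) = (\<lambda>x. a * Y f x + b * Y g x)"
  using Y by (simp add: smooth_vector_fields_def)

lemma derivation_mult:
  "f \<in> smooth_functions T A \<Longrightarrow> g \<in> smooth_functions T A \<Longrightarrow>
    Y (\<lambda>x. f x * g x) = (\<lambda>x. f x * Y g x + Y f x * g x)"
  using Y by (simp add: smooth_vector_fields_def)

lemma derivation_outside: "f \<notin> smooth_functions T A \<or> x \<notin> topspace T \<Longrightarrow> Y f x = 0"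
  using Y by (simp add: smooth_vector_fields_def)

lemma derivation_add:
  "f \<in> smooth_functions T A \<Longrightarrow> g \<in> smooth_functions T A \<Longrightarrow> Y (\<lambda>x. f x + g x) x = Y f x + Y g x"
  using derivation_linear[of f g 1 1] by simp

text \<open>
  Apply the product rule to \<open>1 = 1 * 1\<close>.
\<close>

lemma derivation_const: "Y (\<lambda>x. c) x = 0"
proof -
  have one: "(\<lambda>x. 1) \<in> smooth_functions T A" by (rule smooth_functions_const)
  have "Y (\<lambda>x. 1) x = 0" using fun_cong[OF derivation_mult[OF one one], of x] by simp
  then show ?thesis using fun_cong[OF derivation_linear[OF one one, of c 0], of x] by simp
qed

lemma derivation_sum:
  assumes "\<And>i. i \<in> I \<Longrightarrow> f i \<in> smooth_functions T A"
  shows "Y (\<lambda>x. \<Sum>i\<in>I. f i x) x = (\<Sum>i\<in>I. Y (f i) x)"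
  using assms
proof (induction I rule: infinite_finite_induct)
  case (insert i I)
  then show ?case using derivation_add[of "f i" "\<lambda>x. \<Sum>i\<in>I. f i x"] smooth_functions_sum[of I f] by simp
qed (simp_all add: derivation_const)

text \<open>
  The difference \<open>k\<close> vanishes on \<open>W\<close>, so \<open>k = k * (1 - \<beta>)\<close> for a bump function \<open>\<beta>\<close> supported in \<open>W\<close> with
  \<open>\<beta> x = 1\<close>. Both factors vanish at \<open>x\<close>, and the product rule kills \<open>k\<close>.
\<close>

lemma derivation_local:
  assumes f: "f \<in> smooth_functions T A" and g: "g \<in> smooth_functions T A"
    and W: "openin T W" "x \<in> W" and eq: "\<And>y. y \<in> W \<Longrightarrow> f y = g y"
  shows "Y f x = Y g x"
proof -
  obtain \<beta> where \<beta>: "\<beta> \<in> smooth_functions T A" "\<beta> x = 1" "\<And>y. y \<notin> W \<Longrightarrow> \<beta> y = 0"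
    using smooth_function_bump[OF W] by blast
  define k where "k = (\<lambda>y. 1 * f y + (-1) * g y)"
  have k: "k \<in> smooth_functions T A" unfolding k_def by (rule smooth_functions_linear[OF f g])
  have \<beta>': "(\<lambda>y. 1 * 1 + (-1) * \<beta> y) \<in> smooth_functions T A"
    by (rule smooth_functions_linear[OF smooth_functions_const \<beta>(1)])
  have "k y = k y * (1 * 1 + (-1) * \<beta> y)" for y
    using eq[of y] \<beta>(3)[of y] by (cases "y \<in> W") (auto simp: k_def)
  then have "Y k x = Y (\<lambda>y. k y * (1 * 1 + (-1) * \<beta> y)) x" by presburger
  also have "\<dots> = k x * Y (\<lambda>y. 1 * 1 + (-1) * \<beta> y) x + Y k x * (1 * 1 + (-1) * \<beta> x)"
    using fun_cong[OF derivation_mult[OF k \<beta>'], of x] .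
  also have "\<dots> = 0" using eq[OF W(2)] \<beta>(2) by (simp add: k_def)
  finally have "Y k x = 0" .
  moreover have "Y k x = 1 * Y f x + (-1) * Y g x"
    unfolding k_def using fun_cong[OF derivation_linear[OF f g, of 1 "-1"], of x] .
  ultimately show ?thesis by simp
qed

end

text \<open>
  By Hadamard's lemma \<open>f\<close> agrees near \<open>x\<close> with a constant plus a sum of products of coordinate functions
  vanishing at \<open>x\<close> with smooth functions. Locality and the product rule reduce \<open>Y f x\<close> to the values
  of \<open>Y\<close> on the coordinate functions, which form the vector \<open>w\<close>. Bump functions extend everything from the
  chart to the manifold.
\<close>

lemma derivation_at_point:
  assumes U: "(U, \<phi>) \<in> A" "x \<in> U" and Y: "Y \<in> smooth_vector_fields T A"
  shows "\<exists>w. \<forall>f\<in>smooth_functions T A. Y f x = frechet_derivative (\<lambda>u. f (inv_into U \<phi> u)) (at (\<phi> x)) w"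
proof -
  let ?q = "inv_into U \<phi>" and ?p = "\<phi> x"
  interpret U: topological_chart T U \<phi> by (rule chart_is_topological[OF U(1)])
  obtain B :: "'e set" where B: "finite_basis B" using ex_model_basis by blast
  have pU: "?p \<in> \<phi> ` U" using U(2) by blast
  obtain r where r: "r > 0" "cball ?p r \<subseteq> \<phi> ` U" using U.open_image pU open_contains_cball by blast
  obtain \<beta> :: "'e \<Rightarrow> real" and W where \<beta>: "smooth_on UNIV \<beta>" "open W" "?p \<in> W" "\<And>u. u \<in> W \<Longrightarrow> \<beta> u = 1"
    "\<And>u. norm (u - ?p) \<ge> r \<Longrightarrow> \<beta> u = 0" using smooth_bump[OF B r(1)] by blast
  define ext where "ext h = (\<lambda>y. if y \<in> U then \<beta> (\<phi> y) * h (\<phi> y) else 0)" for h :: "'e \<Rightarrow> real"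
  have ext: "ext h \<in> smooth_functions T A" if h: "smooth_on UNIV h" for h
    unfolding ext_def
    by (rule smooth_extension[OF U(1) r(2) smooth_on_mult[OF open_UNIV \<beta>(1) h]]) (simp add: \<beta>(5))
  define crd where "crd b = (\<lambda>u. representation B (u - ?p) b)" for b
  have crd: "smooth_on UNIV (crd b)" for b
    unfolding crd_def
    by (intro smooth_on_bounded_linear_compose[OF finite_basis_bounded_linear_coord[OF B]] smooth_on_diff
        smooth_on_id smooth_on_const open_UNIV)
  define N where "N = {y \<in> U. \<phi> y \<in> W}"
  have N: "openin T N" "x \<in> N" unfolding N_def using U.chart_preimage_open[OF \<beta>(2)] U(2) \<beta>(3) by auto
  have ext_N: "ext h y = h (\<phi> y)" if "y \<in> N" for h y
    using that \<beta>(4) by (simp add: ext_def N_def)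
  define w where "w = (\<Sum>b\<in>B. Y (ext (crd b)) x *\<^sub>R b)"
  have "Y f x = frechet_derivative (\<lambda>u. f (?q u)) (at ?p) w" if f: "f \<in> smooth_functions T A" for f
  proof -
    define F where "F = (\<lambda>u. if u \<in> \<phi> ` U then \<beta> u * f (?q u) else 0)"
    have F: "smooth_on UNIV F"
    proof (rule smooth_on_local)
      fix u
      show "\<exists>S. open S \<and> u \<in> S \<and> smooth_on S F"
      proof (cases "u \<in> \<phi> ` U")
        case True
        have "smooth_on (\<phi> ` U) (\<lambda>u. \<beta> u * f (?q u))"
          by (rule smooth_on_mult[OF U.open_image smooth_on_subset[OF \<beta>(1)] smooth_functionsD[OF f U(1)]]) simp
        then have "smooth_on (\<phi> ` U) F"
          using smooth_on_cong[OF U.open_image, of F "\<lambda>u. \<beta> u * f (?q u)"] by (simp add: F_def)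
        then show ?thesis using True U.open_image by blast
      next
        case False
        have S: "open (- cball ?p r)" by (rule open_Compl[OF closed_cball])
        have "F v = 0" if "v \<in> - cball ?p r" for v
          using that \<beta>(5)[of v] by (auto simp: F_def dist_norm norm_minus_commute)
        then have "smooth_on (- cball ?p r) F"
          using smooth_on_cong[OF S, of F "\<lambda>_. 0"] smooth_on_const by simp
        then show ?thesis using False r(2) S by blast
      qed
    qed
    obtain g where g: "\<And>b. smooth_on UNIV (g b)" "\<And>b. g b ?p = frechet_derivative F (at ?p) b"
      "\<And>u. F u = F ?p + (\<Sum>b\<in>B. representation B (u - ?p) b * g b u)"
      using hadamard[OF B F, of ?p] by blast
    let ?h = "\<lambda>y. F ?p + (\<Sum>b\<in>B. ext (crd b) y * ext (g b) y)"
    have sums: "(\<lambda>y. ext (crd b) y * ext (g b) y) \<in> smooth_functions T A" for b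
      by (intro smooth_functions_mult ext crd g)
    have "Y f x = Y ?h x"
    proof (rule derivation_local[OF Y f _ N])
      show "?h \<in> smooth_functions T A"
        by (intro smooth_functions_add smooth_functions_const smooth_functions_sum sums)
      fix y assume y: "y \<in> N"
      then have "f y = F (\<phi> y)" using \<beta>(4) chart_inv[OF U(1)] by (simp add: F_def N_def)
      then show "f y = ?h y" using g(3)[of "\<phi> y"] by (simp add: ext_N[OF y] crd_def)
    qed
    also have "\<dots> = (\<Sum>b\<in>B. Y (\<lambda>y. ext (crd b) y * ext (g b) y) x)"
      using derivation_add[OF Y smooth_functions_const smooth_functions_sum[of B, OF sums], where x=x]
      by (simp add: derivation_const[OF Y] derivation_sum[OF Y sums])
    also have "\<dots> = (\<Sum>b\<in>B. Y (ext (crd b)) x * frechet_derivative F (at ?p) b)"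
    proof (rule sum.cong[OF refl])
      fix b
      have "Y (\<lambda>y. ext (crd b) y * ext (g b) y) x = ext (crd b) x * Y (ext (g b)) x + Y (ext (crd b)) x * ext (g b) x"
        using fun_cong[OF derivation_mult[OF Y ext[OF crd] ext[OF g(1)]]] .
      then show "Y (\<lambda>y. ext (crd b) y * ext (g b) y) x = Y (ext (crd b)) x * frechet_derivative F (at ?p) b"
        by (simp add: ext_N[OF N(2)] g(2) crd_def real_vector.representation_zero)
    qed
    also have "\<dots> = frechet_derivative F (at ?p) w"
      using smooth_on_linear_derivative[OF F, of ?p] by (simp add: w_def linear_sum linear_cmul)
    also have "frechet_derivative F (at ?p) = frechet_derivative (\<lambda>u. f (?q u)) (at ?p)"
    proof (rule frechet_derivative_transform_within_open)
      show "F differentiable at ?p" using smooth_on_has_derivative[OF F] by (auto simp: differentiable_def)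
      show "open (W \<inter> \<phi> ` U)" using \<beta>(2) U.open_image by blast
    qed (use \<beta> pU in \<open>auto simp: F_def\<close>)
    finally show ?thesis .
  qed
  then show ?thesis by blast
qed

text \<open>
  Globally defined smooth functions whose differentials at \<open>x\<close> separate tangent vectors.
\<close>

lemma coordinate_functions:
  assumes U: "(U, \<phi>) \<in> A" "x \<in> U" and B: "finite_basis (B :: 'e set)"
  shows "\<exists>f\<in>smooth_functions T A. frechet_derivative (\<lambda>u. f (inv_into U \<phi> u)) (at (\<phi> x)) = (\<lambda>w. representation B w b)"
proof -
  let ?p = "\<phi> x"
  interpret U: topological_chart T U \<phi> by (rule chart_is_topological[OF U(1)])
  have pU: "?p \<in> \<phi> ` U" using U(2) by blast
  obtain r where r: "r > 0" "cball ?p r \<subseteq> \<phi> ` U" using U.open_image pU open_contains_cball by blast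
  obtain \<beta> :: "'e \<Rightarrow> real" and W where \<beta>: "smooth_on UNIV \<beta>" "open W" "?p \<in> W" "\<And>u. u \<in> W \<Longrightarrow> \<beta> u = 1"
    "\<And>u. norm (u - ?p) \<ge> r \<Longrightarrow> \<beta> u = 0" using smooth_bump[OF B r(1)] by blast
  have bl: "bounded_linear (\<lambda>u. representation B u b)" by (rule finite_basis_bounded_linear_coord[OF B])
  define f where "f = (\<lambda>y. if y \<in> U then \<beta> (\<phi> y) * representation B (\<phi> y) b else 0)"
  have "f \<in> smooth_functions T A"
    unfolding f_def
    by (rule smooth_extension[OF U(1) r(2) smooth_on_mult[OF open_UNIV \<beta>(1) smooth_on_bounded_linear[OF bl open_UNIV]]])
       (simp add: \<beta>(5))
  moreover have "((\<lambda>u. f (inv_into U \<phi> u)) has_derivative (\<lambda>w. representation B w b)) (at ?p)"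
  proof (rule has_derivative_transform_within_open[OF bounded_linear_imp_has_derivative[OF bl]])
    show "open (W \<inter> \<phi> ` U)" using \<beta>(2) U.open_image by blast
    fix u assume "u \<in> W \<inter> \<phi> ` U"
    then show "representation B u b = f (inv_into U \<phi> u)"
      using \<beta>(4) chart_inv_mem[of u \<phi> U] by (simp add: f_def f_inv_into_f)
  qed (use \<beta> pU in auto)
  then have "frechet_derivative (\<lambda>u. f (inv_into U \<phi> u)) (at ?p) = (\<lambda>w. representation B w b)"
    by (rule frechet_derivative_at[symmetric])
  ultimately show ?thesis by blast
qed

end

section \<open>Multiplication in charts\<close>

context lie_group
begin

lemma mult_continuous: "continuous_map (prod_topology T T) T (\<lambda>(x, y). x \<otimes> y)"
  using smooth_mult by (simp add: smooth_map_def)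

text \<open>
  Smoothness of multiplication, stated on a product of neighbourhoods in the model space instead of
  through the product atlas.
\<close>

lemma mult_in_charts:
  assumes V: "(V, \<psi>) \<in> A" "x \<in> V" and U: "(U, \<phi>) \<in> A" "y \<in> U" and W: "(W, \<theta>) \<in> A" "x \<otimes> y \<in> W"
  obtains N1 N2 where "open N1" "open N2" "\<psi> x \<in> N1" "\<phi> y \<in> N2" "N1 \<subseteq> \<psi> ` V" "N2 \<subseteq> \<phi> ` U"
    "\<forall>a\<in>N1. \<forall>b\<in>N2. inv_into V \<psi> a \<otimes> inv_into U \<phi> b \<in> W"
    "smooth_on (N1 \<times> N2) (\<lambda>z. \<theta> (inv_into V \<psi> (fst z) \<otimes> inv_into U \<phi> (snd z)))"
proof -
  let ?m = "\<lambda>(x, y). x \<otimes> y" and ?c = "map_prod \<psi> \<phi>"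
  interpret V: topological_chart T V \<psi> by (rule chart_is_topological[OF V(1)])
  interpret U: topological_chart T U \<phi> by (rule chart_is_topological[OF U(1)])
  have "openin (prod_topology T T) {z \<in> topspace (prod_topology T T). ?m z \<in> W}"
    by (rule openin_continuous_map_preimage[OF mult_continuous chart_domain[OF W(1)]])
  moreover have "(x, y) \<in> {z \<in> topspace (prod_topology T T). ?m z \<in> W}"
    using V(2) U(2) W(2) V.U_subset U.U_subset by auto
  ultimately obtain O1 O2 where O: "openin T O1" "openin T O2" "x \<in> O1" "y \<in> O2"
    "O1 \<times> O2 \<subseteq> {z \<in> topspace (prod_topology T T). ?m z \<in> W}"
    unfolding openin_prod_topology_alt by meson
  have prodW: "x' \<otimes> y' \<in> W" if "x' \<in> O1" "y' \<in> O2" for x' y' using O(5) that by auto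
  define N1 where "N1 = \<psi> ` (V \<inter> O1)"
  define N2 where "N2 = \<phi> ` (U \<inter> O2)"
  have N: "open N1" "open N2"
    unfolding N1_def N2_def by (intro V.chart_image_open U.chart_image_open O(1,2))+
  have inj: "inj_on ?c (V \<times> U)" using V.\<psi>_inj U.\<psi>_inj by (rule map_prod_inj_on)
  have inv: "inv_into (V \<times> U) ?c (\<psi> x', \<phi> y') = (x', y')" if "x' \<in> V" "y' \<in> U" for x' y'
    using inv_into_f_f[OF inj, of "(x', y')"] that by simp
  have "(V \<times> U, ?c) \<in> prod_atlas A A" using V(1) U(1) by (auto simp: prod_atlas_def)
  then have sm: "smooth_on (?c ` ((V \<times> U) \<inter> ?m -` W)) (\<theta> \<circ> ?m \<circ> inv_into (V \<times> U) ?c)"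
    using smooth_mult W(1) unfolding smooth_map_def by blast
  have "N1 \<times> N2 \<subseteq> ?c ` ((V \<times> U) \<inter> ?m -` W)"
  proof
    fix z assume "z \<in> N1 \<times> N2"
    then obtain x' y' where xy: "x' \<in> V" "x' \<in> O1" "y' \<in> U" "y' \<in> O2" "z = ?c (x', y')"
      by (auto simp: N1_def N2_def)
    then show "z \<in> ?c ` ((V \<times> U) \<inter> ?m -` W)" using prodW by (intro image_eqI[of _ _ "(x', y')"]) auto
  qed
  then have "smooth_on (N1 \<times> N2) (\<theta> \<circ> ?m \<circ> inv_into (V \<times> U) ?c)" by (rule smooth_on_subset[OF sm])
  moreover have "(\<theta> \<circ> ?m \<circ> inv_into (V \<times> U) ?c) z = \<theta> (inv_into V \<psi> (fst z) \<otimes> inv_into U \<phi> (snd z))"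
    if "z \<in> N1 \<times> N2" for z
    using that inv chart_inv[OF V(1)] chart_inv[OF U(1)] by (auto simp: N1_def N2_def)
  ultimately have sm': "smooth_on (N1 \<times> N2) (\<lambda>z. \<theta> (inv_into V \<psi> (fst z) \<otimes> inv_into U \<phi> (snd z)))"
    using smooth_on_cong[OF open_Times[OF N], of "\<theta> \<circ> ?m \<circ> inv_into (V \<times> U) ?c"
      "\<lambda>z. \<theta> (inv_into V \<psi> (fst z) \<otimes> inv_into U \<phi> (snd z))"] by blast
  show ?thesis
  proof (rule that[OF N _ _ _ _ _ sm'])
    show "\<psi> x \<in> N1" "\<phi> y \<in> N2" using V(2) U(2) O(3,4) by (auto simp: N1_def N2_def)
    show "N1 \<subseteq> \<psi> ` V" "N2 \<subseteq> \<phi> ` U" by (auto simp: N1_def N2_def)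
    show "\<forall>a\<in>N1. \<forall>b\<in>N2. inv_into V \<psi> a \<otimes> inv_into U \<phi> b \<in> W"
      using prodW chart_inv[OF V(1)] chart_inv[OF U(1)] by (auto simp: N1_def N2_def)
  qed
qed

lemma U_carrier: "(U, \<phi>) \<in> A \<Longrightarrow> x \<in> U \<Longrightarrow> x \<in> carrier G"
  using chart_domain openin_subset topspace_eq_carrier by blast

lemma smooth_on_mult_charts:
  fixes f :: "'a \<Rightarrow> real"
  assumes V: "(V, \<psi>) \<in> A" and U: "(U, \<phi>) \<in> A" and f: "f \<in> smooth_functions T A"
  shows "smooth_on (\<psi> ` V \<times> \<phi> ` U) (\<lambda>z. f (inv_into V \<psi> (fst z) \<otimes> inv_into U \<phi> (snd z)))"
proof (rule smooth_on_local)
  obtain B :: "'e set" where B: "finite_basis B" using ex_model_basis by blast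
  fix z assume "z \<in> \<psi> ` V \<times> \<phi> ` U"
  then obtain x y where xy: "x \<in> V" "y \<in> U" "z = (\<psi> x, \<phi> y)" by auto
  then have "x \<otimes> y \<in> topspace T" using U_carrier[OF V] U_carrier[OF U] topspace_eq_carrier by simp
  then obtain W \<theta> where W: "(W, \<theta>) \<in> A" "x \<otimes> y \<in> W" by (rule chart_at)
  let ?m = "\<lambda>z. inv_into V \<psi> (fst z) \<otimes> inv_into U \<phi> (snd z)"
  obtain N1 N2 where N: "open N1" "open N2" "\<psi> x \<in> N1" "\<phi> y \<in> N2" "N1 \<subseteq> \<psi> ` V" "N2 \<subseteq> \<phi> ` U"
    and mW: "\<forall>a\<in>N1. \<forall>b\<in>N2. inv_into V \<psi> a \<otimes> inv_into U \<phi> b \<in> W"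
    and sm: "smooth_on (N1 \<times> N2) (\<lambda>z. \<theta> (?m z))"
    using mult_in_charts[OF V xy(1) U xy(2) W] .
  have oN: "open (N1 \<times> N2)" using N by (simp add: open_Times)
  have "smooth_on (N1 \<times> N2) (\<lambda>z. f (inv_into W \<theta> (\<theta> (?m z))))"
    by (rule smooth_on_compose[OF B oN sm smooth_functionsD[OF f W(1)]]) (use mW in auto)
  moreover have "f (inv_into W \<theta> (\<theta> (?m z))) = f (?m z)" if "z \<in> N1 \<times> N2" for z
    using mW that chart_inv[OF W(1)] by auto
  ultimately have "smooth_on (N1 \<times> N2) (\<lambda>z. f (?m z))"
    using smooth_on_cong[OF oN, of "\<lambda>z. f (inv_into W \<theta> (\<theta> (?m z)))" "\<lambda>z. f (?m z)"] by blast
  then show "\<exists>N. open N \<and> z \<in> N \<and> smooth_on N (\<lambda>z. f (?m z))"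
    using oN N(3,4) xy(3) by (intro exI[of _ "N1 \<times> N2"]) auto
qed

lemma smooth_functions_left_translate:
  assumes f: "f \<in> smooth_functions T A" and g: "g \<in> carrier G"
  shows "(\<lambda>y. f (g \<otimes> y)) \<in> smooth_functions T A"
proof (rule smooth_functionsI)
  fix U \<phi> assume U: "(U, \<phi>) \<in> A"
  obtain B :: "'e set" where B: "finite_basis B" using ex_model_basis by blast
  obtain D :: "('e \<times> 'e) set" where D: "finite_basis D" using finite_basis_prod[OF B B] by blast
  obtain V \<psi> where V: "(V, \<psi>) \<in> A" "g \<in> V" using chart_at[of g] g topspace_eq_carrier by blast
  have sm: "smooth_on (\<phi> ` U) (\<lambda>u. (\<psi> g, u))"
    by (intro smooth_on_Pair smooth_on_const smooth_on_id chart_image[OF U])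
  have im: "(\<lambda>u. (\<psi> g, u)) ` (\<phi> ` U) \<subseteq> \<psi> ` V \<times> \<phi> ` U" using V(2) by blast
  have "smooth_on (\<phi> ` U) (\<lambda>u. f (inv_into V \<psi> (\<psi> g) \<otimes> inv_into U \<phi> u))"
    using smooth_on_compose[OF D chart_image[OF U] sm smooth_on_mult_charts[OF V(1) U f] im] by simp
  then show "smooth_on (\<phi> ` U) (\<lambda>u. f (g \<otimes> inv_into U \<phi> u))" using chart_inv[OF V] by simp
qed

end

section \<open>The Lie algebra as the tangent space at the identity\<close>

locale lie_group_chart = lie_group G T A for G :: "('a, 'm) monoid_scheme" (structure)
    and T and A :: "('a, 'e::real_normed_vector) chart set" +
  fixes U :: "'a set" and \<phi> :: "'a \<Rightarrow> 'e"
  assumes U: "(U, \<phi>) \<in> A" and one_U: "\<one> \<in> U"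
begin

sublocale identity_chart: topological_chart T U \<phi> by (rule chart_is_topological[OF U])

abbreviation q :: "'e \<Rightarrow> 'a" where "q \<equiv> inv_into U \<phi>"

lemma q_carrier: "u \<in> \<phi> ` U \<Longrightarrow> q u \<in> carrier G"
  by (rule U_carrier[OF U chart_inv_mem])

lemma q_one: "q (\<phi> \<one>) = \<one>" by (rule chart_inv[OF U one_U])

lemma one_image: "\<phi> \<one> \<in> \<phi> ` U" using one_U by blast

text \<open>
  The left-invariant vector field with value \<open>w\<close> at the identity, in coordinates. The value \<open>0\<close> elsewhere
  matches the convention for vector fields.
\<close>

definition left_field :: "'e \<Rightarrow> 'a vfield" where
  "left_field w f g = (if f \<in> smooth_functions T A \<and> g \<in> carrier G
     then frechet_derivative (\<lambda>u. f (g \<otimes> q u)) (at (\<phi> \<one>)) w else 0)"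

lemma left_field_has_derivative:
  assumes "f \<in> smooth_functions T A" "g \<in> carrier G"
  shows "((\<lambda>u. f (g \<otimes> q u)) has_derivative (\<lambda>w. left_field w f g)) (at (\<phi> \<one>))"
  using smooth_on_has_derivative[OF smooth_functionsD[OF smooth_functions_left_translate[OF assms] U] one_image] assms
  by (simp add: left_field_def)

lemma left_field_eqI:
  assumes "f \<in> smooth_functions T A" "g \<in> carrier G"
    "((\<lambda>u. f (g \<otimes> q u)) has_derivative f') (at (\<phi> \<one>))"
  shows "left_field w f g = f' w"
  using has_derivative_unique[OF left_field_has_derivative[OF assms(1,2)] assms(3)] by (rule fun_cong)

lemma left_field_outside: "f \<notin> smooth_functions T A \<or> g \<notin> carrier G \<Longrightarrow> left_field w f g = 0"
  by (auto simp: left_field_def)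

lemma left_field_linear:
  "left_field (v + w) = left_field v + left_field w"
  "left_field (a *\<^sub>R w) = vf_scale a (left_field w)"
proof -
  have lin: "linear (\<lambda>w. left_field w f g)" if "f \<in> smooth_functions T A" "g \<in> carrier G" for f g
    using left_field_has_derivative[OF that] by (rule has_derivative_linear)
  show "left_field (v + w) = left_field v + left_field w"
  proof (intro ext)
    fix f g
    show "left_field (v + w) f g = (left_field v + left_field w) f g"
      using linear_add[OF lin, of f g v w] left_field_outside[of f g]
      by (cases "f \<in> smooth_functions T A \<and> g \<in> carrier G") auto
  qed
  show "left_field (a *\<^sub>R w) = vf_scale a (left_field w)"
  proof (intro ext)
    fix f g
    show "left_field (a *\<^sub>R w) f g = vf_scale a (left_field w) f g"
      using linear_cmul[OF lin, of f g a w] left_field_outside[of f g]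
      by (cases "f \<in> smooth_functions T A \<and> g \<in> carrier G") (auto simp: vf_scale_def)
  qed
qed

text \<open>
  In a chart around \<open>g\<close> the derivative of \<open>u \<mapsto> f (g \<otimes> q u)\<close> is a partial derivative of the smooth function
  \<open>(a, u) \<mapsto> f (\<psi>\<^sup>-\<^sup>1 a \<otimes> q u)\<close>.
\<close>

lemma left_field_smooth:
  assumes f: "f \<in> smooth_functions T A" shows "left_field w f \<in> smooth_functions T A"
proof (rule smooth_functionsI)
  fix V \<psi> assume V: "(V, \<psi>) \<in> A"
  obtain B :: "'e set" where B: "finite_basis B" using ex_model_basis by blast
  obtain D :: "('e \<times> 'e) set" where D: "finite_basis D" using finite_basis_prod[OF B B] by blast
  let ?P = "\<lambda>z. f (inv_into V \<psi> (fst z) \<otimes> q (snd z))"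
  have P: "smooth_on (\<psi> ` V \<times> \<phi> ` U) ?P" by (rule smooth_on_mult_charts[OF V U f])
  have eq: "frechet_derivative ?P (at (a, \<phi> \<one>)) (0, w) = left_field w f (inv_into V \<psi> a)" if a: "a \<in> \<psi> ` V" for a
  proof -
    have "((\<lambda>u. (a, u)) has_derivative (\<lambda>w. (0, w))) (at (\<phi> \<one>))" by (auto intro!: derivative_eq_intros)
    moreover have "(?P has_derivative frechet_derivative ?P (at (a, \<phi> \<one>))) (at (a, \<phi> \<one>))"
      using a one_image by (intro smooth_on_has_derivative[OF P]) simp
    ultimately have "((\<lambda>u. ?P (a, u)) has_derivative (\<lambda>w. frechet_derivative ?P (at (a, \<phi> \<one>)) (0, w))) (at (\<phi> \<one>))"
      by (rule has_derivative_compose)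
    then show ?thesis
      using left_field_eqI[OF f, of "inv_into V \<psi> a"] U_carrier[OF V chart_inv_mem[OF a]] by simp
  qed
  have sm: "smooth_on (\<psi> ` V) (\<lambda>a. (a, \<phi> \<one>))"
    by (intro smooth_on_Pair smooth_on_const smooth_on_id chart_image[OF V])
  have im: "(\<lambda>a. (a, \<phi> \<one>)) ` (\<psi> ` V) \<subseteq> \<psi> ` V \<times> \<phi> ` U" using one_image by blast
  have "smooth_on (\<psi> ` V) (\<lambda>a. frechet_derivative ?P (at (a, \<phi> \<one>)) (0, w))"
    by (rule smooth_on_compose[OF D chart_image[OF V] sm smooth_on_deriv[OF P, of "(0, w)"] im])
  then show "smooth_on (\<psi> ` V) (\<lambda>a. left_field w f (inv_into V \<psi> a))"
    using smooth_on_cong[OF chart_image[OF V], of "\<lambda>a. frechet_derivative ?P (at (a, \<phi> \<one>)) (0, w)"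
      "\<lambda>a. left_field w f (inv_into V \<psi> a)"] eq by blast
qed

lemma left_field_in_lie_algebra: "left_field w \<in> lie_algebra G T A"
  unfolding lie_algebra_def smooth_vector_fields_def
proof (intro CollectI conjI ballI allI impI)
  show "left_field w f \<in> smooth_functions T A" if "f \<in> smooth_functions T A" for f
    by (rule left_field_smooth[OF that])
  show "left_field w f x = 0" if "f \<notin> smooth_functions T A \<or> x \<notin> topspace T" for f x
    using left_field_outside that by (simp add: topspace_eq_carrier)
next
  fix f h :: "'a \<Rightarrow> real" and a b :: real assume f: "f \<in> smooth_functions T A" and h: "h \<in> smooth_functions T A"
  show "left_field w (\<lambda>x. a * f x + b * h x) = (\<lambda>x. a * left_field w f x + b * left_field w h x)"
  proof
    fix g
    show "left_field w (\<lambda>x. a * f x + b * h x) g = a * left_field w f g + b * left_field w h g"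
    proof (cases "g \<in> carrier G")
      case True
      show ?thesis
        by (rule left_field_eqI[OF smooth_functions_linear[OF f h] True])
           (intro has_derivative_add has_derivative_mult_right left_field_has_derivative f h True)
    qed (simp add: left_field_outside)
  qed
next
  fix f h :: "'a \<Rightarrow> real" assume f: "f \<in> smooth_functions T A" and h: "h \<in> smooth_functions T A"
  show "left_field w (\<lambda>x. f x * h x) = (\<lambda>x. f x * left_field w h x + left_field w f x * h x)"
  proof
    fix g
    show "left_field w (\<lambda>x. f x * h x) g = f g * left_field w h g + left_field w f g * h g"
    proof (cases "g \<in> carrier G")
      case True
      have "left_field w (\<lambda>x. f x * h x) g =
          f (g \<otimes> q (\<phi> \<one>)) * left_field w h g + left_field w f g * h (g \<otimes> q (\<phi> \<one>))"
        by (rule left_field_eqI[OF smooth_functions_mult[OF f h] True])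
           (intro has_derivative_mult left_field_has_derivative f h True)
      then show ?thesis using True by (simp add: q_one)
    qed (simp add: left_field_outside)
  qed
next
  fix g f x assume g: "g \<in> carrier G" and f: "f \<in> smooth_functions T A" and x: "x \<in> carrier G"
  have "((\<lambda>u. f (g \<otimes> (x \<otimes> q u))) has_derivative (\<lambda>w. left_field w f (g \<otimes> x))) (at (\<phi> \<one>))"
  proof (rule has_derivative_transform_within_open[OF _ identity_chart.open_image one_image])
    show "((\<lambda>u. f (g \<otimes> x \<otimes> q u)) has_derivative (\<lambda>w. left_field w f (g \<otimes> x))) (at (\<phi> \<one>))"
      using f g x by (intro left_field_has_derivative) auto
  qed (use g x q_carrier in \<open>simp add: m_assoc\<close>)
  then show "left_field w (\<lambda>y. f (g \<otimes> y)) x = left_field w f (g \<otimes> x)"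
    by (rule left_field_eqI[OF smooth_functions_left_translate[OF f g] x])
qed

text \<open>
  A left-invariant field is determined by its value at the identity, since \<open>Y f g\<close> equals
  \<open>Y (\<lambda>y. f (g \<otimes> y)) \<one>\<close>, and that value is a directional derivative.
\<close>

lemma lie_algebra_eq_left_fields: "lie_algebra G T A = range left_field"
proof
  show "range left_field \<subseteq> lie_algebra G T A" using left_field_in_lie_algebra by blast
  show "lie_algebra G T A \<subseteq> range left_field"
  proof
    fix Y assume Y: "Y \<in> lie_algebra G T A"
    then have YS: "Y \<in> smooth_vector_fields T A" by (simp add: lie_algebra_def)
    obtain w where w: "\<And>f. f \<in> smooth_functions T A \<Longrightarrow> Y f \<one> = frechet_derivative (\<lambda>u. f (q u)) (at (\<phi> \<one>)) w"
      using derivation_at_point[OF U one_U YS] by blast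
    have "Y f g = left_field w f g" for f g
    proof (cases "f \<in> smooth_functions T A \<and> g \<in> carrier G")
      case True
      then have "Y f g = Y (\<lambda>y. f (g \<otimes> y)) \<one>" using Y by (simp add: lie_algebra_def)
      also have "\<dots> = left_field w f g"
        using w[OF smooth_functions_left_translate, of f g] True by (simp add: left_field_def)
      finally show ?thesis .
    next
      case False
      then show ?thesis using derivation_outside[OF YS, of f g] left_field_outside[of f g w] topspace_eq_carrier by auto
    qed
    then have "Y = left_field w" by (intro ext)
    then show "Y \<in> range left_field" by blast
  qed
qed

lemma left_field_inj: "inj left_field"
proof (rule injI)
  fix v w assume eq: "left_field v = left_field w"
  obtain B :: "'e set" where B: "finite_basis B" using ex_model_basis by blast
  have "representation B v b = representation B w b" for b
  proof -
    obtain f where f: "f \<in> smooth_functions T A"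
      "frechet_derivative (\<lambda>u. f (q u)) (at (\<phi> \<one>)) = (\<lambda>w. representation B w b)"
      using coordinate_functions[OF U one_U B] by blast
    have "left_field x f \<one> = representation B x b" for x
    proof -
      have "((\<lambda>u. f (q u)) has_derivative (\<lambda>w. representation B w b)) (at (\<phi> \<one>))"
        using smooth_on_has_derivative[OF smooth_functionsD[OF f(1) U] one_image] f(2) by simp
      then have "((\<lambda>u. f (\<one> \<otimes> q u)) has_derivative (\<lambda>w. representation B w b)) (at (\<phi> \<one>))"
        by (rule has_derivative_transform_within_open[OF _ identity_chart.open_image one_image])
           (simp add: q_carrier)
      then show ?thesis by (rule left_field_eqI[OF f(1) one_closed])
    qed
    then show ?thesis using eq by metis
  qed
  then have "(\<Sum>b\<in>B. representation B v b *\<^sub>R b) = (\<Sum>b\<in>B. representation B w b *\<^sub>R b)" by (simp only:)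
  then show "v = w" by (simp only: finite_basis_expand[OF B])
qed

definition linear_part :: "('a \<Rightarrow> 'a) \<Rightarrow> 'e \<Rightarrow> 'e" where
  "linear_part \<delta> = frechet_derivative (\<lambda>u. \<phi> (\<delta> (q u))) (at (\<phi> \<one>))"

lemma endomorphism_in_chart:
  assumes \<delta>: "smooth_map T A T A \<delta>" "\<delta> \<one> = \<one>"
  obtains N where "open N" "\<phi> \<one> \<in> N" "N \<subseteq> \<phi> ` U" "\<forall>u\<in>N. \<delta> (q u) \<in> U"
    "smooth_on N (\<lambda>u. \<phi> (\<delta> (q u)))"
proof -
  define W where "W = {x \<in> topspace T. \<delta> x \<in> U}"
  have W: "openin T W" unfolding W_def
    using \<delta>(1) by (intro openin_continuous_map_preimage[OF _ chart_domain[OF U]]) (simp add: smooth_map_def)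
  have "smooth_on (\<phi> ` (U \<inter> \<delta> -` U)) (\<phi> \<circ> \<delta> \<circ> q)" using \<delta>(1) U by (auto simp: smooth_map_def)
  then have "smooth_on (\<phi> ` (U \<inter> W)) (\<phi> \<circ> \<delta> \<circ> q)"
    by (rule smooth_on_subset) (auto simp: W_def)
  then have sm: "smooth_on (\<phi> ` (U \<inter> W)) (\<lambda>u. \<phi> (\<delta> (q u)))" by (simp add: o_def)
  show ?thesis
  proof (rule that[OF identity_chart.chart_image_open[OF W] _ _ _ sm])
    show "\<phi> \<one> \<in> \<phi> ` (U \<inter> W)" using one_U \<delta>(2) topspace_eq_carrier by (simp add: W_def)
    show "\<forall>u\<in>\<phi> ` (U \<inter> W). \<delta> (q u) \<in> U" using chart_inv[OF U] by (auto simp: W_def)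
  qed auto
qed

lemma linear_part_has_derivative:
  assumes "smooth_map T A T A \<delta>" "\<delta> \<one> = \<one>"
  shows "((\<lambda>u. \<phi> (\<delta> (q u))) has_derivative linear_part \<delta>) (at (\<phi> \<one>))"
proof -
  obtain N where N: "open N" "\<phi> \<one> \<in> N" "N \<subseteq> \<phi> ` U" "\<forall>u\<in>N. \<delta> (q u) \<in> U"
    "smooth_on N (\<lambda>u. \<phi> (\<delta> (q u)))" using endomorphism_in_chart[OF assms] .
  show ?thesis unfolding linear_part_def by (rule smooth_on_has_derivative[OF N(5,2)])
qed

text \<open>
  Since \<open>\<delta> (y \<otimes> q u) = \<delta> y \<otimes> \<delta> (q u)\<close>, this is the chain rule for \<open>f (g \<otimes> _)\<close> after \<open>\<delta>\<close> in the chart.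
\<close>

lemma induced_aut_left_field:
  assumes \<delta>: "smooth_map T A T A \<delta>" "\<delta> \<in> hom G G" and \<gamma>: "smooth_map T A T A \<gamma>"
    and \<gamma>_carrier: "\<And>x. x \<in> carrier G \<Longrightarrow> \<gamma> x \<in> carrier G"
    and \<delta>_\<gamma>: "\<And>x. x \<in> carrier G \<Longrightarrow> \<delta> (\<gamma> x) = x"
    and inv: "\<And>x. x \<in> carrier G \<Longrightarrow> inv_into (carrier G) \<delta> x = \<gamma> x"
  shows "induced_aut G \<delta> (left_field w) = left_field (linear_part \<delta> w)"
proof (intro ext)
  fix f g
  have one: "\<delta> \<one> = \<one>" using hom_one[OF \<delta>(2)] is_group by auto
  show "induced_aut G \<delta> (left_field w) f g = left_field (linear_part \<delta> w) f g"
  proof (cases "f \<in> smooth_functions T A \<and> g \<in> carrier G")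
    case True
    then have f: "f \<in> smooth_functions T A" and g: "g \<in> carrier G" by auto
    define y where "y = \<gamma> g"
    have y: "y \<in> carrier G" "\<delta> y = g" using g \<gamma>_carrier \<delta>_\<gamma> by (auto simp: y_def)
    obtain N where N: "open N" "\<phi> \<one> \<in> N" "N \<subseteq> \<phi> ` U" "\<forall>u\<in>N. \<delta> (q u) \<in> U"
      "smooth_on N (\<lambda>u. \<phi> (\<delta> (q u)))"
      using endomorphism_in_chart[OF \<delta>(1) one] .
    have d1: "((\<lambda>u. \<phi> (\<delta> (q u))) has_derivative linear_part \<delta>) (at (\<phi> \<one>))"
      by (rule linear_part_has_derivative[OF \<delta>(1) one])
    have d2: "((\<lambda>u. f (g \<otimes> q u)) has_derivative (\<lambda>w. left_field w f g)) (at (\<phi> (\<delta> (q (\<phi> \<one>)))))"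
      using left_field_has_derivative[OF f g] by (simp add: q_one one)
    have "((\<lambda>u. (f \<circ> \<delta>) (y \<otimes> q u)) has_derivative (\<lambda>w. left_field (linear_part \<delta> w) f g)) (at (\<phi> \<one>))"
    proof (rule has_derivative_transform_within_open[OF has_derivative_compose[OF d1 d2] N(1,2)])
      fix u assume u: "u \<in> N"
      have "q (\<phi> (\<delta> (q u))) = \<delta> (q u)" using bspec[OF N(4) u] chart_inv[OF U] by blast
      moreover have "q u \<in> carrier G" using u N(3) q_carrier by blast
      ultimately show "f (g \<otimes> q (\<phi> (\<delta> (q u)))) = (f \<circ> \<delta>) (y \<otimes> q u)"
        using hom_mult[OF \<delta>(2) y(1)] y(2) by simp
    qed
    then have "left_field w (f \<circ> \<delta>) y = left_field (linear_part \<delta> w) f g"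
      by (rule left_field_eqI[OF smooth_functions_compose[OF \<delta>(1) f] y(1)])
    then show ?thesis using g inv by (simp add: induced_aut_def y_def)
  next
    case False
    have "f \<circ> \<delta> \<notin> smooth_functions T A" if "f \<notin> smooth_functions T A"
    proof
      assume "f \<circ> \<delta> \<in> smooth_functions T A"
      then have "f \<circ> \<delta> \<circ> \<gamma> \<in> smooth_functions T A" by (rule smooth_functions_compose[OF \<gamma>])
      then have "f \<in> smooth_functions T A"
        by (rule smooth_functions_cong) (simp add: \<delta>_\<gamma> topspace_eq_carrier)
      then show False using that by simp
    qed
    then have "induced_aut G \<delta> (left_field w) f g = 0"
      using False left_field_outside by (auto simp: induced_aut_def)
    then show ?thesis using left_field_outside False by auto
  qed
qed

section \<open>The group law and automorphisms to first and second order\<close>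

text \<open>
  Let \<open>m\<close> be the product in the chart. Then \<open>m (a, b) - b\<close> has a vanishing derivative in the second variable at the identity, because
  \<open>m (\<phi> \<one>, b) = b\<close>. By Lipschitz continuity this derivative has norm at most \<open>1/2\<close> on a small ball, and the mean
  value inequality in \<open>b\<close> applies.
\<close>

lemma mult_first_order:
  "\<exists>r>0. cball (\<phi> \<one>) r \<subseteq> \<phi> ` U \<and>
    (\<forall>x\<in>U. \<forall>y\<in>U. norm (\<phi> x - \<phi> \<one>) \<le> r \<longrightarrow> norm (\<phi> y - \<phi> \<one>) \<le> r \<longrightarrow> x \<otimes> y \<in> U \<and>
      norm ((\<phi> (x \<otimes> y) - \<phi> \<one>) - (\<phi> x - \<phi> \<one>) - (\<phi> y - \<phi> \<one>)) \<le> norm (\<phi> y - \<phi> \<one>) / 2)"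
proof -
  let ?p = "\<phi> \<one>" and ?m = "\<lambda>z. \<phi> (q (fst z) \<otimes> q (snd z))"
  obtain B :: "'e set" where B: "finite_basis B" using ex_model_basis by blast
  obtain D :: "('e \<times> 'e) set" where D: "finite_basis D" using finite_basis_prod[OF B B] by blast
  have "\<one> \<otimes> \<one> \<in> U" using one_U by simp
  note 1 = mult_in_charts[OF U one_U U one_U U this]
  obtain N1 N2 where N: "open N1" "open N2" "?p \<in> N1" "?p \<in> N2" "N1 \<subseteq> \<phi> ` U" "N2 \<subseteq> \<phi> ` U"
    and mU: "\<forall>a\<in>N1. \<forall>b\<in>N2. q a \<otimes> q b \<in> U"
    and sm: "smooth_on (N1 \<times> N2) ?m" using 1 .
  have "open (N1 \<inter> N2)" "?p \<in> N1 \<inter> N2" using N by auto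
  then obtain s where s: "s > 0" "cball ?p s \<subseteq> N1 \<inter> N2" using open_contains_cball by blast
  let ?K = "cball ?p s \<times> cball ?p s" and ?D = "\<lambda>z. frechet_derivative ?m (at z)"
  have K: "compact ?K" "convex ?K" "?K \<subseteq> N1 \<times> N2"
    using s(2) by (auto intro: compact_Times finite_basis_compact_cball[OF B] convex_Times)
  obtain M where M: "M \<ge> 0" "\<And>y z w. y \<in> ?K \<Longrightarrow> z \<in> ?K \<Longrightarrow> norm (?D z w - ?D y w) \<le> M * norm (z - y) * norm w"
    using smooth_on_lipschitz_deriv[OF D sm K] by blast
  have partial: "((\<lambda>b. ?m (a, b)) has_derivative (\<lambda>w. ?D (a, b) (0, w))) (at b)"
    if "a \<in> cball ?p s" "b \<in> cball ?p s" for a b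
  proof -
    have "((\<lambda>b. (a, b)) has_derivative (\<lambda>w. (0, w))) (at b)" by (auto intro!: derivative_eq_intros)
    moreover have "(a, b) \<in> N1 \<times> N2" using that K(3) by blast
    then have "(?m has_derivative ?D (a, b)) (at (a, b))" by (rule smooth_on_has_derivative[OF sm])
    ultimately show ?thesis by (rule has_derivative_compose)
  qed
  have D0: "?D (?p, ?p) (0, w) = w" for w
  proof -
    have 1: "((\<lambda>b. ?m (?p, b)) has_derivative (\<lambda>w. w)) (at ?p)"
    proof (rule has_derivative_transform_within_open[OF has_derivative_ident identity_chart.open_image one_image])
      fix b assume b: "b \<in> \<phi> ` U"
      then show "b = ?m (?p, b)" using q_carrier[OF b] by (simp add: q_one f_inv_into_f)
    qed
    have 2: "((\<lambda>b. ?m (?p, b)) has_derivative (\<lambda>w. ?D (?p, ?p) (0, w))) (at ?p)"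
      using s(1) by (intro partial) auto
    show ?thesis using fun_cong[OF has_derivative_unique[OF 2 1]] .
  qed
  (* Points of the product of two balls of radius r have distance at most 2 * r from the centre, so the
     derivative moves by at most M * (2 * r), which has to be at most 1/2. *)
  define r where "r = min s (1 / (4 * (M + 1)))"
  have r: "r > 0" "r \<le> s" using s(1) M(1) by (auto simp: r_def)
  have "M * (2 * r) \<le> M * (2 * (1 / (4 * (M + 1))))" using M(1) by (intro mult_left_mono) (auto simp: r_def)
  also have "\<dots> \<le> 1 / 2" using M(1) by (simp add: field_simps)
  finally have Mr: "M * (2 * r) \<le> 1 / 2" .
  have est: "norm ((?m (a, b) - b) - (?m (a, ?p) - ?p)) \<le> 1/2 * norm (b - ?p)"
    if a: "a \<in> cball ?p r" and b: "b \<in> cball ?p r" for a b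
  proof (rule differentiable_bound[OF convex_cball _ _ b])
    show "?p \<in> cball ?p r" using r by simp
    fix x assume x: "x \<in> cball ?p r"
    have as: "a \<in> cball ?p s" "x \<in> cball ?p s" using a x r(2) by auto
    show "((\<lambda>b. ?m (a, b) - b) has_derivative (\<lambda>w. ?D (a, x) (0, w) - w)) (at x within cball ?p r)"
      by (intro has_derivative_at_withinI[OF has_derivative_diff[OF partial[OF as] has_derivative_ident]])
    have "norm ((a, x) - (?p, ?p)) \<le> norm (a - ?p) + norm (x - ?p)" by (simp add: norm_Pair_le)
    also have "\<dots> \<le> 2 * r" using a x by (simp add: dist_norm norm_minus_commute)
    finally have le: "M * norm ((a, x) - (?p, ?p)) \<le> 1 / 2"
      using Mr M(1) by (meson mult_left_mono order_trans)
    show "onorm (\<lambda>w. ?D (a, x) (0, w) - w) \<le> 1/2"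
    proof (rule onorm_bound)
      fix w
      have "norm (?D (a, x) (0, w) - w) = norm (?D (a, x) (0, w) - ?D (?p, ?p) (0, w))" by (simp add: D0)
      also have "\<dots> \<le> M * norm ((a, x) - (?p, ?p)) * norm (0::'e, w)"
        using as s(1) by (intro M(2)) auto
      also have "\<dots> \<le> 1/2 * norm (0::'e, w)" by (rule mult_right_mono[OF le norm_ge_zero])
      finally show "norm (?D (a, x) (0, w) - w) \<le> 1/2 * norm w" by (simp add: norm_Pair)
    qed simp
  qed
  show ?thesis
  proof (intro exI[of _ r] conjI ballI impI r(1))
    show "cball ?p r \<subseteq> \<phi> ` U" using r(2) s(2) N(5) by fastforce
    fix x y assume xy: "x \<in> U" "y \<in> U" "norm (\<phi> x - ?p) \<le> r" "norm (\<phi> y - ?p) \<le> r"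
    have mem: "\<phi> x \<in> cball ?p r" "\<phi> y \<in> cball ?p r" using xy by (auto simp: dist_norm norm_minus_commute)
    have qx: "q (\<phi> x) = x" "q (\<phi> y) = y" using xy chart_inv[OF U] by auto
    have "\<phi> x \<in> N1" "\<phi> y \<in> N2" using mem r(2) s(2) by auto
    then have "q (\<phi> x) \<otimes> q (\<phi> y) \<in> U" using mU by blast
    then show "x \<otimes> y \<in> U" by (simp add: qx)
    have "?m (\<phi> x, ?p) = \<phi> x" using U_carrier[OF U xy(1)] by (simp add: qx q_one)
    then show "norm ((\<phi> (x \<otimes> y) - ?p) - (\<phi> x - ?p) - (\<phi> y - ?p)) \<le> norm (\<phi> y - ?p) / 2"
      using est[OF mem] by (simp add: qx algebra_simps)
  qed
qed

text \<open>
  A first order estimate would not suffice: iterating it loses a factor \<open>(1 + \<epsilon>)\<^sup>n\<close>, whereas the quadratic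
  errors along a contracting orbit are summable.
\<close>

lemma endomorphism_second_order:
  assumes \<delta>: "smooth_map T A T A \<delta>" "\<delta> \<one> = \<one>"
  shows "\<exists>r>0. \<exists>M\<ge>0. \<forall>x\<in>U. norm (\<phi> x - \<phi> \<one>) \<le> r \<longrightarrow> \<delta> x \<in> U \<and>
      norm ((\<phi> (\<delta> x) - \<phi> \<one>) - linear_part \<delta> (\<phi> x - \<phi> \<one>)) \<le> M * (norm (\<phi> x - \<phi> \<one>))\<^sup>2"
proof -
  obtain B :: "'e set" where B: "finite_basis B" using ex_model_basis by blast
  obtain N where N: "open N" "\<phi> \<one> \<in> N" "N \<subseteq> \<phi> ` U" "\<forall>u\<in>N. \<delta> (q u) \<in> U"
    "smooth_on N (\<lambda>u. \<phi> (\<delta> (q u)))" using endomorphism_in_chart[OF \<delta>] .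
  obtain r where r: "r > 0" "cball (\<phi> \<one>) r \<subseteq> N" using N(1,2) open_contains_cball by blast
  obtain M where M: "M \<ge> 0" "\<And>y z. y \<in> cball (\<phi> \<one>) r \<Longrightarrow> z \<in> cball (\<phi> \<one>) r \<Longrightarrow>
      norm (\<phi> (\<delta> (q z)) - \<phi> (\<delta> (q y)) - frechet_derivative (\<lambda>u. \<phi> (\<delta> (q u))) (at y) (z - y)) \<le> M * (norm (z - y))\<^sup>2"
    using smooth_on_taylor2[OF B N(5) finite_basis_compact_cball[OF B] convex_cball r(2)] by blast
  show ?thesis
  proof (rule exI[of _ r], rule conjI[OF r(1)], rule exI[of _ M], rule conjI[OF M(1)], intro ballI impI conjI)
    fix x assume x: "x \<in> U" "norm (\<phi> x - \<phi> \<one>) \<le> r"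
    have mem: "\<phi> x \<in> cball (\<phi> \<one>) r" using x by (simp add: dist_norm norm_minus_commute)
    have qx: "q (\<phi> x) = x" using x chart_inv[OF U] by auto
    have "\<delta> (q (\<phi> x)) \<in> U" using N(4) mem r(2) by blast
    then show "\<delta> x \<in> U" by (simp add: qx)
    show "norm ((\<phi> (\<delta> x) - \<phi> \<one>) - linear_part \<delta> (\<phi> x - \<phi> \<one>)) \<le> M * (norm (\<phi> x - \<phi> \<one>))\<^sup>2"
      using M(2)[OF _ mem, of "\<phi> \<one>"] r(1) by (simp add: qx q_one \<delta>(2) linear_part_def)
  qed
qed

end

section \<open>Power bounded linear maps\<close>

locale complex_operator = vector_space s for s :: "complex \<Rightarrow> 'v::ab_group_add \<Rightarrow> 'v" +
  fixes L :: "'v \<Rightarrow> 'v"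
  assumes L_add: "L (x + y) = L x + L y" and L_scale: "L (s z x) = s z (L x)"
begin

abbreviation shifted :: "complex \<Rightarrow> 'v \<Rightarrow> 'v" where "shifted z y \<equiv> L y - s z y"

lemma L_zero: "L 0 = 0" using L_scale[of 0 0] by simp
lemma L_minus: "L (- x) = - L x" using L_scale[of "-1" x] by simp
lemma L_diff: "L (x - y) = L x - L y" using L_add[of x "- y"] by (simp add: L_minus)
lemma L_sum: "L (sum f I) = (\<Sum>i\<in>I. L (f i))"
  by (induction I rule: infinite_finite_induct) (auto simp: L_zero L_add)

lemma shifted_linear:
  "shifted z (x + y) = shifted z x + shifted z y" "shifted z (x - y) = shifted z x - shifted z y"
  "shifted z (s a x) = s a (shifted z x)" "shifted z 0 = 0"
  by (simp_all add: L_add L_diff L_scale L_zero scale_right_distrib scale_right_diff_distrib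
      scale_left_commute)

lemma shifted_sum: "shifted z (sum f I) = (\<Sum>i\<in>I. shifted z (f i))"
  by (simp add: L_sum scale_sum_right sum_subtractf)

lemma pow_linear:
  "(L ^^ n) (x + y) = (L ^^ n) x + (L ^^ n) y" "(L ^^ n) (s z x) = s z ((L ^^ n) x)" "(L ^^ n) 0 = 0"
  by (induction n) (auto simp: L_add L_scale L_zero)

lemma pow_sum: "(L ^^ n) (sum f I) = (\<Sum>i\<in>I. (L ^^ n) (f i))"
  by (induction I rule: infinite_finite_induct) (auto simp: pow_linear)

lemma pow_eigen: "L y = s z y \<Longrightarrow> (L ^^ n) y = s (z ^ n) y"
  by (induction n) (auto simp: L_scale mult.commute)

lemma shifted_pow_eigen:
  assumes "L y = s w y" shows "((\<lambda>x. L x - s z x) ^^ k) y = s ((w - z) ^ k) y"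
  by (induction k) (auto simp: L_scale assms scale_left_diff_distrib[symmetric] left_diff_distrib mult.commute)

text \<open>
  If \<open>(L - z)\<^sup>2 v = 0\<close> implies \<open>(L - z) v = 0\<close> then all generalized eigenvectors are eigenvectors, and any basis of
  the eigenspace diagonalizes. Conversely an eigenvector lying in the generalized eigenspace of \<open>z\<close> has
  eigenvalue \<open>z\<close>. The condition on the right is easier to transport than diagonalizability.
\<close>

lemma diagonalizable_generalized_eigenspace_iff:
  assumes V: "subspace V" and inv: "\<And>v. v \<in> V \<Longrightarrow> L v \<in> V"
  shows "diagonalizable_on s (generalized_eigenspace s V L z) L \<longleftrightarrow>
    (\<forall>v\<in>V. shifted z (shifted z v) = 0 \<longrightarrow> shifted z v = 0)"
proof
  assume "diagonalizable_on s (generalized_eigenspace s V L z) L"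
  then obtain B where B: "independent B" "span B = generalized_eigenspace s V L z"
    "\<And>b. b \<in> B \<Longrightarrow> \<exists>z. L b = s z b" unfolding diagonalizable_on_def by blast
  have eig: "shifted z b = 0" if b: "b \<in> B" for b
  proof -
    obtain w where w: "L b = s w b" using B(3)[OF b] by blast
    have "b \<in> generalized_eigenspace s V L z" using B(2) span_base[OF b] by simp
    then obtain k where "((\<lambda>x. L x - s z x) ^^ k) b = 0" unfolding generalized_eigenspace_def by auto
    then have "s ((w - z) ^ k) b = 0" by (simp add: shifted_pow_eigen[OF w])
    moreover have "b \<noteq> 0" using B(1) b dependent_zero by blast
    ultimately have "w = z" by auto
    then show ?thesis by (simp add: w)
  qed
  have all: "shifted z v = 0" if "v \<in> span B" for v
    using that
  proof (induction rule: span_induct_alt)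
    case base show ?case by (rule shifted_linear)
  next
    case (step c x y) then show ?case by (simp only: shifted_linear eig) simp
  qed
  show "\<forall>v\<in>V. shifted z (shifted z v) = 0 \<longrightarrow> shifted z v = 0"
  proof (intro ballI impI)
    fix v assume v: "v \<in> V" "shifted z (shifted z v) = 0"
    then have "((\<lambda>x. L x - s z x) ^^ 2) v = 0" by (simp add: numeral_2_eq_2)
    then have "v \<in> generalized_eigenspace s V L z"
      unfolding generalized_eigenspace_def using v(1) by blast
    then show "shifted z v = 0" using all B(2) by simp
  qed
next
  assume nj: "\<forall>v\<in>V. shifted z (shifted z v) = 0 \<longrightarrow> shifted z v = 0"
  have sV: "shifted z v \<in> V" if "v \<in> V" for v
    using V inv that by (intro subspace_diff subspace_scale)
  have "shifted z v = 0" if "((\<lambda>x. L x - s z x) ^^ k) v = 0" "v \<in> V" for k v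
    using that
  proof (induction k arbitrary: v)
    case 0 then show ?case by (simp add: L_zero)
  next
    case (Suc k)
    have "((\<lambda>x. L x - s z x) ^^ k) (shifted z v) = 0"
      using Suc.prems(1) by (simp only: funpow_Suc_right o_apply)
    then have "shifted z (shifted z v) = 0" using sV[OF Suc.prems(2)] by (rule Suc.IH)
    then show ?case using nj Suc.prems by blast
  qed
  moreover have "((\<lambda>x. L x - s z x) ^^ 1) v = shifted z v" for v by simp
  ultimately have E: "generalized_eigenspace s V L z = {v \<in> V. shifted z v = 0}"
    unfolding generalized_eigenspace_def by (metis (no_types, lifting))
  have sub: "subspace {v \<in> V. shifted z v = 0}"
  proof (rule subspaceI)
    show "0 \<in> {v \<in> V. shifted z v = 0}" using V by (simp add: subspace_0 L_zero)
  next
    fix x y assume "x \<in> {v \<in> V. shifted z v = 0}" "y \<in> {v \<in> V. shifted z v = 0}"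
    then show "x + y \<in> {v \<in> V. shifted z v = 0}"
      using V by (simp add: subspace_add L_add scale_right_distrib)
  next
    fix c x assume "x \<in> {v \<in> V. shifted z v = 0}"
    then show "s c x \<in> {v \<in> V. shifted z v = 0}"
      using V shifted_linear(3)[where z=z and a=c and x=x] by (auto simp: subspace_scale)
  qed
  obtain B where B: "B \<subseteq> {v \<in> V. shifted z v = 0}" "independent B" "{v \<in> V. shifted z v = 0} \<subseteq> span B"
    using maximal_independent_subset by blast
  then have "span B = {v \<in> V. shifted z v = 0}" using span_minimal[OF B(1) sub] by blast
  moreover have "\<exists>w. L b = s w b" if "b \<in> B" for b using B(1) that by auto
  ultimately show "diagonalizable_on s (generalized_eigenspace s V L z) L"
    unfolding diagonalizable_on_def E using B(2) by blast
qed

context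
  fixes L' assumes L': "complex_operator s L'"
begin

lemma inverse_eigenvector_iff:
  assumes "\<And>v. L (L' v) = v" "\<And>v. L' (L v) = v" "z \<noteq> 0"
  shows "L' v = s (1 / z) v \<longleftrightarrow> L v = s z v"
proof
  assume "L v = s z v"
  then have "v = s z (L' v)" using complex_operator.L_scale[OF L'] assms(2) by metis
  then have "s (1 / z) v = s (1 / z) (s z (L' v))" by simp
  then show "L' v = s (1 / z) v" using assms(3) by simp
next
  assume "L' v = s (1 / z) v"
  then have "v = s (1 / z) (L v)" using L_scale assms(1) by metis
  then have "s z v = s z (s (1 / z) (L v))" by simp
  then show "L v = s z v" using assms(3) by simp
qed

lemma inverse_no_kernel:
  assumes "\<And>v. L' (L v) = v" shows "\<not> (\<exists>v. v \<noteq> 0 \<and> L v = s 0 v)"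
proof
  assume "\<exists>v. v \<noteq> 0 \<and> L v = s 0 v"
  then obtain v where v: "v \<noteq> 0" "L v = 0" by auto
  then have "v = L' 0" using assms[of v] by simp
  then show False using v(1) complex_operator.L_zero[OF L'] by simp
qed

text \<open>
  A Jordan chain for the inverse at \<open>1 / z\<close> starting at \<open>v\<close> is, up to nonzero scalars, a Jordan chain for \<open>L\<close>
  at \<open>z\<close>: with \<open>a = L' v - v / z\<close> and \<open>b = L v - z v\<close> one has \<open>L a = - b / z\<close>.
\<close>

lemma inverse_no_jordan:
  assumes LL': "\<And>v. L (L' v) = v" and L'L: "\<And>v. L' (L v) = v" and z: "z \<noteq> 0"
    and nj: "\<forall>v. shifted z (shifted z v) = 0 \<longrightarrow> shifted z v = 0"
  shows "\<forall>v. L' (L' v - s (1 / z) v) - s (1 / z) (L' v - s (1 / z) v) = 0 \<longrightarrow> L' v - s (1 / z) v = 0"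
proof (intro allI impI)
  fix v
  define a where "a = L' v - s (1 / z) v"
  define b where "b = shifted z v"
  assume "L' (L' v - s (1 / z) v) - s (1 / z) (L' v - s (1 / z) v) = 0"
  then have "L' a = s (1 / z) a" by (simp add: a_def)
  then have La: "L a = s z a" using inverse_eigenvector_iff[OF LL' L'L z] by blast
  have "L a = v - s (1 / z) (L v)" by (simp add: a_def L_diff L_scale LL')
  then have Lab: "L a = s (- (1 / z)) b" using z by (simp add: b_def scale_right_diff_distrib)
  have "s (- z) (L a) = b" unfolding Lab using z by simp
  then have b: "b = s (- z * z) a" unfolding La by simp
  have "shifted z b = s (- z * z) (shifted z a)" unfolding b by (rule shifted_linear(3))
  also have "\<dots> = 0" by (simp add: La)
  finally have "b = 0" using nj unfolding b_def by blast
  then have "L a = 0" using Lab by simp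
  then have "a = 0" using L'L[of a] complex_operator.L_zero[OF L'] by simp
  then show "L' v - s (1 / z) v = 0" by (simp add: a_def)
qed

end

text \<open>
  The product of the operators \<open>L - z\<close> over a list. The order in the list matters in the proofs below, which
  remove the factors one at a time from the side of the argument.
\<close>

fun shifted_list :: "complex list \<Rightarrow> 'v \<Rightarrow> 'v" where
  "shifted_list [] y = y"
| "shifted_list (z # zs) y = shifted_list zs (shifted z y)"

lemma shifted_list_append: "shifted_list (xs @ ys) y = shifted_list ys (shifted_list xs y)"
  by (induction xs arbitrary: y) auto

definition poly_apply :: "complex poly \<Rightarrow> 'v \<Rightarrow> 'v" where
  "poly_apply p y = (\<Sum>i\<le>degree p. s (coeff p i) ((L ^^ i) y))"

lemma poly_apply_le:
  assumes "degree p \<le> N" shows "poly_apply p y = (\<Sum>i\<le>N. s (coeff p i) ((L ^^ i) y))"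
  unfolding poly_apply_def using assms by (intro sum.mono_neutral_left) (auto simp: coeff_eq_0)

lemma poly_apply_smult: "poly_apply (smult a p) y = s a (poly_apply p y)"
  by (subst (1 2) poly_apply_le[of _ "degree p"]) (auto simp: scale_sum_right degree_smult_le)

lemma poly_apply_add: "poly_apply (p + q) y = poly_apply p y + poly_apply q y"
  by (subst (1 2 3) poly_apply_le[of _ "max (degree p) (degree q)"])
     (auto simp: sum.distrib scale_left_distrib degree_add_le)

lemma poly_apply_linear:
  "poly_apply p (x + y) = poly_apply p x + poly_apply p y" "poly_apply p (s a x) = s a (poly_apply p x)"
  by (simp_all add: poly_apply_def pow_linear scale_right_distrib sum.distrib scale_sum_right mult.commute)

lemma poly_apply_pCons: "poly_apply (pCons a p) y = s a y + poly_apply p (L y)"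
proof -
  have "poly_apply (pCons a p) y = (\<Sum>i\<le>Suc (degree p). s (coeff (pCons a p) i) ((L ^^ i) y))"
    by (rule poly_apply_le) (rule degree_pCons_le)
  also have "\<dots> = s a y + (\<Sum>i\<le>degree p. s (coeff p i) ((L ^^ i) (L y)))"
    unfolding sum.atMost_Suc_shift by (simp add: funpow_swap1)
  finally show ?thesis by (simp add: poly_apply_def)
qed

lemma poly_apply_root_mult: "poly_apply ([:- z, 1:] * q) y = poly_apply q (shifted z y)"
proof -
  have "poly_apply ([:- z, 1:] * q) y = s (-z) (poly_apply q y) + poly_apply q (L y)"
    by (simp add: poly_apply_add poly_apply_smult poly_apply_pCons del: smult_minus_left)
  also have "\<dots> = poly_apply q (L y + s (-z) y)"
    unfolding poly_apply_linear(1) poly_apply_linear(2)[of q "-z"] by (rule add.commute)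
  finally show ?thesis by simp
qed

lemma poly_apply_prod_list: "poly_apply (prod_list (map (\<lambda>z. [:- z, 1:]) zs)) y = shifted_list zs y"
proof (induction zs arbitrary: y)
  case Nil show ?case by (simp add: poly_apply_def)
next
  case (Cons z zs) then show ?case by (simp only: list.map prod_list.Cons poly_apply_root_mult shifted_list.simps)
qed

text \<open>
  Induction on the list: if \<open>(L - w) y\<close> is a sum of eigenvectors \<open>e z\<close> then subtracting
  \<open>e z / (z - w)\<close> for \<open>z \<noteq> w\<close> from \<open>y\<close> leaves \<open>y'\<close> with \<open>(L - w)\<^sup>2 y' = 0\<close>. By \<open>S2\<close>, \<open>y'\<close> is itself an
  eigenvector for \<open>w\<close> or, if \<open>cmod w > c\<close>, it vanishes by \<open>S1\<close>.
\<close>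

lemma shifted_list_kernel:
  assumes S1: "\<And>z v. v \<noteq> 0 \<Longrightarrow> L v = s z v \<Longrightarrow> cmod z \<le> c"
    and S2: "\<And>z v. cmod z = c \<Longrightarrow> shifted z (shifted z v) = 0 \<Longrightarrow> shifted z v = 0"
  shows "\<forall>z\<in>set zs. c \<le> cmod z \<Longrightarrow> shifted_list zs y = 0 \<Longrightarrow>
    \<exists>Z e. finite Z \<and> (\<forall>z\<in>Z. cmod z = c \<and> L (e z) = s z (e z)) \<and> y = (\<Sum>z\<in>Z. e z)"
proof (induction zs arbitrary: y)
  case Nil
  then show ?case by (intro exI[of _ "{}"]) auto
next
  case (Cons w zs)
  obtain Z e where Z: "finite Z" "\<And>z. z \<in> Z \<Longrightarrow> cmod z = c" "\<And>z. z \<in> Z \<Longrightarrow> L (e z) = s z (e z)"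
    and u: "shifted w y = (\<Sum>z\<in>Z. e z)"
    using Cons.IH[of "shifted w y"] Cons.prems by auto
  (* The preimage of e z under L - w, which acts on e z as the scalar z - w. *)
  define e' where "e' z = s (1 / (z - w)) (e z)" for z
  define y' where "y' = y - (\<Sum>z\<in>Z-{w}. e' z)"
  have e': "L (e' z) = s z (e' z)" if "z \<in> Z" for z
    unfolding e'_def using Z(3)[OF that] by (simp add: L_scale mult.commute)
  have "shifted w (e' z) = e z" if "z \<in> Z - {w}" for z
  proof -
    have "shifted w (e' z) = s (z - w) (e' z)" using e' that by (simp add: scale_left_diff_distrib)
    then show ?thesis using that by (simp add: e'_def)
  qed
  then have "shifted w y' = (\<Sum>z\<in>Z. e z) - (\<Sum>z\<in>Z-{w}. e z)"
    unfolding y'_def shifted_linear(2) u shifted_sum by simp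
  also have "\<dots> = (if w \<in> Z then e w else 0)"
    using Z(1) by (simp add: sum.remove)
  finally have y': "shifted w y' = (if w \<in> Z then e w else 0)" .
  have z0: "shifted w y' = 0"
  proof (cases "w \<in> Z")
    case True
    have "shifted w (shifted w y') = 0" using y' True Z(3) by simp
    then show ?thesis using S2 Z(2)[OF True] by blast
  qed (use y' in simp)
  show ?case
  proof (cases "cmod w = c")
    case True
    define f where "f z = (if z = w then y' else e' z)" for z
    have "(\<Sum>z\<in>insert w Z. f z) = y' + (\<Sum>z\<in>Z-{w}. f z)"
      using Z(1) by (simp add: sum.insert_remove f_def)
    also have "(\<Sum>z\<in>Z-{w}. f z) = (\<Sum>z\<in>Z-{w}. e' z)"
      by (intro sum.cong) (auto simp: f_def)
    finally have "y = (\<Sum>z\<in>insert w Z. f z)" by (simp add: y'_def)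
    moreover have "cmod z = c \<and> L (f z) = s z (f z)" if "z \<in> insert w Z" for z
      using that True z0 Z(2) e' by (auto simp: f_def)
    moreover have "finite (insert w Z)" using Z(1) by simp
    ultimately show ?thesis by blast
  next
    case False
    have "y' = 0"
    proof (rule ccontr)
      assume "y' \<noteq> 0"
      then have "cmod w \<le> c" using S1 z0 by auto
      then show False using False Cons.prems by auto
    qed
    then have "y = (\<Sum>z\<in>Z-{w}. e' z)" by (simp add: y'_def)
    then show ?thesis using Z e' by (intro exI[of _ "Z-{w}"] exI[of _ e']) auto
  qed
qed

end

text \<open>
  The constant \<open>K\<close> allows a norm that is equivalent to a complex norm, such as the product norm on a
  complexification.
\<close>

locale normed_complex_operator = complex_operator s L
  for s :: "complex \<Rightarrow> 'v::real_normed_vector \<Rightarrow> 'v" and L +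
  fixes K c :: real
  assumes norm_scale: "norm (s z x) \<le> K * cmod z * norm x" and K: "K \<ge> 0" and c: "c > 0"
begin

definition growth :: "'v \<Rightarrow> bool" where
  "growth y \<longleftrightarrow> (\<exists>M. \<forall>n. norm ((L ^^ n) y) \<le> M * c ^ n)"

lemma growth_sum:
  assumes "\<And>i. i \<in> I \<Longrightarrow> growth (f i)" shows "growth (sum f I)"
proof -
  obtain M where M: "\<And>i n. i \<in> I \<Longrightarrow> norm ((L ^^ n) (f i)) \<le> M i * c ^ n"
    using assms unfolding growth_def by metis
  have "norm ((L ^^ n) (sum f I)) \<le> (\<Sum>i\<in>I. M i) * c ^ n" for n
    unfolding pow_sum sum_distrib_right using M by (intro order_trans[OF norm_sum] sum_mono)
  then show ?thesis unfolding growth_def by blast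
qed

lemma growth_eigen:
  assumes "L y = s z y" "cmod z \<le> c" shows "growth y"
  unfolding growth_def
proof (intro exI allI)
  fix n
  have "norm ((L ^^ n) y) \<le> K * cmod z ^ n * norm y"
    using norm_scale[of "z ^ n" y] by (simp add: pow_eigen[OF assms(1)] norm_power)
  also have "\<dots> \<le> K * c ^ n * norm y"
    using K assms(2) by (intro mult_right_mono mult_left_mono power_mono) auto
  finally show "norm ((L ^^ n) y) \<le> (K * norm y) * c ^ n" by (simp add: mult_ac)
qed

text \<open>
  From \<open>L\<^sup>n\<^sup>+\<^sup>1 y = z L\<^sup>n y + L\<^sup>n (L y - z y)\<close> the growth constants satisfy a contracting recursion. The statement
  proved by induction includes an arbitrary scalar \<open>w\<close> so that \<open>K\<close> enters once and not in every step.
\<close>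

lemma growth_peel:
  assumes "growth (shifted z y)" "cmod z < c" shows "growth y"
proof -
  obtain M0 where M0: "\<And>n. norm ((L ^^ n) (shifted z y)) \<le> M0 * c ^ n"
    using assms(1) unfolding growth_def by blast
  define M where "M = max M0 0"
  have M: "norm ((L ^^ n) (shifted z y)) \<le> M * c ^ n" for n
    using M0[of n] c by (intro order_trans[OF M0] mult_right_mono) (auto simp: M_def)
  (* The smallest constant that covers n = 0 and is preserved by the recursion. *)
  define R where "R = max (norm y) (M / (c - cmod z))"
  have R: "cmod z * R + M \<le> R * c"
  proof -
    have "M / (c - cmod z) \<le> R" by (simp add: R_def)
    then show ?thesis using assms(2) by (simp add: field_simps)
  qed
  have "\<forall>w. norm (s w ((L ^^ n) y)) \<le> K * cmod w * (R * c ^ n)" for n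
  proof (induction n)
    case 0
    have "norm y \<le> R" by (simp add: R_def)
    then have "K * cmod w * norm y \<le> K * cmod w * R" for w using K by (intro mult_left_mono) auto
    then show ?case using norm_scale by (auto intro: order_trans)
  next
    case (Suc n)
    show ?case
    proof
      fix w
      have "(L ^^ Suc n) y = (L ^^ n) (s z y + shifted z y)" by (simp add: funpow_swap1)
      also have "\<dots> = s z ((L ^^ n) y) + (L ^^ n) (shifted z y)" by (simp only: pow_linear)
      finally have "s w ((L ^^ Suc n) y) = s (w * z) ((L ^^ n) y) + s w ((L ^^ n) (shifted z y))"
        by (simp add: scale_right_distrib)
      also have "norm \<dots> \<le> K * cmod (w * z) * (R * c ^ n) + K * cmod w * norm ((L ^^ n) (shifted z y))"
        using Suc norm_scale by (intro norm_triangle_mono) auto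
      also have "\<dots> \<le> K * cmod (w * z) * (R * c ^ n) + K * cmod w * (M * c ^ n)"
        using M K by (intro add_left_mono mult_left_mono) auto
      also have "\<dots> = K * cmod w * ((cmod z * R + M) * c ^ n)" by (simp add: norm_mult algebra_simps)
      also have "\<dots> \<le> K * cmod w * ((R * c) * c ^ n)"
        using R K c by (intro mult_left_mono mult_right_mono) auto
      finally show "norm (s w ((L ^^ Suc n) y)) \<le> K * cmod w * (R * c ^ Suc n)" by (simp add: mult_ac)
    qed
  qed
  then have "norm (s 1 ((L ^^ n) y)) \<le> K * cmod 1 * (R * c ^ n)" for n by blast
  then have "norm ((L ^^ n) y) \<le> (K * R) * c ^ n" for n by (simp add: mult_ac)
  then show ?thesis unfolding growth_def by blast
qed

lemma growth_shifted_list: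
  "\<forall>z\<in>set zs. cmod z < c \<Longrightarrow> growth (shifted_list zs y) \<Longrightarrow> growth y"
  by (induction zs arbitrary: y) (auto intro: growth_peel)

text \<open>
  The roots of \<open>p\<close> are split by modulus. The factors with \<open>cmod z \<ge> c\<close> see a sum of eigenvectors, and then
  the factors with \<open>cmod z < c\<close> are peeled off.
\<close>

lemma growth_if_annihilated:
  assumes S1: "\<And>z v. v \<noteq> 0 \<Longrightarrow> L v = s z v \<Longrightarrow> cmod z \<le> c"
    and S2: "\<And>z v. cmod z = c \<Longrightarrow> shifted z (shifted z v) = 0 \<Longrightarrow> shifted z v = 0"
    and p: "p \<noteq> 0" "poly_apply p y = 0"
  shows "growth y"
proof -
  obtain xs where xs: "mset xs = filter_mset (\<lambda>z. cmod z < c) (proots p)" using ex_mset by blast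
  obtain ys where ys: "mset ys = filter_mset (\<lambda>z. \<not> cmod z < c) (proots p)" using ex_mset by blast
  have "mset (xs @ ys) = proots p" by (simp add: xs ys multiset_partition[symmetric])
  then have "(\<Prod>x\<in>#proots p. [:-x, 1:]) = prod_list (map (\<lambda>z. [:- z, 1:]) (xs @ ys))"
    by (metis mset_map prod_mset_prod_list)
  then have "p = smult (lead_coeff p) (prod_list (map (\<lambda>z. [:- z, 1:]) (xs @ ys)))"
    using complex_poly_decompose_multiset[of p] by simp
  then have "poly_apply p y = s (lead_coeff p) (shifted_list (xs @ ys) y)"
    using poly_apply_smult poly_apply_prod_list by metis
  then have ker: "shifted_list ys (shifted_list xs y) = 0" using p by (simp add: shifted_list_append)
  have ys_ge: "\<forall>z\<in>set ys. c \<le> cmod z" and xs_lt: "\<forall>z\<in>set xs. cmod z < c"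
    using arg_cong[OF xs, of set_mset] arg_cong[OF ys, of set_mset] by auto
  have "\<exists>Z e. finite Z \<and> (\<forall>z\<in>Z. cmod z = c \<and> L (e z) = s z (e z)) \<and> shifted_list xs y = (\<Sum>z\<in>Z. e z)"
  proof (rule shifted_list_kernel[OF _ _ ys_ge ker])
    show "cmod z \<le> c" if "v \<noteq> 0" "L v = s z v" for z v using that by (rule S1)
    show "shifted z v = 0" if "cmod z = c" "shifted z (shifted z v) = 0" for z v using that by (rule S2)
  qed
  then obtain Z e where Z: "finite Z" "\<forall>z\<in>Z. cmod z = c \<and> L (e z) = s z (e z)"
    "shifted_list xs y = (\<Sum>z\<in>Z. e z)" by blast
  have "growth (shifted_list xs y)" unfolding Z(3) using Z(2) by (intro growth_sum growth_eigen) auto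
  then show ?thesis using growth_shifted_list[OF xs_lt] by blast
qed

lemma norm_scale_ge: "cmod z * norm x \<le> K * norm (s z x)"
proof (cases "z = 0")
  case False
  have "norm x = norm (s (1 / z) (s z x))" using False by simp
  also have "\<dots> \<le> K * (1 / cmod z) * norm (s z x)"
    using norm_scale[of "1/z" "s z x"] by (simp add: norm_divide)
  finally show ?thesis using False by (simp add: field_simps)
qed (use K in simp)

context
  fixes C assumes C: "\<And>n v. norm ((L ^^ n) v) \<le> C * c ^ n * norm v"
begin

lemma bounded_powers_eigenvalue:
  assumes "v \<noteq> 0" "L v = s z v" shows "cmod z \<le> c"
proof (rule ccontr)
  assume "\<not> cmod z \<le> c"
  then have "cmod z / c > 1" using c by simp
  then obtain n where n: "K * C < (cmod z / c) ^ n" using real_arch_pow by blast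
  have "cmod z ^ n * norm v \<le> K * norm (s (z ^ n) v)"
    using norm_scale_ge[of "z ^ n" v] by (simp add: norm_power)
  also have "s (z ^ n) v = (L ^^ n) v" using pow_eigen[OF assms(2)] by simp
  also have "K * norm ((L ^^ n) v) \<le> K * (C * c ^ n * norm v)" by (intro mult_left_mono C K)
  finally have "cmod z ^ n \<le> K * C * c ^ n" using assms(1) by (simp add: mult_ac)
  then show False using n c by (simp add: power_divide field_simps)
qed

text \<open>
  With \<open>u = (L - z) w\<close> and \<open>(L - z) u = 0\<close>, the vector \<open>L\<^sup>n w = z\<^sup>n w + n z\<^sup>n\<^sup>-\<^sup>1 u\<close> grows like \<open>n c\<^sup>n\<close> unless \<open>u = 0\<close>.
\<close>

lemma bounded_powers_no_jordan:
  assumes z: "cmod z = c" and w: "shifted z (shifted z w) = 0" shows "shifted z w = 0"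
proof (rule ccontr)
  assume ne: "shifted z w \<noteq> 0"
  define u where "u = shifted z w"
  have Lw: "L w = s z w + u" and Lu: "L u = s z u" using w by (auto simp: u_def)
  have pow: "(L ^^ Suc m) w = s (z ^ Suc m) w + s (of_nat (Suc m) * z ^ m) u" for m
  proof (induction m)
    case (Suc m)
    have "(L ^^ Suc (Suc m)) w = s (z ^ Suc m) (s z w + u) + s (of_nat (Suc m) * z ^ m) (s z u)"
      unfolding funpow.simps(2)[of "Suc m"] o_apply Suc L_add L_scale Lw Lu ..
    also have "\<dots> = s (z ^ Suc (Suc m)) w + (s (z ^ Suc m) u + s (of_nat (Suc m) * z ^ Suc m) u)"
      by (simp add: scale_right_distrib mult_ac add_ac)
    also have "s (z ^ Suc m) u + s (of_nat (Suc m) * z ^ Suc m) u = s (of_nat (Suc (Suc m)) * z ^ Suc m) u"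
      unfolding scale_left_distrib[symmetric] by (simp add: algebra_simps)
    finally show ?case .
  qed (simp add: Lw)
  have bd: "real (Suc m) * norm u \<le> K * (C + K) * c * norm w" for m
  proof -
    have "real (Suc m) * c ^ m * norm u \<le> K * norm (s (of_nat (Suc m) * z ^ m) u)"
      using norm_scale_ge[of "of_nat (Suc m) * z ^ m" u] z
      by (simp add: norm_mult norm_power del: of_nat_Suc)
    also have "s (of_nat (Suc m) * z ^ m) u = (L ^^ Suc m) w - s (z ^ Suc m) w"
      unfolding pow by (rule add_diff_cancel_left'[symmetric])
    also have "K * norm \<dots> \<le> K * (C * c ^ Suc m * norm w + K * cmod (z ^ Suc m) * norm w)"
      by (intro mult_left_mono K norm_triangle_le_diff add_mono C norm_scale)
    also have "\<dots> = (K * (C + K) * c * norm w) * c ^ m"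
      by (simp add: norm_power norm_mult z algebra_simps)
    finally show ?thesis using c by (simp add: mult_ac)
  qed
  obtain n where "K * (C + K) * c * norm w < real n * norm u"
    using ex_less_of_nat_mult[of "norm u"] ne by (auto simp: u_def)
  also have "\<dots> \<le> real (Suc n) * norm u" by (intro mult_right_mono) auto
  finally show False using bd[of n] by simp
qed

end

end

text \<open>
  There are more than \<open>card B\<close> iterates of \<open>v\<close>; either two of them coincide or they are dependent.
\<close>

lemma annihilating_polynomial:
  fixes L :: "'e::real_normed_vector \<Rightarrow> 'e"
  assumes "finite_basis (B::'e set)"
  shows "\<exists>N a. (\<exists>i\<le>N. a i \<noteq> 0) \<and> (\<Sum>i\<le>N. a i *\<^sub>R (L ^^ i) v) = 0"
proof (cases "inj_on (\<lambda>i. (L ^^ i) v) {..card B}")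
  case True
  let ?f = "\<lambda>i. (L ^^ i) v"
  have "\<not> independent (?f ` {..card B})"
  proof
    assume "independent (?f ` {..card B})"
    then have "card (?f ` {..card B}) \<le> card B"
      using real_vector.independent_span_bound[of B] assms by (auto simp: finite_basis_def)
    then show False using True by (simp add: card_image)
  qed
  then obtain u where u: "\<exists>x\<in>?f ` {..card B}. u x \<noteq> 0" "(\<Sum>x\<in>?f ` {..card B}. u x *\<^sub>R x) = 0"
    using real_vector.dependent_finite[of "?f ` {..card B}"] by auto
  have "(\<Sum>i\<le>card B. u (?f i) *\<^sub>R ?f i) = 0" using u(2) by (simp add: sum.reindex[OF True])
  then show ?thesis using u(1) by (intro exI[of _ "card B"] exI[of _ "\<lambda>i. u (?f i)"]) auto
next
  case False
  then obtain i j where ij: "i \<noteq> j" "i \<le> card B" "j \<le> card B" "(L ^^ i) v = (L ^^ j) v"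
    by (auto simp: inj_on_def)
  define a where "a k = (if k = i then 1 else if k = j then -1 else (0::real))" for k
  have "(\<Sum>k\<le>card B. a k *\<^sub>R (L ^^ k) v) = (\<Sum>k\<in>{i,j}. a k *\<^sub>R (L ^^ k) v)"
    using ij by (intro sum.mono_neutral_right) (auto simp: a_def)
  then show ?thesis using ij by (intro exI[of _ "card B"] exI[of _ a]) (auto simp: a_def)
qed

abbreviation pair_scale :: "complex \<Rightarrow> 'e \<times> 'e \<Rightarrow> 'e \<times> 'e::real_vector" where
  "pair_scale \<equiv> cplx_scale scaleR"

lemma map_prod_funpow:
  fixes f :: "'a \<Rightarrow> 'a" shows "(map_prod f f ^^ n) (u, v) = ((f ^^ n) u, (f ^^ n) v)"
  by (induction n) auto

lemma normed_complex_operator_pair: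
  fixes L :: "'e::real_normed_vector \<Rightarrow> 'e"
  assumes L: "linear L" and c: "c > 0"
  shows "normed_complex_operator pair_scale (map_prod L L) 4 c"
proof -
  interpret vs: vector_space "pair_scale :: complex \<Rightarrow> 'e \<times> 'e \<Rightarrow> _"
    by (rule vector_space_cplx_scale) (rule real_vector.vector_space_axioms)
  show ?thesis
  proof
    show "map_prod L L (x + y) = map_prod L L x + map_prod L L y" for x y
      by (cases x; cases y) (simp add: linear_add[OF L])
    show "map_prod L L (pair_scale z x) = pair_scale z (map_prod L L x)" for z x
      by (cases x) (simp add: cplx_scale_def linear_add[OF L] linear_diff[OF L] linear_cmul[OF L])
    show "norm (pair_scale z x) \<le> 4 * cmod z * norm x" for z and x :: "'e \<times> 'e"
    proof -
      obtain u v where x: "x = (u, v)" by (cases x)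
      have uv: "norm u \<le> norm x" "norm v \<le> norm x"
        unfolding x by (simp_all add: norm_Pair real_le_rsqrt)
      have b: "\<bar>Re z\<bar> * norm w \<le> cmod z * norm x" "\<bar>Im z\<bar> * norm w \<le> cmod z * norm x"
        if "norm w \<le> norm x" for w :: 'e
        using that abs_Re_le_cmod abs_Im_le_cmod by (auto intro!: mult_mono)
      have "norm (pair_scale z x) \<le> norm (Re z *\<^sub>R u - Im z *\<^sub>R v) + norm (Re z *\<^sub>R v + Im z *\<^sub>R u)"
        by (simp add: x cplx_scale_def norm_Pair_le)
      also have "\<dots> \<le> (norm (Re z *\<^sub>R u) + norm (Im z *\<^sub>R v)) + (norm (Re z *\<^sub>R v) + norm (Im z *\<^sub>R u))"
        by (intro add_mono norm_triangle_ineq norm_triangle_ineq4)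
      also have "\<dots> \<le> 4 * (cmod z * norm x)"
        using b[OF uv(1)] b[OF uv(2)] by simp
      finally show ?thesis by simp
    qed
  qed (use c in auto)
qed

text \<open>
  Given the spectral conditions, each basis vector is annihilated by a polynomial in \<open>L\<close>, hence grows at
  most like \<open>c\<^sup>n\<close>, and finitely many such bounds bound \<open>L\<^sup>n\<close>.
\<close>

theorem powers_bounded_iff_spectral:
  fixes L :: "'e::real_normed_vector \<Rightarrow> 'e"
  assumes B: "finite_basis (B::'e set)" and L: "linear L" and c: "c > 0"
  shows "(\<exists>C. \<forall>n v. norm ((L ^^ n) v) \<le> C * c ^ n * norm v) \<longleftrightarrow>
    (\<forall>z v. v \<noteq> 0 \<longrightarrow> map_prod L L v = pair_scale z v \<longrightarrow> cmod z \<le> c) \<and>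
    (\<forall>z v. cmod z = c \<longrightarrow>
       map_prod L L (map_prod L L v - pair_scale z v) - pair_scale z (map_prod L L v - pair_scale z v) = 0 \<longrightarrow>
       map_prod L L v - pair_scale z v = 0)" (is "?bounded \<longleftrightarrow> ?S1 \<and> ?S2")
proof -
  interpret normed_complex_operator pair_scale "map_prod L L" 4 c
    by (rule normed_complex_operator_pair[OF L c])
  show ?thesis
  proof
    assume ?bounded
    then obtain C where C: "\<And>n v. norm ((L ^^ n) v) \<le> C * c ^ n * norm v" by blast
    have C': "norm ((map_prod L L ^^ n) x) \<le> (2 * max C 0) * c ^ n * norm x" for n x
    proof -
      obtain u v where x: "x = (u, v)" by (cases x)
      have uv: "norm u \<le> norm x" "norm v \<le> norm x"
        unfolding x by (simp_all add: norm_Pair real_le_rsqrt)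
      have le: "norm ((L ^^ n) w) \<le> max C 0 * c ^ n * norm x" if "norm w \<le> norm x" for w
        using c that by (intro order_trans[OF C] mult_mono) auto
      have "norm ((map_prod L L ^^ n) x) \<le> norm ((L ^^ n) u) + norm ((L ^^ n) v)"
        by (simp add: x map_prod_funpow norm_Pair_le)
      then show ?thesis using le[OF uv(1)] le[OF uv(2)] by simp
    qed
    show "?S1 \<and> ?S2"
      using bounded_powers_eigenvalue[OF C'] bounded_powers_no_jordan[OF C'] by blast
  next
    assume S: "?S1 \<and> ?S2"
    have "\<exists>M. \<forall>n. norm ((L ^^ n) b) \<le> M * c ^ n" for b
    proof -
      obtain N a i where i: "i \<le> N" "a i \<noteq> 0" and a: "(\<Sum>i\<le>N. a i *\<^sub>R (L ^^ i) b) = 0"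
        using annihilating_polynomial[OF B, of L b] by blast
      have L0: "(L ^^ k) 0 = 0" for k by (induction k) (auto simp: linear_0[OF L])
      define p where "p = (\<Sum>i\<le>N. monom (complex_of_real (a i)) i)"
      have co: "coeff p j = (if j \<le> N then complex_of_real (a j) else 0)" for j
        by (simp add: p_def coeff_sum)
      then have "p \<noteq> 0" using i by (metis coeff_0 of_real_eq_0_iff)
      moreover have "degree p \<le> N" using co by (intro degree_le) auto
      then have "poly_apply p (b, 0) = (\<Sum>i\<le>N. (a i *\<^sub>R (L ^^ i) b, 0))"
        using L0
        by (subst poly_apply_le) (auto intro!: sum.cong simp: co map_prod_funpow cplx_scale_def)
      then have "poly_apply p (b, 0) = 0"
        using a by (simp add: sum_prod[symmetric] zero_prod_def prod_eq_iff fst_sum snd_sum)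
      ultimately have "growth (b, 0)" using growth_if_annihilated[of p "(b, 0)"] S by blast
      then obtain M where M: "\<And>n. norm ((map_prod L L ^^ n) (b, 0)) \<le> M * c ^ n" by (auto simp: growth_def)
      have "norm ((L ^^ n) b) \<le> norm ((map_prod L L ^^ n) (b, 0))" for n
        by (simp add: map_prod_funpow norm_Pair real_le_rsqrt)
      then show ?thesis using M order_trans by blast
    qed
    then obtain M where M: "\<And>b n. norm ((L ^^ n) b) \<le> M b * c ^ n" by metis
    obtain C where C: "C \<ge> 0" "\<And>(f::'e\<Rightarrow>'e) m v. linear f \<Longrightarrow> (\<And>b. b \<in> B \<Longrightarrow> norm (f b) \<le> m) \<Longrightarrow>
        norm (f v) \<le> C * m * norm v" by (rule finite_basis_norm_bound[OF B]) blast
    have "norm ((L ^^ n) v) \<le> (C * (\<Sum>b\<in>B. \<bar>M b\<bar>)) * c ^ n * norm v" for n v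
    proof -
      have lin: "linear (L ^^ n)"
        by (induction n) (auto intro: linear_compose[OF _ L, unfolded o_def] simp: bounded_linear.linear[OF bounded_linear_ident] o_def id_def)
      have "norm ((L ^^ n) b) \<le> (\<Sum>b\<in>B. \<bar>M b\<bar>) * c ^ n" if "b \<in> B" for b
      proof -
        have "M b \<le> \<bar>M b\<bar>" by simp
        also have "\<dots> \<le> (\<Sum>b\<in>B. \<bar>M b\<bar>)" using that finite_basis_finite[OF B] by (intro member_le_sum) auto
        finally show ?thesis using c by (intro order_trans[OF M] mult_right_mono) auto
      qed
      then show ?thesis using C(2)[OF lin, of "(\<Sum>b\<in>B. \<bar>M b\<bar>) * c ^ n" v] by (simp add: mult_ac)
    qed
    then show ?bounded by blast
  qed
qed

section \<open>Groups with a chart at the identity\<close>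

text \<open>
  What is needed of a Lie group near the identity: coordinates \<open>\<psi>\<close> vanishing at \<open>\<one>\<close> in which the product is
  the sum up to half the norm of the second factor.
\<close>

locale chart_group = group G + topological_chart T U \<psi>
  for G :: "('a, 'm) monoid_scheme" (structure) and T U and \<psi> :: "'a \<Rightarrow> 'e::real_normed_vector" +
  fixes r :: real
  assumes topspace_T: "topspace T = carrier G"
    and left_mult_continuous: "\<And>g. g \<in> carrier G \<Longrightarrow> continuous_map T T (\<lambda>x. g \<otimes> x)"
    and inv_continuous: "continuous_map T T (\<lambda>x. inv x)"
    and one_U: "\<one> \<in> U" and \<psi>_one: "\<psi> \<one> = 0"
    and r_pos: "r > 0" and ball_image: "cball 0 r \<subseteq> \<psi> ` U"
    and mult_U: "\<And>x y. x \<in> U \<Longrightarrow> y \<in> U \<Longrightarrow> norm (\<psi> x) \<le> r \<Longrightarrow> norm (\<psi> y) \<le> r \<Longrightarrow> x \<otimes> y \<in> U"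
    and mult_approx: "\<And>x y. x \<in> U \<Longrightarrow> y \<in> U \<Longrightarrow> norm (\<psi> x) \<le> r \<Longrightarrow> norm (\<psi> y) \<le> r \<Longrightarrow>
      norm (\<psi> (x \<otimes> y) - \<psi> x - \<psi> y) \<le> norm (\<psi> y) / 2"
begin

lemma U_carrier: "x \<in> U \<Longrightarrow> x \<in> carrier G"
  using openin_subset[OF open_U] topspace_T by auto

definition small :: "real \<Rightarrow> 'a set" where "small \<rho> = {x \<in> U. norm (\<psi> x) < \<rho>}"

lemma small_open: "openin T (small \<rho>)"
proof -
  have "small \<rho> = {x \<in> U. \<psi> x \<in> ball 0 \<rho>}" by (auto simp: small_def)
  then show ?thesis using chart_preimage_open[OF open_ball] by metis
qed

lemma one_small: "\<rho> > 0 \<Longrightarrow> \<one> \<in> small \<rho>"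
  by (simp add: small_def one_U \<psi>_one)

lemma small_carrier: "x \<in> small \<rho> \<Longrightarrow> x \<in> carrier G"
  by (auto simp: small_def U_carrier)

lemma nbhd_contains_small:
  assumes W: "openin T W" "\<one> \<in> W"
  shows "\<exists>\<rho>>0. \<rho> \<le> r \<and> small \<rho> \<subseteq> W"
proof -
  have "open (\<psi> ` (U \<inter> W))" by (rule chart_image_open[OF W(1)])
  moreover have "0 \<in> \<psi> ` (U \<inter> W)" using one_U W(2) \<psi>_one by (metis IntI image_eqI)
  ultimately obtain \<epsilon> where \<epsilon>: "\<epsilon> > 0" "ball 0 \<epsilon> \<subseteq> \<psi> ` (U \<inter> W)" using open_contains_ball by blast
  have "small (min \<epsilon> r) \<subseteq> W"
  proof
    fix x assume "x \<in> small (min \<epsilon> r)"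
    then have x: "x \<in> U" "\<psi> x \<in> \<psi> ` (U \<inter> W)" using \<epsilon> by (auto simp: small_def)
    then obtain y where "y \<in> U" "y \<in> W" "\<psi> x = \<psi> y" by auto
    then show "x \<in> W" using x(1) \<psi>_inj by (metis inj_onD)
  qed
  then show ?thesis using \<epsilon>(1) r_pos by (intro exI[of _ "min \<epsilon> r"]) auto
qed

lemma chart_point:
  assumes "norm v \<le> r" obtains x where "x \<in> U" "\<psi> x = v"
proof -
  have "v \<in> \<psi> ` U" using assms ball_image by auto
  then show ?thesis using that by blast
qed

lemma norm_mult_le:
  assumes "x \<in> U" "y \<in> U" "norm (\<psi> x) \<le> r" "norm (\<psi> y) \<le> r"
  shows "norm (\<psi> (x \<otimes> y)) \<le> norm (\<psi> x) + 3/2 * norm (\<psi> y)"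
proof -
  have "\<psi> (x \<otimes> y) = (\<psi> (x \<otimes> y) - \<psi> x - \<psi> y) + (\<psi> x + \<psi> y)" by simp
  then have "norm (\<psi> (x \<otimes> y)) \<le> norm (\<psi> (x \<otimes> y) - \<psi> x - \<psi> y) + norm (\<psi> x + \<psi> y)"
    using norm_triangle_ineq by metis
  then show ?thesis using mult_approx[OF assms] norm_triangle_ineq[of "\<psi> x" "\<psi> y"] by linarith
qed

text \<open>
  Each multiplication by \<open>x\<close> adds \<open>\<psi> x\<close> up to an error of at most half its norm.
\<close>

lemma power_approx:
  assumes x: "x \<in> U" "norm (\<psi> x) \<le> r"
    and pow: "\<And>j. j < m \<Longrightarrow> x [^] j \<in> U \<and> norm (\<psi> (x [^] j)) \<le> r"
  shows "norm (\<psi> (x [^] m) - real m *\<^sub>R \<psi> x) \<le> real m / 2 * norm (\<psi> x)"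
  using pow
proof (induction m)
  case 0 then show ?case by (simp add: \<psi>_one)
next
  case (Suc m)
  have IH: "norm (\<psi> (x [^] m) - real m *\<^sub>R \<psi> x) \<le> real m / 2 * norm (\<psi> x)"
    using Suc by auto
  have "norm (\<psi> (x [^] m \<otimes> x) - \<psi> (x [^] m) - \<psi> x) \<le> norm (\<psi> x) / 2"
    using Suc.prems[of m] x by (intro mult_approx) auto
  moreover have "\<psi> (x [^] Suc m) - real (Suc m) *\<^sub>R \<psi> x =
      (\<psi> (x [^] m \<otimes> x) - \<psi> (x [^] m) - \<psi> x) + (\<psi> (x [^] m) - real m *\<^sub>R \<psi> x)"
    by (simp add: algebra_simps)
  ultimately have "norm (\<psi> (x [^] Suc m) - real (Suc m) *\<^sub>R \<psi> x) \<le> norm (\<psi> x) / 2 + real m / 2 * norm (\<psi> x)"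
    using IH norm_triangle_mono by metis
  then show ?case by (simp add: field_simps)
qed

text \<open>
  The estimate \<open>power_approx\<close> presupposes that the lower powers stay in the ball, so both are proved
  together by induction.
\<close>

lemma power_in_chart:
  assumes x: "x \<in> U" "norm (\<psi> x) \<le> r" and m: "real m * (3/2) * norm (\<psi> x) \<le> r" and j: "j \<le> m"
  shows "x [^] j \<in> U \<and> norm (\<psi> (x [^] j)) \<le> real j * (3/2) * norm (\<psi> x)"
  using j
proof (induction j rule: less_induct)
  case (less j)
  have le: "real i * (3/2) * norm (\<psi> x) \<le> r" if "i \<le> m" for i
    using that by (intro order_trans[OF _ m] mult_right_mono) auto
  have in_ball: "x [^] i \<in> U \<and> norm (\<psi> (x [^] i)) \<le> r" if "i < j" for i
    using less.IH[OF that] le[of i] less.prems that by auto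
  have "x [^] j \<in> U"
  proof (cases j)
    case 0 then show ?thesis by (simp add: one_U)
  next
    case (Suc i) then show ?thesis using in_ball[of i] x mult_U[of "x [^] i" x] by simp
  qed
  moreover have "norm (\<psi> (x [^] j)) \<le> norm (\<psi> (x [^] j) - real j *\<^sub>R \<psi> x) + norm (real j *\<^sub>R \<psi> x)"
    by (metis diff_add_cancel norm_triangle_ineq)
  then have "norm (\<psi> (x [^] j)) \<le> real j / 2 * norm (\<psi> x) + real j * norm (\<psi> x)"
    using power_approx[OF x in_ball] by fastforce
  ultimately show ?case by (simp add: algebra_simps)
qed

text \<open>
  By left invariance it suffices to compare neighbourhoods of the identity.
\<close>

lemma mtopology_eqI:
  assumes "Metric_space (carrier G) d"
    and left: "\<And>g x y. g \<in> carrier G \<Longrightarrow> x \<in> carrier G \<Longrightarrow> y \<in> carrier G \<Longrightarrow> d (g \<otimes> x) (g \<otimes> y) = d x y"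
    and fine: "\<And>W. openin T W \<Longrightarrow> \<one> \<in> W \<Longrightarrow> \<exists>\<epsilon>>0. \<forall>x\<in>carrier G. d \<one> x < \<epsilon> \<longrightarrow> x \<in> W"
    and coarse: "\<And>\<epsilon>. \<epsilon> > 0 \<Longrightarrow> \<exists>W. openin T W \<and> \<one> \<in> W \<and> (\<forall>x\<in>W. d \<one> x < \<epsilon>)"
  shows "Metric_space.mtopology (carrier G) d = T"
proof -
  interpret M: Metric_space "carrier G" d by fact
  have dist: "d x y = d \<one> (inv x \<otimes> y)" if "x \<in> carrier G" "y \<in> carrier G" for x y
    using left[of "inv x" x y] that by simp
  have pre: "openin T {y \<in> carrier G. g \<otimes> y \<in> W}" if "g \<in> carrier G" "openin T W" for g W
    using openin_continuous_map_preimage[OF left_mult_continuous[OF that(1)] that(2)] by (simp add: topspace_T)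
  show ?thesis
  proof (rule topology_eq[THEN iffD2], intro allI iffI)
    fix S assume S: "openin M.mtopology S"
    show "openin T S"
    proof (subst openin_subopen, intro ballI)
      fix x assume x: "x \<in> S"
      then have xc: "x \<in> carrier G" using S by (auto simp: M.openin_mtopology)
      obtain \<epsilon> where \<epsilon>: "\<epsilon> > 0" "M.mball x \<epsilon> \<subseteq> S" using S x by (auto simp: M.openin_mtopology)
      obtain W where W: "openin T W" "\<one> \<in> W" "\<forall>x\<in>W. d \<one> x < \<epsilon>" using coarse[OF \<epsilon>(1)] by blast
      show "\<exists>W'. openin T W' \<and> x \<in> W' \<and> W' \<subseteq> S"
      proof (intro exI conjI)
        show "openin T {y \<in> carrier G. inv x \<otimes> y \<in> W}" using xc W by (intro pre) auto
        show "x \<in> {y \<in> carrier G. inv x \<otimes> y \<in> W}" using xc W by simp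
        have "y \<in> M.mball x \<epsilon>" if "y \<in> carrier G" "inv x \<otimes> y \<in> W" for y
          using W(3) dist[OF xc that(1)] xc that by simp
        then show "{y \<in> carrier G. inv x \<otimes> y \<in> W} \<subseteq> S" using \<epsilon>(2) by blast
      qed
    qed
  next
    fix S assume S: "openin T S"
    show "openin M.mtopology S"
      unfolding M.openin_mtopology
    proof (intro conjI allI impI)
      show sub: "S \<subseteq> carrier G" using openin_subset[OF S] topspace_T by simp
      fix x assume x: "x \<in> S"
      then have xc: "x \<in> carrier G" using sub by auto
      obtain \<epsilon> where \<epsilon>: "\<epsilon> > 0" "\<forall>y\<in>carrier G. d \<one> y < \<epsilon> \<longrightarrow> y \<in> {y \<in> carrier G. x \<otimes> y \<in> S}"
        using fine[OF pre[OF xc S]] x xc by auto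
      have "y \<in> S" if "y \<in> M.mball x \<epsilon>" for y
      proof -
        have y: "y \<in> carrier G" "d \<one> (inv x \<otimes> y) < \<epsilon>" using that dist[OF xc, of y] by simp_all
        then have "x \<otimes> (inv x \<otimes> y) \<in> S" using \<epsilon>(2) xc by simp
        then show ?thesis using xc y(1) by (simp add: m_assoc[symmetric])
      qed
      then show "\<exists>\<epsilon>>0. M.mball x \<epsilon> \<subseteq> S" using \<epsilon>(1) by blast
    qed
  qed
qed

end

text \<open>
  The automorphism \<open>\<delta>\<close> with inverse \<open>\<gamma>\<close> has linear part \<open>L\<close> in the chart, with a quadratic error.
\<close>

locale chart_group_automorphism = chart_group G T U \<psi> r
  for G :: "('a, 'm) monoid_scheme" (structure) and T U and \<psi> :: "'a \<Rightarrow> 'e::real_normed_vector" and r +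
  fixes \<delta> \<gamma> :: "'a \<Rightarrow> 'a" and L :: "'e \<Rightarrow> 'e" and M :: real
  assumes \<delta>_hom: "\<delta> \<in> hom G G" and \<gamma>_hom: "\<gamma> \<in> hom G G"
    and \<gamma>_\<delta>: "\<And>x. x \<in> carrier G \<Longrightarrow> \<gamma> (\<delta> x) = x" and \<delta>_\<gamma>: "\<And>x. x \<in> carrier G \<Longrightarrow> \<delta> (\<gamma> x) = x"
    and \<delta>_continuous: "continuous_map T T \<delta>" and \<gamma>_continuous: "continuous_map T T \<gamma>"
    and L_bounded: "bounded_linear L" and M_nonneg: "M \<ge> 0"
    and \<delta>_U: "\<And>x. x \<in> U \<Longrightarrow> norm (\<psi> x) \<le> r \<Longrightarrow> \<delta> x \<in> U"
    and \<delta>_approx: "\<And>x. x \<in> U \<Longrightarrow> norm (\<psi> x) \<le> r \<Longrightarrow> norm (\<psi> (\<delta> x) - L (\<psi> x)) \<le> M * (norm (\<psi> x))\<^sup>2"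
begin

lemma \<delta>_carrier: "x \<in> carrier G \<Longrightarrow> \<delta> x \<in> carrier G" using \<delta>_hom by (auto simp: hom_def)
lemma \<gamma>_carrier: "x \<in> carrier G \<Longrightarrow> \<gamma> x \<in> carrier G" using \<gamma>_hom by (auto simp: hom_def)

lemma \<delta>_pow_carrier: "x \<in> carrier G \<Longrightarrow> (\<delta> ^^ n) x \<in> carrier G" by (induction n) (auto simp: \<delta>_carrier)
lemma \<gamma>_pow_carrier: "x \<in> carrier G \<Longrightarrow> (\<gamma> ^^ n) x \<in> carrier G" by (induction n) (auto simp: \<gamma>_carrier)

lemma \<delta>_mult: "x \<in> carrier G \<Longrightarrow> y \<in> carrier G \<Longrightarrow> \<delta> (x \<otimes> y) = \<delta> x \<otimes> \<delta> y"
  using \<delta>_hom by (auto simp: hom_def)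
lemma \<gamma>_mult: "x \<in> carrier G \<Longrightarrow> y \<in> carrier G \<Longrightarrow> \<gamma> (x \<otimes> y) = \<gamma> x \<otimes> \<gamma> y"
  using \<gamma>_hom by (auto simp: hom_def)

lemma \<delta>_pow_mult: "x \<in> carrier G \<Longrightarrow> y \<in> carrier G \<Longrightarrow> (\<delta> ^^ n) (x \<otimes> y) = (\<delta> ^^ n) x \<otimes> (\<delta> ^^ n) y"
  by (induction n) (auto simp: \<delta>_mult \<delta>_pow_carrier)
lemma \<gamma>_pow_mult: "x \<in> carrier G \<Longrightarrow> y \<in> carrier G \<Longrightarrow> (\<gamma> ^^ n) (x \<otimes> y) = (\<gamma> ^^ n) x \<otimes> (\<gamma> ^^ n) y"
  by (induction n) (auto simp: \<gamma>_mult \<gamma>_pow_carrier)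

lemma \<gamma>_\<delta>_pow: "x \<in> carrier G \<Longrightarrow> (\<gamma> ^^ n) ((\<delta> ^^ n) x) = x"
proof (induction n arbitrary: x)
  case (Suc n)
  have "(\<gamma> ^^ Suc n) ((\<delta> ^^ Suc n) x) = (\<gamma> ^^ n) (\<gamma> (\<delta> ((\<delta> ^^ n) x)))" by (simp add: funpow_swap1)
  then show ?case using Suc by (simp add: \<gamma>_\<delta> \<delta>_pow_carrier)
qed simp

lemma \<delta>_one: "\<delta> \<one> = \<one>" using hom_one[OF \<delta>_hom] is_group by auto

lemma \<delta>_pow_one: "(\<delta> ^^ n) \<one> = \<one>" by (induction n) (auto simp: \<delta>_one)

lemma \<gamma>_one: "\<gamma> \<one> = \<one>" using hom_one[OF \<gamma>_hom] is_group by auto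

lemma \<gamma>_pow_one: "(\<gamma> ^^ n) \<one> = \<one>" by (induction n) (auto simp: \<gamma>_one)

lemma \<delta>_pow_inv:
  assumes "x \<in> carrier G" shows "(\<delta> ^^ n) (inv x) = inv ((\<delta> ^^ n) x)"
proof (rule inv_equality[symmetric])
  show "(\<delta> ^^ n) (inv x) \<otimes> (\<delta> ^^ n) x = \<one>"
    using \<delta>_pow_mult[of "inv x" x n] assms by (simp add: \<delta>_pow_one)
qed (use assms \<delta>_pow_carrier in auto)

lemma \<delta>_pow_nat_pow: "x \<in> carrier G \<Longrightarrow> (\<delta> ^^ n) (x [^] (j::nat)) = ((\<delta> ^^ n) x) [^] j"
  by (induction j) (auto simp: \<delta>_pow_one \<delta>_pow_mult)

lemma \<delta>_pow_continuous: "continuous_map T T (\<delta> ^^ n)"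
  by (induction n) (auto intro: continuous_map_compose[OF _ \<delta>_continuous, unfolded o_def] simp: o_def id_def)

lemma \<gamma>_pow_continuous: "continuous_map T T (\<gamma> ^^ n)"
  by (induction n) (auto intro: continuous_map_compose[OF _ \<gamma>_continuous, unfolded o_def] simp: o_def id_def)

lemma L_pow_bounded: "bounded_linear (L ^^ n)"
  by (induction n) (auto intro: bounded_linear_compose[OF L_bounded] simp: o_def id_def bounded_linear_ident)

end

section \<open>Consequences of the existence of a dilated distance\<close>

locale contracted_metric = chart_group_automorphism G T U \<psi> r \<delta> \<gamma> L M
  for G :: "('a, 'm) monoid_scheme" (structure) and T U and \<psi> :: "'a \<Rightarrow> 'e::real_normed_vector"
    and r \<delta> \<gamma> L M +
  fixes d :: "'a \<Rightarrow> 'a \<Rightarrow> real" and c :: real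
  assumes metric: "Metric_space (carrier G) d"
    and left_invariant: "\<And>g x y. g \<in> carrier G \<Longrightarrow> x \<in> carrier G \<Longrightarrow> y \<in> carrier G \<Longrightarrow> d (g \<otimes> x) (g \<otimes> y) = d x y"
    and mtopology_eq: "Metric_space.mtopology (carrier G) d = T"
    and c: "0 < c" "c < 1"
    and dilation: "\<And>x y. x \<in> carrier G \<Longrightarrow> y \<in> carrier G \<Longrightarrow> d (\<delta> x) (\<delta> y) = c * d x y"
begin

sublocale Metric_space "carrier G" d by (rule metric)

lemma dist_pow:
  "x \<in> carrier G \<Longrightarrow> y \<in> carrier G \<Longrightarrow> d ((\<delta> ^^ n) x) ((\<delta> ^^ n) y) = c ^ n * d x y"
  by (induction n) (auto simp: dilation \<delta>_pow_carrier)

lemma dist_one_pow: "x \<in> carrier G \<Longrightarrow> d \<one> ((\<delta> ^^ n) x) = c ^ n * d \<one> x"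
  using dist_pow[of \<one> x n] by (simp add: \<delta>_pow_one)

lemma dist_one_mult:
  assumes "x \<in> carrier G" "y \<in> carrier G" shows "d \<one> (x \<otimes> y) \<le> d \<one> x + d \<one> y"
  using triangle[of \<one> x "x \<otimes> y"] left_invariant[of x \<one> y] assms by simp

lemma dist_one_nat_pow: "x \<in> carrier G \<Longrightarrow> d \<one> (x [^] (j::nat)) \<le> real j * d \<one> x"
proof (induction j)
  case (Suc j)
  then show ?case using dist_one_mult[of "x [^] j" x] by (simp add: algebra_simps)
qed simp

lemma dist_ball_in_nbhd:
  assumes "openin T W" "\<one> \<in> W"
  shows "\<exists>\<epsilon>>0. \<forall>x\<in>carrier G. d \<one> x < \<epsilon> \<longrightarrow> x \<in> W"
proof -
  have "openin mtopology W" using assms(1) by (simp add: mtopology_eq)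
  then obtain \<epsilon> where "\<epsilon> > 0" "mball \<one> \<epsilon> \<subseteq> W" using assms(2) unfolding openin_mtopology by blast
  then show ?thesis by (intro exI[of _ \<epsilon>]) auto
qed

lemma small_in_dist_ball:
  assumes "\<epsilon> > 0" shows "\<exists>\<rho>>0. \<rho> \<le> r \<and> (\<forall>x\<in>small \<rho>. d \<one> x < \<epsilon>)"
proof -
  have "openin T (mball \<one> \<epsilon>)" using openin_mball mtopology_eq by metis
  then obtain \<rho> where "\<rho> > 0" "\<rho> \<le> r" "small \<rho> \<subseteq> mball \<one> \<epsilon>" using nbhd_contains_small assms by fastforce
  then show ?thesis by (intro exI[of _ \<rho>]) auto
qed

text \<open>
  Choose \<open>m\<close> with \<open>m * norm (\<psi> x)\<close> comparable to \<open>r\<close>. Then \<open>x\<^sup>m\<close> has left \<open>small (r/6)\<close>, so its distance to the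
  identity is at least \<open>\<epsilon>\<close>, and \<open>\<epsilon> \<le> d \<one> (x\<^sup>m) \<le> m * d \<one> x\<close>.
\<close>

lemma dist_lower_bound:
  obtains \<epsilon> \<kappa> where "\<epsilon> > 0" "\<kappa> > 0"
    "\<And>x. x \<in> carrier G \<Longrightarrow> d \<one> x < \<epsilon> \<Longrightarrow> x \<in> small (r/6) \<and> \<kappa> * norm (\<psi> x) \<le> d \<one> x"
proof -
  obtain \<epsilon> where \<epsilon>: "\<epsilon> > 0" "\<And>x. x \<in> carrier G \<Longrightarrow> d \<one> x < \<epsilon> \<Longrightarrow> x \<in> small (r/6)"
    using dist_ball_in_nbhd[OF small_open one_small, of "r/6"] r_pos by auto
  define \<kappa> where "\<kappa> = 3 * \<epsilon> / (2 * r)"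
  have "\<kappa> * norm (\<psi> x) \<le> d \<one> x" if x: "x \<in> carrier G" "d \<one> x < \<epsilon>" for x
  proof (cases "\<psi> x = 0")
    case False
    have xs: "x \<in> U" "norm (\<psi> x) < r/6" using \<epsilon>(2)[OF x] by (auto simp: small_def)
    define a where "a = norm (\<psi> x)"
    have a: "a > 0" using False by (simp add: a_def)
    (* The largest m for which power_in_chart keeps the powers of x in the chart ball. *)
    define m where "m = nat \<lfloor>r / (3/2 * a)\<rfloor>"
    have "real m \<le> r / (3/2 * a)" "r / (3/2 * a) < real m + 1"
      unfolding m_def using r_pos a by (auto simp: of_nat_nat)
    moreover have "3/2 * a > 0" using a by simp
    ultimately have "real m * (3/2 * a) \<le> r" and m2: "r < (real m + 1) * (3/2 * a)"
      using pos_le_divide_eq pos_divide_less_eq by blast+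
    then have m1: "real m * (3/2) * a \<le> r" by (simp only: mult.assoc)
    have am: "r / 2 < real m * a" using m2 xs(2) by (simp add: a_def[symmetric] algebra_simps)
    have pw: "x [^] j \<in> U \<and> norm (\<psi> (x [^] j)) \<le> r" if "j \<le> m" for j
    proof -
      have "real j * (3/2) * a \<le> real m * (3/2) * a" using that a by (intro mult_right_mono) auto
      then show ?thesis using power_in_chart[OF xs(1) _ m1[unfolded a_def] that] xs(2) r_pos m1
        by (auto simp: a_def)
    qed
    have "norm (\<psi> (x [^] m) - real m *\<^sub>R \<psi> x) \<le> real m / 2 * norm (\<psi> x)"
      by (rule power_approx) (use xs r_pos pw in auto)
    moreover have "norm (real m *\<^sub>R \<psi> x) \<le> norm (\<psi> (x [^] m)) + norm (\<psi> (x [^] m) - real m *\<^sub>R \<psi> x)"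
      by (metis norm_minus_commute norm_triangle_sub)
    ultimately have "real m * a \<le> norm (\<psi> (x [^] m)) + real m * a / 2" by (simp add: a_def)
    then have "r / 6 < norm (\<psi> (x [^] m))" using am r_pos by linarith
    then have "\<not> d \<one> (x [^] m) < \<epsilon>" using \<epsilon>(2)[of "x [^] m"] x(1) by (auto simp: small_def)
    then have "\<epsilon> \<le> real m * d \<one> x" using dist_one_nat_pow[OF x(1), of m] by linarith
    then have "(3 * a) * \<epsilon> \<le> (3 * a) * (real m * d \<one> x)" using a by (intro mult_left_mono) auto
    also have "\<dots> = 2 * (real m * (3/2) * a) * d \<one> x" by simp
    also have "\<dots> \<le> 2 * r * d \<one> x"
    proof (rule mult_right_mono[OF _ nonneg])
      show "2 * (real m * (3/2) * a) \<le> 2 * r" using m1 by linarith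
    qed
    finally show ?thesis using r_pos by (simp add: \<kappa>_def a_def[symmetric] field_simps)
  qed simp
  moreover have "\<kappa> > 0" using \<epsilon>(1) r_pos by (simp add: \<kappa>_def)
  ultimately show ?thesis using \<epsilon> that by blast
qed

text \<open>
  The distance of \<open>x\<close> to the identity is not bounded by a multiple of \<open>norm (\<psi> x)\<close>, so the lower bound for
  \<open>d\<close> does not give linearity in \<open>norm (\<psi> x)\<close> directly. It is applied to \<open>\<delta>\<^sup>n (x\<^sup>m) = (\<delta>\<^sup>n x)\<^sup>m\<close> instead, where \<open>m\<close> is
  so large that \<open>x\<^sup>m\<close> has coordinates of a fixed order of magnitude: this gives
  \<open>m * norm (\<psi> (\<delta>\<^sup>n x)) \<le> const * c\<^sup>n\<close>, and \<open>1 / m\<close> is comparable to \<open>norm (\<psi> x)\<close>.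
\<close>

lemma chart_contraction:
  obtains s C where "s > 0" "s \<le> r" "C \<ge> 0"
    "\<And>x n. x \<in> small s \<Longrightarrow> (\<delta> ^^ n) x \<in> small r \<and> norm (\<psi> ((\<delta> ^^ n) x)) \<le> C * c ^ n * norm (\<psi> x)"
proof -
  obtain \<epsilon> \<kappa> where \<epsilon>: "\<epsilon> > 0" "\<kappa> > 0"
    "\<And>x. x \<in> carrier G \<Longrightarrow> d \<one> x < \<epsilon> \<Longrightarrow> x \<in> small (r/6) \<and> \<kappa> * norm (\<psi> x) \<le> d \<one> x"
    using dist_lower_bound by blast
  obtain s where s: "s > 0" "s \<le> r" "\<And>x. x \<in> small s \<Longrightarrow> d \<one> x < \<epsilon>"
    using small_in_dist_ball[OF \<epsilon>(1)] by blast
  define C where "C = 12 * \<epsilon> / (\<kappa> * s)"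
  have near: "(\<delta> ^^ n) x \<in> small (r/6)" "\<kappa> * norm (\<psi> ((\<delta> ^^ n) x)) \<le> c ^ n * \<epsilon>" if x: "x \<in> small s" for x n
  proof -
    have "c ^ n * d \<one> x \<le> 1 * d \<one> x" using c by (intro mult_right_mono) (auto simp: power_le_one)
    then have lt: "d \<one> ((\<delta> ^^ n) x) < \<epsilon>" using s(3)[OF x] by (simp add: dist_one_pow small_carrier[OF x])
    have le: "d \<one> ((\<delta> ^^ n) x) \<le> c ^ n * \<epsilon>"
      unfolding dist_one_pow[OF small_carrier[OF x]] using s(3)[OF x] c by (intro mult_left_mono) auto
    show "(\<delta> ^^ n) x \<in> small (r/6)" "\<kappa> * norm (\<psi> ((\<delta> ^^ n) x)) \<le> c ^ n * \<epsilon>"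
      using \<epsilon>(3)[OF \<delta>_pow_carrier[OF small_carrier[OF x]] lt] le by auto
  qed
  have bound: "norm (\<psi> ((\<delta> ^^ n) x)) \<le> C * c ^ n * norm (\<psi> x)" if x: "x \<in> small (s/3)" for x n
  proof (cases "\<psi> x = 0")
    case True
    then have "x = \<one>" using x \<psi>_inj one_U \<psi>_one by (auto simp: small_def inj_on_def)
    then show ?thesis by (simp add: \<delta>_pow_one \<psi>_one)
  next
    case False
    define y where "y = (\<delta> ^^ n) x"
    define a where "a = norm (\<psi> x)"
    have a: "a > 0" "a < s / 3" "x \<in> U" using False x by (auto simp: a_def small_def)
    have xs: "x \<in> small s" using x s(1) by (auto simp: small_def)
    (* The largest m for which power_in_chart keeps the powers of x within half of the radius s. *)
    define m where "m = nat \<lfloor>s / (3 * a)\<rfloor>"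
    have "1 \<le> s / (3 * a)" using a by (simp add: field_simps)
    then have "real m \<le> s / (3 * a)" "s / (3 * a) < real m + 1" "real m \<ge> 1"
      unfolding m_def by (auto simp: of_nat_nat le_floor_iff)
    then have "real m * (3 * a) \<le> s" and m2': "s < (real m + 1) * (3 * a)" and m3: "real m \<ge> 1"
      using a by (simp_all add: pos_le_divide_eq pos_divide_less_eq)
    then have m1: "real m * (3/2) * a \<le> s / 2" by (simp add: mult_ac)
    have "s \<le> (real m + 1) * (3 * a)" using m2' by (rule less_imp_le)
    also have "\<dots> \<le> (2 * real m) * (3 * a)" using a m3 by (intro mult_right_mono) auto
    also have "\<dots> = 6 * a * real m" by simp
    finally have m2: "s \<le> 6 * a * real m" .
    have pw: "x [^] j \<in> small s" if "j \<le> m" for j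
    proof -
      have "real j * (3/2) * a \<le> real m * (3/2) * a" using that a by (intro mult_right_mono) auto
      moreover have "x [^] j \<in> U \<and> norm (\<psi> (x [^] j)) \<le> real j * (3/2) * norm (\<psi> x)"
        by (rule power_in_chart[of _ m]) (use a s m1 that in \<open>auto simp: a_def\<close>)
      ultimately show ?thesis using m1 s(1) by (auto simp: small_def a_def)
    qed
    have xc: "x \<in> carrier G" using xs by (rule small_carrier)
    have ypw: "y [^] j \<in> small (r/6)" "\<kappa> * norm (\<psi> (y [^] j)) \<le> c ^ n * \<epsilon>" if "j \<le> m" for j
      using near[OF pw[OF that], of n] by (auto simp: y_def \<delta>_pow_nat_pow[OF xc])
    have ys: "y \<in> small (r/6)" using near[OF xs] by (simp add: y_def)
    have "norm (\<psi> (y [^] m) - real m *\<^sub>R \<psi> y) \<le> real m / 2 * norm (\<psi> y)"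
    proof (rule power_approx[rotated 2])
      show "y [^] j \<in> U \<and> norm (\<psi> (y [^] j)) \<le> r" if "j < m" for j
        using ypw(1)[of j] that r_pos by (simp add: small_def)
    qed (use r_pos ys in \<open>auto simp: small_def\<close>)
    moreover have "norm (real m *\<^sub>R \<psi> y) \<le> norm (\<psi> (y [^] m)) + norm (\<psi> (y [^] m) - real m *\<^sub>R \<psi> y)"
      by (metis norm_minus_commute norm_triangle_sub)
    ultimately have "real m * norm (\<psi> y) \<le> 2 * norm (\<psi> (y [^] m))" by simp
    then have "\<kappa> * (real m * norm (\<psi> y)) \<le> \<kappa> * (2 * norm (\<psi> (y [^] m)))"
      using \<epsilon>(2) by (intro mult_left_mono) auto
    then have k: "\<kappa> * (real m * norm (\<psi> y)) \<le> 2 * c ^ n * \<epsilon>" using ypw(2)[of m] by simp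
    have "s * (\<kappa> * norm (\<psi> y)) \<le> (6 * a * real m) * (\<kappa> * norm (\<psi> y))"
      using m2 \<epsilon>(2) by (intro mult_right_mono) auto
    also have "\<dots> = 6 * a * (\<kappa> * (real m * norm (\<psi> y)))" by simp
    also have "\<dots> \<le> 6 * a * (2 * c ^ n * \<epsilon>)" using k a by (intro mult_left_mono) auto
    finally show ?thesis using s(1) \<epsilon>(2) by (simp add: C_def y_def[symmetric] a_def[symmetric] field_simps)
  qed
  show ?thesis
  proof (rule that[of "s/3" C])
    show "C \<ge> 0" using \<epsilon> s by (simp add: C_def)
    fix x n assume x: "x \<in> small (s/3)"
    then have "x \<in> small s" using s(1) by (auto simp: small_def)
    then have "(\<delta> ^^ n) x \<in> small r" using near(1)[of x n] r_pos by (auto simp: small_def)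
    then show "(\<delta> ^^ n) x \<in> small r \<and> norm (\<psi> ((\<delta> ^^ n) x)) \<le> C * c ^ n * norm (\<psi> x)"
      using bound[OF x] by blast
  qed (use s in auto)
qed

text \<open>
  For fixed \<open>n\<close> the coordinates of \<open>\<delta>\<^sup>n x\<close> and \<open>L\<^sup>n (\<psi> x)\<close> differ by a quadratic term, so \<open>chart_contraction\<close>,
  applied to points with coordinates \<open>t *\<^sub>R v\<close> and divided by \<open>t\<close>, gives the bound as \<open>t\<close> tends to \<open>0\<close>.
\<close>

theorem linear_part_powers_bounded: "\<exists>C. \<forall>n v. norm ((L ^^ n) v) \<le> C * c ^ n * norm v"
proof -
  obtain s C where s: "s > 0" "s \<le> r" "C \<ge> 0"
    and small_r: "\<And>x n. x \<in> small s \<Longrightarrow> (\<delta> ^^ n) x \<in> small r"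
    and bd: "\<And>x n. x \<in> small s \<Longrightarrow> norm (\<psi> ((\<delta> ^^ n) x)) \<le> C * c ^ n * norm (\<psi> x)"
    using chart_contraction by metis
  obtain K where K: "K \<ge> 0" "\<And>v. norm (L v) \<le> norm v * K"
    using bounded_linear.nonneg_bounded[OF L_bounded] by blast
  have "\<exists>m\<ge>0. \<forall>x\<in>small s. norm (\<psi> ((\<delta> ^^ n) x) - (L ^^ n) (\<psi> x)) \<le> m * (norm (\<psi> x))\<^sup>2" for n
  proof (induction n)
    case (Suc n)
    then obtain m where m: "m \<ge> 0" "\<And>x. x \<in> small s \<Longrightarrow> norm (\<psi> ((\<delta> ^^ n) x) - (L ^^ n) (\<psi> x)) \<le> m * (norm (\<psi> x))\<^sup>2"
      by blast
    have "norm (\<psi> ((\<delta> ^^ Suc n) x) - (L ^^ Suc n) (\<psi> x)) \<le> (M * (C * c ^ n)\<^sup>2 + m * K) * (norm (\<psi> x))\<^sup>2"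
      if x: "x \<in> small s" for x
    proof -
      define y where "y = (\<delta> ^^ n) x"
      have y: "y \<in> U" "norm (\<psi> y) \<le> r" using small_r[OF x] by (auto simp: y_def small_def less_imp_le)
      have "norm (\<psi> (\<delta> y) - L (\<psi> y)) \<le> M * (norm (\<psi> y))\<^sup>2" using y by (rule \<delta>_approx)
      also have "\<dots> \<le> M * (C * c ^ n * norm (\<psi> x))\<^sup>2"
        using bd[OF x, of n] M_nonneg by (intro mult_left_mono power_mono) (auto simp: y_def)
      finally have 1: "norm (\<psi> (\<delta> y) - L (\<psi> y)) \<le> M * (C * c ^ n)\<^sup>2 * (norm (\<psi> x))\<^sup>2"
        by (simp add: power_mult_distrib)
      have "norm (L (\<psi> y) - L ((L ^^ n) (\<psi> x))) \<le> norm (\<psi> y - (L ^^ n) (\<psi> x)) * K"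
        using K(2) bounded_linear.linear[OF L_bounded] by (metis linear_diff)
      also have "\<dots> \<le> (m * (norm (\<psi> x))\<^sup>2) * K" using m(2)[OF x] K(1) by (intro mult_right_mono) (auto simp: y_def)
      finally have 2: "norm (L (\<psi> y) - L ((L ^^ n) (\<psi> x))) \<le> m * K * (norm (\<psi> x))\<^sup>2" by (simp only: mult_ac)
      have "\<psi> ((\<delta> ^^ Suc n) x) - (L ^^ Suc n) (\<psi> x) = (\<psi> (\<delta> y) - L (\<psi> y)) + (L (\<psi> y) - L ((L ^^ n) (\<psi> x)))"
        by (simp add: y_def)
      then show ?thesis using norm_triangle_mono[OF 1 2] by (simp add: algebra_simps)
    qed
    moreover have "M * (C * c ^ n)\<^sup>2 + m * K \<ge> 0" using M_nonneg m K by simp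
    ultimately show ?case by blast
  qed (auto intro: exI[of _ 0])
  then obtain m where m: "\<And>n. m n \<ge> 0"
    "\<And>n x. x \<in> small s \<Longrightarrow> norm (\<psi> ((\<delta> ^^ n) x) - (L ^^ n) (\<psi> x)) \<le> m n * (norm (\<psi> x))\<^sup>2" by metis
  have "norm ((L ^^ n) v) \<le> C * c ^ n * norm v" for n v
  proof (rule field_le_epsilon)
    fix e :: real assume e: "e > 0"
    (* The first bound puts t *\<^sub>R v into the chart ball, the second one makes the quadratic error,
       divided by t, at most e. *)
    define t where "t = min (s / (2 * (norm v + 1))) (e / (m n * (norm v)\<^sup>2 + 1))"
    have nv: "norm v + 1 > 0" "m n * (norm v)\<^sup>2 + 1 > 0" using m(1)[of n] by (auto simp: add_nonneg_pos)
    have t: "t > 0" using e s nv by (simp add: t_def)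
    have "t * norm v \<le> s / (2 * (norm v + 1)) * norm v" by (intro mult_right_mono) (auto simp: t_def)
    also have "\<dots> < s"
    proof -
      have "1 * (norm v + 1) < 2 * (norm v + 1)" by (rule mult_strict_right_mono[OF _ nv(1)]) simp
      then have "norm v < 2 * (norm v + 1)" by simp
      then have "s * norm v < s * (2 * (norm v + 1))" using s(1) by (rule mult_strict_left_mono)
      then show ?thesis using nv(1) by (simp add: pos_divide_less_eq)
    qed
    finally have tv: "t * norm v < s" .
    have "t * (m n * (norm v)\<^sup>2) \<le> e / (m n * (norm v)\<^sup>2 + 1) * (m n * (norm v)\<^sup>2)"
      using m(1)[of n] by (intro mult_right_mono) (auto simp: t_def)
    also have "\<dots> \<le> e" using e nv by (simp add: field_simps)
    finally have te: "t * (m n * (norm v)\<^sup>2) \<le> e" .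
    obtain x where x: "x \<in> U" "\<psi> x = t *\<^sub>R v" using chart_point[of "t *\<^sub>R v"] tv s t by auto
    then have xs: "x \<in> small s" using tv t by (simp add: small_def)
    have "norm ((L ^^ n) (\<psi> x)) \<le> norm (\<psi> ((\<delta> ^^ n) x)) + norm (\<psi> ((\<delta> ^^ n) x) - (L ^^ n) (\<psi> x))"
      by (metis norm_minus_commute norm_triangle_sub)
    also have "\<dots> \<le> C * c ^ n * norm (\<psi> x) + m n * (norm (\<psi> x))\<^sup>2" by (intro add_mono bd[OF xs] m(2)[OF xs])
    also have "(L ^^ n) (\<psi> x) = t *\<^sub>R (L ^^ n) v"
      unfolding x(2) using linear_cmul[OF bounded_linear.linear[OF L_pow_bounded]] by blast
    finally have "t * norm ((L ^^ n) v) \<le> t * (C * c ^ n * norm v + t * (m n * (norm v)\<^sup>2))"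
      using t by (simp add: x(2) power_mult_distrib algebra_simps power2_eq_square)
    then have "norm ((L ^^ n) v) \<le> C * c ^ n * norm v + t * (m n * (norm v)\<^sup>2)" using t by simp
    then show "norm ((L ^^ n) v) \<le> C * c ^ n * norm v + e" using te by linarith
  qed
  then show ?thesis by blast
qed

lemma bounded_contracted_into_chart:
  assumes S: "S \<subseteq> carrier G" and B: "\<And>x. x \<in> S \<Longrightarrow> d \<one> x \<le> B"
  shows "\<exists>n. \<forall>x\<in>S. (\<delta> ^^ n) x \<in> small r"
proof -
  obtain \<epsilon> where \<epsilon>: "\<epsilon> > 0" "\<forall>x\<in>carrier G. d \<one> x < \<epsilon> \<longrightarrow> x \<in> small r"
    using dist_ball_in_nbhd[OF small_open one_small[OF r_pos]] by blast
  obtain n where n: "c ^ n < \<epsilon> / (\<bar>B\<bar> + 1)" using real_arch_pow_inv[of "\<epsilon> / (\<bar>B\<bar> + 1)" c] \<epsilon>(1) c by auto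
  have "(\<delta> ^^ n) x \<in> small r" if x: "x \<in> S" for x
  proof -
    have "d \<one> ((\<delta> ^^ n) x) = c ^ n * d \<one> x" using x S by (auto simp: dist_one_pow)
    also have "\<dots> \<le> c ^ n * (\<bar>B\<bar> + 1)" using B[OF x] c by (intro mult_left_mono) auto
    also have "\<dots> < \<epsilon>" using n by (simp add: field_simps)
    finally show ?thesis using \<epsilon>(2) \<delta>_pow_carrier x S by blast
  qed
  then show ?thesis by blast
qed

text \<open>
  The segment between \<open>\<delta>\<^sup>n x\<close> and \<open>\<delta>\<^sup>n y\<close> in the chart, brought back by \<open>\<gamma>\<^sup>n\<close>; it joins \<open>x\<close> to \<open>y\<close> as soon
  as both images lie in the chart ball.
\<close>

definition chart_segment :: "nat \<Rightarrow> real \<Rightarrow> 'a \<Rightarrow> 'a \<Rightarrow> 'a" where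
  "chart_segment n t x y =
    (\<gamma> ^^ n) (inv_into U \<psi> ((1 - t) *\<^sub>R \<psi> ((\<delta> ^^ n) x) + t *\<^sub>R \<psi> ((\<delta> ^^ n) y)))"

lemma chart_segment_ends:
  assumes "x \<in> carrier G" "(\<delta> ^^ n) x \<in> small r" "y \<in> carrier G" "(\<delta> ^^ n) y \<in> small r"
  shows "chart_segment n 0 x y = x" "chart_segment n 1 x y = y"
  using assms \<psi>_inj by (auto simp: chart_segment_def small_def \<gamma>_\<delta>_pow)

lemma continuous_map_chart_segment:
  fixes K :: "'k::topological_space set"
  assumes f: "continuous_map (top_of_set K) T f" and g: "continuous_map (top_of_set K) T g"
    and t: "continuous_on K t" "t ` K \<subseteq> {0..1}"
    and small: "\<And>k. k \<in> K \<Longrightarrow> (\<delta> ^^ n) (f k) \<in> small r" "\<And>k. k \<in> K \<Longrightarrow> (\<delta> ^^ n) (g k) \<in> small r"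
  shows "continuous_map (top_of_set K) T (\<lambda>k. chart_segment n (t k) (f k) (g k))"
proof -
  have coord: "continuous_on K (\<lambda>k. \<psi> ((\<delta> ^^ n) (f k)))"
    if f: "continuous_map (top_of_set K) T f" and sm: "\<And>k. k \<in> K \<Longrightarrow> (\<delta> ^^ n) (f k) \<in> small r" for f
  proof -
    have "continuous_map (top_of_set K) T ((\<delta> ^^ n) \<circ> f)"
      by (rule continuous_map_compose[OF f \<delta>_pow_continuous])
    then have "continuous_map (top_of_set K) (subtopology T U) ((\<delta> ^^ n) \<circ> f)"
      using sm by (auto simp: continuous_map_in_subtopology small_def)
    from continuous_map_compose[OF this \<psi>_continuous]
    have "continuous_map (top_of_set K) euclidean (\<psi> \<circ> ((\<delta> ^^ n) \<circ> f))"
      by (rule continuous_map_into_fulltopology)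
    then show ?thesis by (simp add: o_def)
  qed
  let ?h = "\<lambda>k. (1 - t k) *\<^sub>R \<psi> ((\<delta> ^^ n) (f k)) + t k *\<^sub>R \<psi> ((\<delta> ^^ n) (g k))"
  have "continuous_on K ?h" by (intro continuous_intros coord f g small t)
  moreover have "?h k \<in> \<psi> ` U" if k: "k \<in> K" for k
  proof -
    have "norm (\<psi> ((\<delta> ^^ n) (f k))) \<le> r" "norm (\<psi> ((\<delta> ^^ n) (g k))) \<le> r"
      using small[OF k] by (auto simp: small_def)
    then have "\<psi> ((\<delta> ^^ n) (f k)) \<in> cball 0 r" "\<psi> ((\<delta> ^^ n) (g k)) \<in> cball 0 r" by auto
    then have "?h k \<in> cball 0 r" using t(2) k by (intro convexD[OF convex_cball]) auto
    then show ?thesis using ball_image by blast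
  qed
  ultimately have "continuous_map (top_of_set K) (top_of_set (\<psi> ` U)) ?h"
    by (auto simp: continuous_map_in_subtopology)
  from continuous_map_compose[OF continuous_map_compose[OF this \<psi>_inverse_continuous] \<gamma>_pow_continuous[of n]]
  show ?thesis by (simp add: o_def chart_segment_def)
qed

theorem connected_space_T: "connected_space T"
  unfolding connected_space_subconnected
proof (intro ballI)
  fix x y assume "x \<in> topspace T" "y \<in> topspace T"
  then have xy: "x \<in> carrier G" "y \<in> carrier G" by (auto simp: topspace_T)
  have "\<exists>n. \<forall>z\<in>{x, y}. (\<delta> ^^ n) z \<in> small r"
    by (rule bounded_contracted_into_chart[where B="max (d \<one> x) (d \<one> y)"]) (use xy in auto)
  then obtain n where n: "\<forall>z\<in>{x, y}. (\<delta> ^^ n) z \<in> small r" by blast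
  have "continuous_map (top_of_set {0..1::real}) T (\<lambda>t. chart_segment n t x y)"
    using n xy by (intro continuous_map_chart_segment) (auto simp: topspace_T)
  moreover have "connectedin (top_of_set {0..1::real}) {0..1}" by (simp add: connectedin_subtopology)
  ultimately have "connectedin T ((\<lambda>t. chart_segment n t x y) ` {0..1})"
    by (rule connectedin_continuous_map_image)
  moreover have "x \<in> (\<lambda>t. chart_segment n t x y) ` {0..1}" "y \<in> (\<lambda>t. chart_segment n t x y) ` {0..1}"
    using chart_segment_ends[of x n y] n xy by (force intro: image_eqI[of _ _ 0] image_eqI[of _ _ 1])+
  ultimately show "\<exists>S. connectedin T S \<and> x \<in> S \<and> y \<in> S" by blast
qed

lemma path_bounded:
  assumes "pathin T p" shows "\<exists>B. \<forall>t\<in>{0..1}. d \<one> (p t) \<le> B"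
proof -
  have "compactin mtopology (p ` {0..1})"
    using assms unfolding pathin_def mtopology_eq
    by (intro image_compactin[of "top_of_set {0..1}"]) (auto simp: compactin_subtopology)
  then have "mbounded (p ` {0..1})" by (rule compactin_imp_mbounded)
  then obtain B where "\<forall>x\<in>p ` {0..1}. \<forall>y\<in>p ` {0..1}. d x y \<le> B" "p ` {0..1} \<subseteq> carrier G"
    unfolding mbounded_alt by blast
  then have B: "d (p 0) (p t) \<le> B" "p t \<in> carrier G" if "t \<in> {0..1}" for t using that by auto
  have "d \<one> (p t) \<le> d \<one> (p 0) + B" if "t \<in> {0..1}" for t
    using triangle[of \<one> "p 0" "p t"] B(1)[OF that] B(2)[OF that] B(2)[of 0] by simp
  then show ?thesis by blast
qed

text \<open>
  For \<open>n\<close> large, chart segments between the points of two loops with equal parameter form a homotopy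
  through loops.
\<close>

theorem simply_connected_space_T: "simply_connected_space T"
  unfolding simply_connected_space_def
proof (intro allI impI)
  fix p q assume pq: "pathin T p \<and> p 1 = p 0 \<and> pathin T q \<and> q 1 = q 0"
  obtain B1 B2 where B: "\<forall>t\<in>{0..1}. d \<one> (p t) \<le> B1" "\<forall>t\<in>{0..1}. d \<one> (q t) \<le> B2"
    using path_bounded pq by blast
  have cp: "continuous_map (top_of_set {0..1}) T p" "continuous_map (top_of_set {0..1}) T q"
    using pq by (auto simp: pathin_def)
  have car: "p t \<in> carrier G" "q t \<in> carrier G" if "t \<in> {0..1}" for t
    using continuous_map_image_subset_topspace[OF cp(1)] continuous_map_image_subset_topspace[OF cp(2)] that
    by (auto simp: topspace_T)
  have "\<exists>n. \<forall>x\<in>p ` {0..1} \<union> q ` {0..1}. (\<delta> ^^ n) x \<in> small r"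
    by (rule bounded_contracted_into_chart[where B="max B1 B2"]) (use B car in \<open>auto simp: le_max_iff_disj\<close>)
  then obtain n where n: "\<forall>x\<in>p ` {0..1} \<union> q ` {0..1}. (\<delta> ^^ n) x \<in> small r" by blast
  define h where "h = (\<lambda>z::real \<times> real. chart_segment n (fst z) (p (snd z)) (q (snd z)))"
  have proj: "continuous_map (top_of_set ({0..1::real} \<times> {0..1::real})) (top_of_set {0..1}) snd"
    by (auto simp: continuous_map_in_subtopology intro: continuous_on_snd continuous_on_id)
  have "continuous_map (top_of_set ({0..1} \<times> {0..1})) T h"
    unfolding h_def
  proof (rule continuous_map_chart_segment)
    show "continuous_map (top_of_set ({0..1::real} \<times> {0..1::real})) T (\<lambda>z. p (snd z))"
      using continuous_map_compose[OF proj cp(1)] by (simp add: o_def)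
    show "continuous_map (top_of_set ({0..1::real} \<times> {0..1::real})) T (\<lambda>z. q (snd z))"
      using continuous_map_compose[OF proj cp(2)] by (simp add: o_def)
  qed (use n in \<open>auto intro!: continuous_intros\<close>)
  moreover have "prod_topology (top_of_set {0..1::real}) (top_of_set {0..1::real}) = top_of_set ({0..1} \<times> {0..1})"
    by (simp add: subtopology_Times[symmetric])
  ultimately have "continuous_map (prod_topology (top_of_set {0..1}) (top_of_set {0..1})) T h" by simp
  moreover have "h (0, t) = p t" "h (1, t) = q t" if "t \<in> {0..1}" for t
    using chart_segment_ends[of "p t" n "q t"] car[OF that] n that by (auto simp: h_def)
  moreover have "h (t, 1) = h (t, 0)" for t using pq by (simp add: h_def)
  ultimately show "homotopic_with (\<lambda>r. r 1 = r 0) (top_of_set {0..1}) T p q"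
    by (subst homotopic_with) auto
qed

end

section \<open>The chain distance of a chart\<close>

context chart_group
begin

definition chart_gauge :: "'a \<Rightarrow> real" where
  "chart_gauge x = (if x \<in> U then min 1 (norm (\<psi> x)) else 1)"

definition chain_costs :: "'a \<Rightarrow> real set" where
  "chain_costs x = {sum_list (map chart_gauge ys) | ys. set ys \<subseteq> carrier G \<and> foldr (\<otimes>) ys \<one> = x}"

text \<open>
  The infimum over all factorizations of \<open>x\<close> of the summed gauges; it is subadditive by concatenation.
\<close>

definition chain_norm :: "'a \<Rightarrow> real" where "chain_norm x = Inf (chain_costs x)"

text \<open>
  The maximum makes the distance symmetric, because the gauge of an element and of its inverse may differ.
\<close>

definition chain_dist :: "'a \<Rightarrow> 'a \<Rightarrow> real" where
  "chain_dist x y = max (chain_norm (inv x \<otimes> y)) (chain_norm (inv y \<otimes> x))"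

lemma chart_gauge_nonneg: "chart_gauge x \<ge> 0" by (simp add: chart_gauge_def)

lemma chain_cost_nonneg: "s \<in> chain_costs x \<Longrightarrow> s \<ge> 0"
  by (auto simp: chain_costs_def chart_gauge_nonneg intro!: sum_list_nonneg)

lemma bdd_chain_costs: "bdd_below (chain_costs x)"
  using chain_cost_nonneg by (intro bdd_belowI[of _ 0])

lemma chart_gauge_in_chain_costs: "x \<in> carrier G \<Longrightarrow> chart_gauge x \<in> chain_costs x"
  unfolding chain_costs_def by (intro CollectI exI[of _ "[x]"]) simp

lemma chain_costs_nonempty: "x \<in> carrier G \<Longrightarrow> chain_costs x \<noteq> {}"
  using chart_gauge_in_chain_costs by blast

lemma chain_norm_nonneg: "x \<in> carrier G \<Longrightarrow> chain_norm x \<ge> 0"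
  unfolding chain_norm_def by (rule cInf_greatest[OF chain_costs_nonempty chain_cost_nonneg])

lemma chain_norm_le_chart_gauge: "x \<in> carrier G \<Longrightarrow> chain_norm x \<le> chart_gauge x"
  unfolding chain_norm_def by (rule cInf_lower[OF chart_gauge_in_chain_costs bdd_chain_costs])

lemma chain_norm_one: "chain_norm \<one> = 0"
  using chain_norm_le_chart_gauge[of \<one>] chain_norm_nonneg[of \<one>] by (simp add: chart_gauge_def one_U \<psi>_one)

lemma foldr_mult_closed: "set ys \<subseteq> carrier G \<Longrightarrow> foldr (\<otimes>) ys \<one> \<in> carrier G"
  by (induction ys) auto

lemma foldr_mult_append:
  "set ys \<subseteq> carrier G \<Longrightarrow> set zs \<subseteq> carrier G \<Longrightarrow>
    foldr (\<otimes>) (ys @ zs) \<one> = foldr (\<otimes>) ys \<one> \<otimes> foldr (\<otimes>) zs \<one>"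
  by (induction ys) (auto simp: foldr_mult_closed m_assoc)

lemma chain_norm_mult:
  assumes "x \<in> carrier G" "y \<in> carrier G"
  shows "chain_norm (x \<otimes> y) \<le> chain_norm x + chain_norm y"
proof -
  have le: "chain_norm (x \<otimes> y) \<le> s + t" if st: "s \<in> chain_costs x" "t \<in> chain_costs y" for s t
  proof -
    obtain ys where ys: "s = sum_list (map chart_gauge ys)" "set ys \<subseteq> carrier G" "foldr (\<otimes>) ys \<one> = x"
      using st(1) unfolding chain_costs_def by blast
    obtain zs where zs: "t = sum_list (map chart_gauge zs)" "set zs \<subseteq> carrier G" "foldr (\<otimes>) zs \<one> = y"
      using st(2) unfolding chain_costs_def by blast
    have "s + t \<in> chain_costs (x \<otimes> y)"
      unfolding chain_costs_def
      using ys zs foldr_mult_append[OF ys(2) zs(2)] by (intro CollectI exI[of _ "ys @ zs"]) simp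
    then show ?thesis unfolding chain_norm_def by (rule cInf_lower[OF _ bdd_chain_costs])
  qed
  have "chain_norm (x \<otimes> y) - t \<le> chain_norm x" if t: "t \<in> chain_costs y" for t
    unfolding chain_norm_def[of x]
    using le[OF _ t] by (intro cInf_greatest[OF chain_costs_nonempty[OF assms(1)]]) (simp add: diff_le_eq)
  then have "chain_norm (x \<otimes> y) - chain_norm x \<le> t" if "t \<in> chain_costs y" for t
    using that by (simp add: algebra_simps)
  then have "chain_norm (x \<otimes> y) - chain_norm x \<le> chain_norm y"
    unfolding chain_norm_def[of y] by (intro cInf_greatest[OF chain_costs_nonempty[OF assms(2)]])
  then show ?thesis by simp
qed

text \<open>
  Each factor increases the norm of the coordinates by at most \<open>3/2\<close> of its gauge while the partial
  product is in the chart ball, and the total budget keeps it there. This is why short chains cannot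
  reach far points.
\<close>

lemma chain_stays_in_chart:
  assumes "set ys \<subseteq> carrier G" "sum_list (map chart_gauge ys) < 1" "x \<in> U"
    "norm (\<psi> x) + 2 * sum_list (map chart_gauge ys) \<le> r"
  shows "x \<otimes> foldr (\<otimes>) ys \<one> \<in> U \<and>
    norm (\<psi> (x \<otimes> foldr (\<otimes>) ys \<one>)) \<le> norm (\<psi> x) + 2 * sum_list (map chart_gauge ys)"
  using assms
proof (induction ys arbitrary: x)
  case Nil then show ?case using U_carrier by simp
next
  case (Cons y ys)
  let ?S = "sum_list (map chart_gauge ys)"
  have S: "?S \<ge> 0" by (intro sum_list_nonneg) (auto simp: chart_gauge_nonneg)
  have lt: "chart_gauge y + ?S < 1" and le: "norm (\<psi> x) + 2 * (chart_gauge y + ?S) \<le> r" using Cons.prems by auto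
  have y: "y \<in> U" "chart_gauge y = norm (\<psi> y)"
    using lt S by (auto simp: chart_gauge_def split: if_splits)
  have yr: "norm (\<psi> y) \<le> r" "norm (\<psi> x) \<le> r"
    using le S y(2) by (smt (verit) norm_ge_zero)+
  have xy: "x \<otimes> y \<in> U" "norm (\<psi> (x \<otimes> y)) \<le> norm (\<psi> x) + 3/2 * norm (\<psi> y)"
    using mult_U norm_mult_le Cons.prems(3) y(1) yr by auto
  have "norm (\<psi> (x \<otimes> y)) \<le> norm (\<psi> x) + 2 * norm (\<psi> y)"
    by (rule order_trans[OF xy(2)]) (intro add_left_mono mult_right_mono; simp)
  then have xy2: "norm (\<psi> (x \<otimes> y)) + 2 * ?S \<le> norm (\<psi> x) + 2 * (chart_gauge y + ?S)"
    unfolding y(2) distrib_left by linarith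
  have IH: "x \<otimes> y \<otimes> foldr (\<otimes>) ys \<one> \<in> U \<and>
    norm (\<psi> (x \<otimes> y \<otimes> foldr (\<otimes>) ys \<one>)) \<le> norm (\<psi> (x \<otimes> y)) + 2 * ?S"
    using Cons.prems lt le chart_gauge_nonneg[of y] xy(1) xy2 by (intro Cons.IH) auto
  have "x \<otimes> foldr (\<otimes>) (y # ys) \<one> = x \<otimes> y \<otimes> foldr (\<otimes>) ys \<one>"
    using Cons.prems U_carrier foldr_mult_closed[of ys] by (simp add: m_assoc)
  then show ?case using IH xy2 by simp
qed

lemma chain_norm_lower:
  assumes x: "x \<in> carrier G" "chain_norm x < t" and t: "t \<le> 1" "2 * t \<le> r"
  shows "x \<in> U \<and> norm (\<psi> x) \<le> 2 * t"
proof -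
  obtain s where "s \<in> chain_costs x" "s < t"
    using x cInf_less_iff[OF chain_costs_nonempty[OF x(1)] bdd_chain_costs] unfolding chain_norm_def by blast
  then obtain ys where ys: "set ys \<subseteq> carrier G" "foldr (\<otimes>) ys \<one> = x" "sum_list (map chart_gauge ys) < t"
    unfolding chain_costs_def by blast
  have "\<one> \<otimes> foldr (\<otimes>) ys \<one> \<in> U \<and>
    norm (\<psi> (\<one> \<otimes> foldr (\<otimes>) ys \<one>)) \<le> norm (\<psi> \<one>) + 2 * sum_list (map chart_gauge ys)"
    by (rule chain_stays_in_chart) (use ys t in \<open>auto simp: one_U \<psi>_one\<close>)
  then show ?thesis using ys x(1) by (simp add: \<psi>_one)
qed

lemma chain_dist_commute: "chain_dist x y = chain_dist y x"
  by (simp add: chain_dist_def max.commute)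

lemma chain_dist_nonneg: "x \<in> carrier G \<Longrightarrow> y \<in> carrier G \<Longrightarrow> chain_dist x y \<ge> 0"
  by (simp add: chain_dist_def chain_norm_nonneg le_max_iff_disj)

lemma chain_dist_self: "x \<in> carrier G \<Longrightarrow> chain_dist x x = 0"
  by (simp add: chain_dist_def chain_norm_one)

lemma chain_dist_left:
  assumes "g \<in> carrier G" "x \<in> carrier G" "y \<in> carrier G"
  shows "chain_dist (g \<otimes> x) (g \<otimes> y) = chain_dist x y"
proof -
  have "inv (g \<otimes> a) \<otimes> (g \<otimes> b) = inv a \<otimes> b" if "a \<in> carrier G" "b \<in> carrier G" for a b
  proof -
    have "inv (g \<otimes> a) \<otimes> (g \<otimes> b) = inv a \<otimes> (inv g \<otimes> (g \<otimes> b))"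
      using that assms(1) by (simp add: inv_mult_group m_assoc)
    then show ?thesis using that assms(1) by (simp add: m_assoc[symmetric])
  qed
  then show ?thesis using assms by (simp add: chain_dist_def)
qed

lemma chain_dist_triangle:
  assumes "x \<in> carrier G" "y \<in> carrier G" "z \<in> carrier G"
  shows "chain_dist x z \<le> chain_dist x y + chain_dist y z"
proof -
  have le: "chain_norm (inv a \<otimes> c) \<le> chain_norm (inv a \<otimes> b) + chain_norm (inv b \<otimes> c)"
    if "a \<in> carrier G" "b \<in> carrier G" "c \<in> carrier G" for a b c
  proof -
    have "inv a \<otimes> c = (inv a \<otimes> b) \<otimes> (inv b \<otimes> c)"
      using that by (simp add: m_assoc) (simp add: m_assoc[symmetric])
    then show ?thesis using chain_norm_mult[of "inv a \<otimes> b" "inv b \<otimes> c"] that by simp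
  qed
  show ?thesis using le[of x y z] le[of z y x] assms unfolding chain_dist_def by linarith
qed

lemma chain_dist_one: "x \<in> carrier G \<Longrightarrow> chain_dist \<one> x = max (chain_norm x) (chain_norm (inv x))"
  by (simp add: chain_dist_def)

lemma chain_dist_one_lower:
  assumes "x \<in> carrier G" "chain_dist \<one> x < t" "t \<le> 1" "2 * t \<le> r"
  shows "x \<in> U \<and> norm (\<psi> x) \<le> 2 * t"
  using assms chain_norm_lower[of x t] by (simp add: chain_dist_one)

lemma chain_dist_zero:
  assumes "x \<in> carrier G" "y \<in> carrier G" "chain_dist x y = 0" shows "x = y"
proof -
  define z where "z = inv x \<otimes> y"
  have z: "z \<in> carrier G" "chain_dist \<one> z = 0"
    using chain_dist_left[of "inv x" x y] assms by (auto simp: z_def)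
  have small: "z \<in> U \<and> norm (\<psi> z) \<le> 2 * t" if "t > 0" "t \<le> 1" "2 * t \<le> r" for t
    using chain_dist_one_lower[OF z(1)] z(2) that by simp
  have zU: "z \<in> U" using small[of "min 1 (r/2)"] r_pos by auto
  have "norm (\<psi> z) \<le> 0"
  proof (rule ccontr)
    assume "\<not> norm (\<psi> z) \<le> 0"
    then have "z \<in> U \<and> norm (\<psi> z) \<le> 2 * min (min 1 (r/2)) (norm (\<psi> z) / 4)"
      using r_pos by (intro small) auto
    then show False using \<open>\<not> norm (\<psi> z) \<le> 0\<close> by linarith
  qed
  then have "z = \<one>" using zU one_U \<psi>_one \<psi>_inj by (auto simp: inj_on_def)
  then have "x \<otimes> z = x" using assms by simp
  moreover have "x \<otimes> z = y" using assms by (simp add: z_def m_assoc[symmetric])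
  ultimately show ?thesis by simp
qed

definition small_sym :: "real \<Rightarrow> 'a set" where
  "small_sym \<rho> = {x \<in> small \<rho>. inv x \<in> small \<rho>}"

lemma small_sym_open: "openin T (small_sym \<rho>)"
proof -
  have "openin T {x \<in> topspace T. inv x \<in> small \<rho>}"
    by (rule openin_continuous_map_preimage[OF inv_continuous small_open])
  then have "openin T (small \<rho> \<inter> {x \<in> topspace T. inv x \<in> small \<rho>})" by (rule openin_Int[OF small_open])
  moreover have "small \<rho> \<inter> {x \<in> topspace T. inv x \<in> small \<rho>} = small_sym \<rho>"
    using small_carrier by (auto simp: small_sym_def topspace_T)
  ultimately show ?thesis by simp
qed

lemma one_small_sym: "\<rho> > 0 \<Longrightarrow> \<one> \<in> small_sym \<rho>"
  by (simp add: small_sym_def one_small)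

lemma small_sym_carrier: "x \<in> small_sym \<rho> \<Longrightarrow> x \<in> carrier G"
  unfolding small_sym_def using small_carrier by blast

lemma chain_norm_small: "x \<in> U \<Longrightarrow> chain_norm x \<le> norm (\<psi> x)"
  using chain_norm_le_chart_gauge[of x] U_carrier by (simp add: chart_gauge_def)

lemma chain_dist_small: "x \<in> small_sym \<rho> \<Longrightarrow> chain_dist \<one> x \<le> \<rho>"
  using chain_norm_small[of x] chain_norm_small[of "inv x"]
  by (simp add: chain_dist_one small_sym_carrier) (auto simp: small_sym_def small_def)

end

section \<open>Construction of a dilated distance\<close>

locale contracting_chart_automorphism = chart_group_automorphism G T U \<psi> r \<delta> \<gamma> L M
  for G :: "('a, 'm) monoid_scheme" (structure) and T U and \<psi> :: "'a \<Rightarrow> 'e::real_normed_vector"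
    and r \<delta> \<gamma> L M +
  fixes C c :: real
  assumes connected: "connected_space T" and c: "0 < c" "c < 1"
    and powers_bounded: "\<And>n v. norm ((L ^^ n) v) \<le> C * c ^ n * norm v" and C: "C \<ge> 1"
begin

text \<open>
  Write \<open>u n\<close> for the coordinates of \<open>\<delta>\<^sup>n x\<close>, so that \<open>u (n + 1) = L (u n)\<close> up to \<open>M * (norm (u n))\<^sup>2\<close>. Only the powers of
  \<open>L\<close> are controlled, not \<open>L\<close> itself, so the induction bounds \<open>L\<^sup>j (u n)\<close> for all \<open>j\<close> at once. The factor
  \<open>2 - c\<^sup>n\<close> increases with \<open>n\<close> by exactly what the quadratic error needs if \<open>x\<close> is close to the identity.
\<close>

lemma orbit_bound:
  obtains s where "s > 0"
    "\<And>x n. x \<in> small s \<Longrightarrow> (\<delta> ^^ n) x \<in> U \<and> norm (\<psi> ((\<delta> ^^ n) x)) \<le> 2 * C * c ^ n * norm (\<psi> x)"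
proof -
  (* The two bounds make 2 * b at most r and 4 * C * M * b at most c * (1 - c) for b = C * norm (\<psi> x);
     M + 1 replaces M as it must not vanish in the denominator. *)
  define s where "s = min (r / (2 * C)) (c * (1 - c) / (4 * C * (M + 1) * C))"
  have s: "s > 0" using r_pos C c M_nonneg by (simp add: s_def)
  have "(\<delta> ^^ n) x \<in> U \<and> (\<forall>j. norm ((L ^^ j) (\<psi> ((\<delta> ^^ n) x))) \<le> c ^ (j + n) * (C * norm (\<psi> x) * (2 - c ^ n)))"
    if x: "x \<in> small s" for x n
  proof (induction n)
    case 0
    have "norm ((L ^^ j) (\<psi> x)) \<le> c ^ j * (C * norm (\<psi> x))" for j
      using powers_bounded[where n=j and v="\<psi> x"] by (simp add: mult_ac)
    then show ?case using x by (simp add: small_def)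
  next
    case (Suc n)
    define b where "b = C * norm (\<psi> x)"
    define y where "y = (\<delta> ^^ n) x"
    have b0: "b \<ge> 0" using C by (simp add: b_def)
    have yU: "y \<in> U" and yL: "\<And>j. norm ((L ^^ j) (\<psi> y)) \<le> c ^ (j + n) * (b * (2 - c ^ n))"
      using Suc by (auto simp: y_def b_def)
    have cn: "0 < c ^ n" "c ^ n \<le> 1" using c by (auto simp: power_le_one)
    have nx: "norm (\<psi> x) \<le> s" using x by (simp add: small_def)
    have "b \<le> C * (r / (2 * C))" unfolding b_def using nx C by (intro mult_left_mono) (auto simp: s_def)
    then have b1: "2 * b \<le> r" using C by simp
    have "b \<le> C * (c * (1 - c) / (4 * C * (M + 1) * C))"
      unfolding b_def using nx C by (intro mult_left_mono) (auto simp: s_def)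
    also have "\<dots> = c * (1 - c) / (4 * C * (M + 1))" using C by simp
    finally have "4 * C * (M + 1) * b \<le> c * (1 - c)" using C M_nonneg by (simp add: pos_le_divide_eq mult_ac)
    moreover have "4 * C * M * b \<le> 4 * C * (M + 1) * b" using C M_nonneg b0 by (intro mult_right_mono mult_left_mono) auto
    ultimately have b2: "4 * C * M * b \<le> c * (1 - c)" by linarith
    have "norm (\<psi> y) \<le> c ^ n * (b * (2 - c ^ n))" using yL[of 0] by simp
    also have "\<dots> \<le> c ^ n * (b * 2)" using cn b0 by (intro mult_left_mono) auto
    finally have ny: "norm (\<psi> y) \<le> c ^ n * (2 * b)" by (simp add: mult_ac)
    have "c ^ n * (2 * b) \<le> 1 * (2 * b)" using cn b0 by (intro mult_right_mono) auto
    then have yr: "norm (\<psi> y) \<le> r" using ny b1 by linarith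
    have "(\<delta> ^^ Suc n) x = \<delta> y" by (simp add: y_def)
    moreover have "norm ((L ^^ j) (\<psi> (\<delta> y))) \<le> c ^ (j + Suc n) * (b * (2 - c ^ Suc n))" for j
    proof -
      have "(L ^^ j) (\<psi> (\<delta> y)) = (L ^^ Suc j) (\<psi> y) + (L ^^ j) (\<psi> (\<delta> y) - L (\<psi> y))"
        using linear_diff[OF bounded_linear.linear[OF L_pow_bounded[of j]]] by (simp add: funpow_swap1)
      also have "norm \<dots> \<le> norm ((L ^^ Suc j) (\<psi> y)) + norm ((L ^^ j) (\<psi> (\<delta> y) - L (\<psi> y)))"
        by (rule norm_triangle_ineq)
      also have "\<dots> \<le> c ^ (Suc j + n) * (b * (2 - c ^ n)) + C * c ^ j * (M * (c ^ n * (2 * b))\<^sup>2)"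
      proof (intro add_mono yL)
        have "norm ((L ^^ j) (\<psi> (\<delta> y) - L (\<psi> y))) \<le> C * c ^ j * norm (\<psi> (\<delta> y) - L (\<psi> y))"
          by (rule powers_bounded)
        also have "\<dots> \<le> C * c ^ j * (M * (c ^ n * (2 * b))\<^sup>2)"
          using C c M_nonneg ny
          by (intro mult_left_mono order_trans[OF \<delta>_approx[OF yU yr]] power_mono) auto
        finally show "norm ((L ^^ j) (\<psi> (\<delta> y) - L (\<psi> y))) \<le> C * c ^ j * (M * (c ^ n * (2 * b))\<^sup>2)" .
      qed
      also have "C * c ^ j * (M * (c ^ n * (2 * b))\<^sup>2) = (4 * C * M * b) * (c ^ (j + n) * c ^ n * b)"
        by (simp add: power2_eq_square power_add mult_ac)
      also have "\<dots> \<le> (c * (1 - c)) * (c ^ (j + n) * c ^ n * b)"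
        using b2 c b0 by (intro mult_right_mono) auto
      also have "c ^ (Suc j + n) * (b * (2 - c ^ n)) + (c * (1 - c)) * (c ^ (j + n) * c ^ n * b) =
          c ^ (j + Suc n) * (b * (2 - c ^ Suc n))"
        by (simp add: power_add algebra_simps)
      finally show ?thesis by simp
    qed
    ultimately show ?case using \<delta>_U[OF yU yr] by (simp add: b_def)
  qed
  note main = this
  show ?thesis
  proof (rule that[OF s])
    fix x n assume x: "x \<in> small s"
    have "norm (\<psi> ((\<delta> ^^ n) x)) \<le> c ^ n * (C * norm (\<psi> x) * (2 - c ^ n))"
      using main[OF x, of n, THEN conjunct2, THEN spec, of 0] by simp
    also have "\<dots> \<le> c ^ n * (C * norm (\<psi> x) * 2)" using c C by (intro mult_left_mono) auto
    finally show "(\<delta> ^^ n) x \<in> U \<and> norm (\<psi> ((\<delta> ^^ n) x)) \<le> 2 * C * c ^ n * norm (\<psi> x)"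
      using main[OF x] by (simp add: mult_ac)
  qed
qed

lemma chain_dist_orbit_small:
  obtains s where "s > 0"
    "\<And>x n \<rho>. x \<in> small_sym s \<Longrightarrow> x \<in> small_sym \<rho> \<Longrightarrow> chain_dist \<one> ((\<delta> ^^ n) x) \<le> 2 * C * \<rho> * c ^ n"
proof -
  obtain s where s: "s > 0"
    "\<And>x n. x \<in> small s \<Longrightarrow> (\<delta> ^^ n) x \<in> U \<and> norm (\<psi> ((\<delta> ^^ n) x)) \<le> 2 * C * c ^ n * norm (\<psi> x)"
    using orbit_bound by blast
  have le: "chain_norm ((\<delta> ^^ n) x) \<le> 2 * C * \<rho> * c ^ n" if x: "x \<in> small s" "x \<in> small \<rho>" for x n \<rho>
  proof -
    have "chain_norm ((\<delta> ^^ n) x) \<le> norm (\<psi> ((\<delta> ^^ n) x))" using s(2)[OF x(1)] chain_norm_small by blast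
    also have "\<dots> \<le> 2 * C * c ^ n * norm (\<psi> x)" using s(2)[OF x(1)] by blast
    also have "\<dots> \<le> 2 * C * c ^ n * \<rho>" using x(2) C c by (intro mult_left_mono) (auto simp: small_def)
    finally show ?thesis by (simp add: mult_ac)
  qed
  show ?thesis
  proof (rule that[OF s(1)])
    fix x n \<rho> assume x: "x \<in> small_sym s" "x \<in> small_sym \<rho>"
    have "x \<in> carrier G" using x(1) by (rule small_sym_carrier)
    then have "chain_dist \<one> ((\<delta> ^^ n) x) = max (chain_norm ((\<delta> ^^ n) x)) (chain_norm ((\<delta> ^^ n) (inv x)))"
      by (simp add: chain_dist_one \<delta>_pow_carrier \<delta>_pow_inv)
    then show "chain_dist \<one> ((\<delta> ^^ n) x) \<le> 2 * C * \<rho> * c ^ n"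
      using le[of x \<rho> n] le[of "inv x" \<rho> n] x by (simp add: small_sym_def)
  qed
qed

definition decaying :: "'a set" where
  "decaying = {x \<in> carrier G. \<exists>K. \<forall>n. chain_dist \<one> ((\<delta> ^^ n) x) \<le> K * c ^ n}"

lemma decaying_mult:
  assumes "x \<in> decaying" "y \<in> decaying" shows "x \<otimes> y \<in> decaying"
proof -
  obtain K where K: "x \<in> carrier G" "\<And>n. chain_dist \<one> ((\<delta> ^^ n) x) \<le> K * c ^ n"
    using assms(1) by (auto simp: decaying_def)
  obtain K' where K': "y \<in> carrier G" "\<And>n. chain_dist \<one> ((\<delta> ^^ n) y) \<le> K' * c ^ n"
    using assms(2) by (auto simp: decaying_def)
  have "chain_dist \<one> ((\<delta> ^^ n) (x \<otimes> y)) \<le> (K + K') * c ^ n" for n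
  proof -
    let ?x = "(\<delta> ^^ n) x" and ?y = "(\<delta> ^^ n) y"
    have car: "?x \<in> carrier G" "?y \<in> carrier G" using K(1) K'(1) \<delta>_pow_carrier by auto
    have "chain_dist \<one> (?x \<otimes> ?y) \<le> chain_dist \<one> ?x + chain_dist ?x (?x \<otimes> ?y)"
      using car by (intro chain_dist_triangle) auto
    also have "chain_dist ?x (?x \<otimes> ?y) = chain_dist \<one> ?y"
      using chain_dist_left[of ?x \<one> ?y] car by simp
    finally show ?thesis using K(2)[of n] K'(2)[of n] by (simp add: \<delta>_pow_mult K(1) K'(1) algebra_simps)
  qed
  then show ?thesis using K(1) K'(1) by (auto simp: decaying_def)
qed

lemma decaying_inv:
  assumes "x \<in> decaying" shows "inv x \<in> decaying"
proof -
  obtain K where K: "x \<in> carrier G" "\<And>n. chain_dist \<one> ((\<delta> ^^ n) x) \<le> K * c ^ n"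
    using assms by (auto simp: decaying_def)
  have "chain_dist \<one> ((\<delta> ^^ n) (inv x)) = chain_dist \<one> ((\<delta> ^^ n) x)" for n
    using K(1) by (simp add: \<delta>_pow_inv chain_dist_one \<delta>_pow_carrier max.commute)
  then show ?thesis using K by (auto simp: decaying_def)
qed

text \<open>
  The decaying elements form a subgroup containing a neighbourhood of the identity, hence an open and
  closed subset of a connected space.
\<close>

lemma decaying_all: "decaying = carrier G"
proof -
  obtain s where s: "s > 0"
    "\<And>x n \<rho>. x \<in> small_sym s \<Longrightarrow> x \<in> small_sym \<rho> \<Longrightarrow> chain_dist \<one> ((\<delta> ^^ n) x) \<le> 2 * C * \<rho> * c ^ n"
    using chain_dist_orbit_small by blast
  have small: "small_sym s \<subseteq> decaying" using s(2) small_sym_carrier by (auto simp: decaying_def)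
  define N where "N x = {y \<in> topspace T. inv x \<otimes> y \<in> small_sym s}" for x
  have N_open: "openin T (N x)" if "x \<in> carrier G" for x
    unfolding N_def
    by (rule openin_continuous_map_preimage[OF left_mult_continuous[OF inv_closed[OF that]] small_sym_open])
  have x_N: "x \<in> N x" if "x \<in> carrier G" for x
    unfolding N_def using that s(1) by (simp add: topspace_T one_small_sym)
  have iff: "y \<in> decaying \<longleftrightarrow> x \<in> decaying" if x: "x \<in> carrier G" and y: "y \<in> N x" for x y
  proof -
    have d: "inv x \<otimes> y \<in> decaying" and yc: "y \<in> carrier G" using y small by (auto simp: N_def topspace_T)
    have e1: "x \<otimes> (inv x \<otimes> y) = y" using x yc by (simp add: m_assoc[symmetric])
    have e2: "y \<otimes> inv (inv x \<otimes> y) = x"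
    proof -
      have "y \<otimes> inv (inv x \<otimes> y) = y \<otimes> (inv y \<otimes> x)" using x yc by (simp add: inv_mult_group)
      then show ?thesis using x yc by (simp add: m_assoc[symmetric])
    qed
    show ?thesis using decaying_mult[OF _ d, of x] decaying_mult[OF _ decaying_inv[OF d], of y] e1 e2 by auto
  qed
  have sub: "decaying \<subseteq> topspace T" by (auto simp: decaying_def topspace_T)
  have "openin T decaying"
  proof (subst openin_subopen, intro ballI)
    fix x assume x: "x \<in> decaying"
    then have xc: "x \<in> carrier G" by (simp add: decaying_def)
    have "N x \<subseteq> decaying" using iff[OF xc] x by blast
    then show "\<exists>W. openin T W \<and> x \<in> W \<and> W \<subseteq> decaying"
      using N_open[OF xc] x_N[OF xc] by blast
  qed
  moreover have "openin T (topspace T - decaying)"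
  proof (subst openin_subopen, intro ballI)
    fix x assume x: "x \<in> topspace T - decaying"
    then have xc: "x \<in> carrier G" by (simp add: topspace_T)
    have "N x \<subseteq> topspace T" unfolding N_def by blast
    then have "N x \<subseteq> topspace T - decaying" using iff[OF xc] x by blast
    then show "\<exists>W. openin T W \<and> x \<in> W \<and> W \<subseteq> topspace T - decaying"
      using N_open[OF xc] x_N[OF xc] by blast
  qed
  then have "closedin T decaying" using sub by (simp add: closedin_def)
  moreover have "\<one> \<in> decaying" using small one_small_sym[OF s(1)] by blast
  ultimately show ?thesis using connected unfolding connected_space_clopen_in topspace_T by blast
qed

definition int_pow :: "int \<Rightarrow> 'a \<Rightarrow> 'a" where
  "int_pow n = (if 0 \<le> n then \<delta> ^^ nat n else \<gamma> ^^ nat (- n))"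

lemma int_pow_carrier: "x \<in> carrier G \<Longrightarrow> int_pow n x \<in> carrier G"
  by (simp add: int_pow_def \<delta>_pow_carrier \<gamma>_pow_carrier)

lemma int_pow_mult: "x \<in> carrier G \<Longrightarrow> y \<in> carrier G \<Longrightarrow> int_pow n (x \<otimes> y) = int_pow n x \<otimes> int_pow n y"
  by (simp add: int_pow_def \<delta>_pow_mult \<gamma>_pow_mult)

lemma int_pow_one: "int_pow n \<one> = \<one>"
  by (simp add: int_pow_def \<delta>_pow_one \<gamma>_pow_one)

lemma int_pow_shift: "x \<in> carrier G \<Longrightarrow> int_pow n (\<delta> x) = int_pow (n + 1) x"
proof (cases "n \<ge> 0")
  case True
  then have "nat (n + 1) = Suc (nat n)" by simp
  then show ?thesis using True by (simp add: int_pow_def funpow_swap1)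
next
  case False
  assume x: "x \<in> carrier G"
  define k where "k = nat (- n - 1)"
  have k: "nat (- n) = Suc k" using False by (simp add: k_def)
  have "int_pow n (\<delta> x) = (\<gamma> ^^ k) (\<gamma> (\<delta> x))" using False by (simp add: int_pow_def k funpow_swap1)
  also have "\<dots> = (\<gamma> ^^ k) x" using x by (simp add: \<gamma>_\<delta>)
  also have "\<dots> = int_pow (n + 1) x"
  proof (cases "n = -1")
    case True then show ?thesis by (simp add: int_pow_def k_def)
  next
    case n: False
    then have "nat (- (n + 1)) = k" "\<not> 0 \<le> n + 1" using False by (auto simp: k_def)
    then show ?thesis by (simp add: int_pow_def)
  qed
  finally show ?thesis .
qed

definition scaled_dist :: "int \<Rightarrow> 'a \<Rightarrow> 'a \<Rightarrow> real" where
  "scaled_dist n x y = c powi (- n) * min 1 (chain_dist (int_pow n x) (int_pow n y))"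

text \<open>
  The factor \<open>c\<^sup>-\<^sup>n\<close> makes a shift of \<open>n\<close> into multiplication by \<open>c\<close>; the truncation in \<open>scaled_dist\<close> keeps the
  terms with negative \<open>n\<close>, where \<open>\<delta>\<^sup>n\<close> expands, below \<open>c\<^sup>-\<^sup>n \<le> 1\<close>. The value outside the group makes the
  function a metric in the sense of the locale \<open>Metric_space\<close>.
\<close>

definition dilated_dist :: "'a \<Rightarrow> 'a \<Rightarrow> real" where
  "dilated_dist x y = (if x \<in> carrier G \<and> y \<in> carrier G then (SUP n. scaled_dist n x y) else 0)"

lemma scaled_dist_nonneg: "x \<in> carrier G \<Longrightarrow> y \<in> carrier G \<Longrightarrow> scaled_dist n x y \<ge> 0"
  using c by (simp add: scaled_dist_def chain_dist_nonneg int_pow_carrier)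

lemma scaled_dist_left:
  "g \<in> carrier G \<Longrightarrow> x \<in> carrier G \<Longrightarrow> y \<in> carrier G \<Longrightarrow> scaled_dist n (g \<otimes> x) (g \<otimes> y) = scaled_dist n x y"
  by (simp add: scaled_dist_def int_pow_mult chain_dist_left int_pow_carrier)

lemma scaled_dist_commute: "scaled_dist n x y = scaled_dist n y x"
  by (simp add: scaled_dist_def chain_dist_commute)

lemma scaled_dist_nonneg_index:
  "scaled_dist (int n) \<one> x * c ^ n = min 1 (chain_dist \<one> ((\<delta> ^^ n) x))"
  using c by (simp add: scaled_dist_def int_pow_one int_pow_def \<delta>_pow_one power_int_minus field_simps)

lemma scaled_dist_neg_index:
  assumes "n < 0" "x \<in> carrier G" shows "scaled_dist n \<one> x \<le> c ^ nat (- n)"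
proof -
  have "c powi (- n) = c ^ nat (- n)" using assms by (simp add: power_int_def)
  then show ?thesis using c by (simp add: scaled_dist_def mult_left_le)
qed

lemma scaled_dist_le:
  assumes x: "x \<in> carrier G" and K: "K \<ge> 0" "\<And>n. chain_dist \<one> ((\<delta> ^^ n) x) \<le> K * c ^ n" and n: "n \<ge> 0"
  shows "scaled_dist n \<one> x \<le> K"
proof -
  obtain k where k: "n = int k" using n nonneg_eq_int by blast
  have "scaled_dist n \<one> x * c ^ k \<le> K * c ^ k"
    unfolding k scaled_dist_nonneg_index using K(2)[of k] by linarith
  then show ?thesis using c by simp
qed

lemma scaled_dist_bdd:
  assumes "x \<in> carrier G" "y \<in> carrier G" shows "bdd_above (range (\<lambda>n. scaled_dist n x y))"
proof -
  define z where "z = inv x \<otimes> y"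
  have z: "z \<in> carrier G" using assms by (simp add: z_def)
  have eq: "scaled_dist n x y = scaled_dist n \<one> z" for n
    using scaled_dist_left[of "inv x" x y n] assms by (simp add: z_def)
  obtain K where K: "\<And>n. chain_dist \<one> ((\<delta> ^^ n) z) \<le> K * c ^ n"
    using z decaying_all by (auto simp: decaying_def)
  have K0: "K \<ge> 0" using K[of 0] chain_dist_nonneg[of \<one> z] z by simp
  have "scaled_dist n \<one> z \<le> max K 1" for n
  proof (cases "n \<ge> 0")
    case True then show ?thesis using scaled_dist_le[OF z K0 K] by (simp add: le_max_iff_disj)
  next
    case False
    then have "scaled_dist n \<one> z \<le> c ^ nat (- n)" using scaled_dist_neg_index z by simp
    also have "\<dots> \<le> 1" using c by (simp add: power_le_one)
    finally show ?thesis by simp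
  qed
  then show ?thesis unfolding eq by (intro bdd_aboveI[of _ "max K 1"]) auto
qed

lemma scaled_le_dilated:
  "x \<in> carrier G \<Longrightarrow> y \<in> carrier G \<Longrightarrow> scaled_dist n x y \<le> dilated_dist x y"
  unfolding dilated_dist_def using cSUP_upper[OF UNIV_I scaled_dist_bdd] by simp

lemma dilated_leI:
  "x \<in> carrier G \<Longrightarrow> y \<in> carrier G \<Longrightarrow> (\<And>n. scaled_dist n x y \<le> K) \<Longrightarrow> dilated_dist x y \<le> K"
  by (simp add: dilated_dist_def cSUP_least)

lemma dilated_dist_lower:
  "x \<in> carrier G \<Longrightarrow> y \<in> carrier G \<Longrightarrow> min 1 (chain_dist x y) \<le> dilated_dist x y"
  using scaled_le_dilated[of x y 0] by (simp add: scaled_dist_def int_pow_def)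

lemma dilated_dist_left:
  "g \<in> carrier G \<Longrightarrow> x \<in> carrier G \<Longrightarrow> y \<in> carrier G \<Longrightarrow> dilated_dist (g \<otimes> x) (g \<otimes> y) = dilated_dist x y"
  by (simp add: dilated_dist_def scaled_dist_left)

lemma dilated_dist_metric: "Metric_space (carrier G) dilated_dist"
proof
  fix x y z :: 'a
  show "0 \<le> dilated_dist x y"
    using scaled_dist_nonneg[of x y 0] scaled_le_dilated[of x y 0] by (auto simp: dilated_dist_def)
  show "dilated_dist x y = dilated_dist y x"
    by (auto simp: dilated_dist_def scaled_dist_commute[of _ x y])
  assume x: "x \<in> carrier G" and y: "y \<in> carrier G"
  show "dilated_dist x y = 0 \<longleftrightarrow> x = y"
  proof
    assume "dilated_dist x y = 0"
    then have "chain_dist x y = 0"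
      using dilated_dist_lower[OF x y] chain_dist_nonneg[OF x y] by (auto simp: min_def split: if_splits)
    then show "x = y" by (rule chain_dist_zero[OF x y])
  next
    assume "x = y"
    then show "dilated_dist x y = 0"
      using x by (simp add: dilated_dist_def scaled_dist_def chain_dist_self int_pow_carrier)
  qed
  assume z: "z \<in> carrier G"
  show "dilated_dist x z \<le> dilated_dist x y + dilated_dist y z"
  proof (rule dilated_leI[OF x z])
    fix n
    let ?p = "int_pow n"
    have "min 1 (chain_dist (?p x) (?p z)) \<le> min 1 (chain_dist (?p x) (?p y)) + min 1 (chain_dist (?p y) (?p z))"
      using chain_dist_triangle[of "?p x" "?p y" "?p z"] chain_dist_nonneg[of "?p x" "?p y"]
        chain_dist_nonneg[of "?p y" "?p z"] x y z by (simp add: int_pow_carrier min_def)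
    then have "scaled_dist n x z \<le> scaled_dist n x y + scaled_dist n y z"
      unfolding scaled_dist_def distrib_left[symmetric] using c by (intro mult_left_mono) auto
    then show "scaled_dist n x z \<le> dilated_dist x y + dilated_dist y z"
      using scaled_le_dilated[OF x y, of n] scaled_le_dilated[OF y z, of n] by linarith
  qed
qed

lemma scaled_dist_shift:
  "x \<in> carrier G \<Longrightarrow> y \<in> carrier G \<Longrightarrow> scaled_dist n (\<delta> x) (\<delta> y) = c * scaled_dist (n + 1) x y"
  using c by (simp add: scaled_dist_def int_pow_shift power_int_diff power_int_minus power_int_add field_simps)

lemma dilated_dist_dilation:
  assumes x: "x \<in> carrier G" and y: "y \<in> carrier G"
  shows "dilated_dist (\<delta> x) (\<delta> y) = c * dilated_dist x y"
proof (rule antisym)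
  have car: "\<delta> x \<in> carrier G" "\<delta> y \<in> carrier G" using x y \<delta>_carrier by auto
  show "dilated_dist (\<delta> x) (\<delta> y) \<le> c * dilated_dist x y"
    using c scaled_le_dilated[OF x y] by (intro dilated_leI[OF car]) (simp add: scaled_dist_shift x y)
  have "scaled_dist n x y \<le> dilated_dist (\<delta> x) (\<delta> y) / c" for n
    using scaled_le_dilated[OF car, of "n - 1"] c by (simp add: scaled_dist_shift x y field_simps)
  then have "dilated_dist x y \<le> dilated_dist (\<delta> x) (\<delta> y) / c" by (rule dilated_leI[OF x y])
  then show "c * dilated_dist x y \<le> dilated_dist (\<delta> x) (\<delta> y)" using c by (simp add: field_simps)
qed

text \<open>
  The term for \<open>n = 0\<close> bounds the distance below by the truncated chain distance. For the other direction,
  the terms with \<open>n \<ge> 0\<close> are small near the identity by the orbit estimate, those with \<open>n\<close> very negative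
  because \<open>c\<^sup>-\<^sup>n\<close> is small, and the finitely many remaining ones by continuity of \<open>\<gamma>\<^sup>k\<close>.
\<close>

lemma dilated_dist_topology: "Metric_space.mtopology (carrier G) dilated_dist = T"
proof (rule mtopology_eqI[OF dilated_dist_metric dilated_dist_left])
  fix W assume W: "openin T W" "\<one> \<in> W"
  obtain \<rho> where \<rho>: "\<rho> > 0" "\<rho> \<le> r" "small \<rho> \<subseteq> W" using nbhd_contains_small[OF W] by blast
  define t where "t = min (1/2) (\<rho>/4)"
  have t: "t > 0" "t < 1" "2 * t \<le> r" "2 * t < \<rho>" using \<rho> by (auto simp: t_def)
  have "x \<in> W" if x: "x \<in> carrier G" "dilated_dist \<one> x < t" for x
  proof -
    have "min 1 (chain_dist \<one> x) < t" using dilated_dist_lower[of \<one> x] x by simp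
    then have "chain_dist \<one> x < t" using t(2) by (auto simp: min_def split: if_splits)
    then have "x \<in> U \<and> norm (\<psi> x) \<le> 2 * t" using t by (intro chain_dist_one_lower[OF x(1)]) auto
    then show ?thesis using \<rho>(3) t(4) by (auto simp: small_def)
  qed
  then show "\<exists>\<epsilon>>0. \<forall>x\<in>carrier G. dilated_dist \<one> x < \<epsilon> \<longrightarrow> x \<in> W" using t(1) by blast
next
  fix \<epsilon> :: real assume e: "\<epsilon> > 0"
  obtain s where s: "s > 0"
    "\<And>x n \<rho>. x \<in> small_sym s \<Longrightarrow> x \<in> small_sym \<rho> \<Longrightarrow> chain_dist \<one> ((\<delta> ^^ n) x) \<le> 2 * C * \<rho> * c ^ n"
    using chain_dist_orbit_small by blast
  obtain m where m: "c ^ m < \<epsilon> / 2" using real_arch_pow_inv[of "\<epsilon> / 2" c] e c by auto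
  define \<rho> where "\<rho> = \<epsilon> / (4 * C)"
  have \<rho>: "\<rho> > 0" "2 * C * \<rho> = \<epsilon> / 2" using e C by (auto simp: \<rho>_def)
  define V where "V k = {x \<in> topspace T. (\<gamma> ^^ k) x \<in> small_sym (\<epsilon>/2)}" for k
  have V: "openin T (V k)" for k
    unfolding V_def by (rule openin_continuous_map_preimage[OF \<gamma>_pow_continuous small_sym_open])
  define W where "W = small_sym s \<inter> small_sym \<rho> \<inter> (\<Inter>k\<in>{..m}. V k)"
  have "openin T (\<Inter>k\<in>{..m}. V k)" by (rule openin_INT2) (auto intro: V)
  then have "openin T W" unfolding W_def by (intro openin_Int small_sym_open)
  moreover have "\<one> \<in> W"
    using s \<rho> e by (auto simp: W_def V_def one_small_sym \<gamma>_pow_one topspace_T)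
  moreover have "dilated_dist \<one> x < \<epsilon>" if x: "x \<in> W" for x
  proof -
    have xc: "x \<in> carrier G" and xs: "x \<in> small_sym s" "x \<in> small_sym \<rho>"
      and xV: "\<And>k. k \<le> m \<Longrightarrow> (\<gamma> ^^ k) x \<in> small_sym (\<epsilon>/2)"
      using x by (auto simp: W_def V_def small_sym_carrier)
    have "scaled_dist n \<one> x \<le> \<epsilon> / 2" for n
    proof (cases "n \<ge> 0")
      case True
      then show ?thesis
        using s(2)[OF xs] e by (intro scaled_dist_le[OF xc]) (auto simp: \<rho>(2))
    next
      case neg: False
      define k where "k = nat (- n)"
      show ?thesis
      proof (cases "k \<le> m")
        case True
        have "scaled_dist n \<one> x = c ^ k * min 1 (chain_dist \<one> ((\<gamma> ^^ k) x))"
          using neg by (simp add: scaled_dist_def int_pow_def k_def \<gamma>_pow_one power_int_def)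
        also have "\<dots> \<le> 1 * min 1 (chain_dist \<one> ((\<gamma> ^^ k) x))"
          using c chain_dist_nonneg \<gamma>_pow_carrier xc by (intro mult_right_mono) (auto simp: power_le_one)
        also have "\<dots> \<le> \<epsilon> / 2" using chain_dist_small[OF xV[OF True]] by (simp add: min_le_iff_disj)
        finally show ?thesis .
      next
        case False
        have "scaled_dist n \<one> x \<le> c ^ k" unfolding k_def using neg xc by (intro scaled_dist_neg_index) auto
        also have "\<dots> \<le> c ^ m" using False c by (intro power_decreasing) auto
        finally show ?thesis using m by simp
      qed
    qed
    then have "dilated_dist \<one> x \<le> \<epsilon> / 2" by (intro dilated_leI) (auto simp: xc)
    then show ?thesis using e by simp
  qed
  ultimately show "\<exists>W. openin T W \<and> \<one> \<in> W \<and> (\<forall>x\<in>W. dilated_dist \<one> x < \<epsilon>)" by blast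
qed

theorem ex_dilated_distance:
  "\<exists>d. Metric_space (carrier G) d \<and>
     (\<forall>g\<in>carrier G. \<forall>x\<in>carrier G. \<forall>y\<in>carrier G. d (g \<otimes> x) (g \<otimes> y) = d x y) \<and>
     Metric_space.mtopology (carrier G) d = T \<and>
     (\<forall>x\<in>carrier G. \<forall>y\<in>carrier G. d (\<delta> x) (\<delta> y) = c * d x y)"
  using dilated_dist_metric dilated_dist_left dilated_dist_topology dilated_dist_dilation by blast

end

section \<open>Dilations in terms of the linear part\<close>

lemma topological_chart_translate:
  fixes \<phi> :: "'a \<Rightarrow> 'e::real_normed_vector"
  assumes "topological_chart T U \<phi>" shows "topological_chart T U (\<lambda>x. \<phi> x - p)"
proof -
  interpret topological_chart T U \<phi> by fact
  let ?t = "\<lambda>v. v - p"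
  have im: "(\<lambda>x. \<phi> x - p) ` U = ?t ` (\<phi> ` U)" by auto
  have "homeomorphic_maps (top_of_set (\<phi> ` U)) (top_of_set (?t ` (\<phi> ` U))) ?t (\<lambda>v. v + p)"
    unfolding homeomorphic_maps_def by (auto simp: continuous_map_in_subtopology intro!: continuous_intros)
  then have "homeomorphic_map (top_of_set (\<phi> ` U)) (top_of_set (?t ` (\<phi> ` U))) ?t"
    using homeomorphic_map_maps by blast
  then have "homeomorphic_map (subtopology T U) (top_of_set (?t ` (\<phi> ` U))) (?t \<circ> \<phi>)"
    by (rule homeomorphic_map_compose[OF \<psi>_homeo])
  moreover have "open (?t ` (\<phi> ` U))" using open_translation_subtract[OF open_image, of p] .
  ultimately show ?thesis unfolding topological_chart_def im by (simp add: o_def open_U)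
qed

context lie_group_chart
begin

lemma left_mult_continuous: "g \<in> carrier G \<Longrightarrow> continuous_map T T (\<lambda>x. g \<otimes> x)"
proof -
  assume g: "g \<in> carrier G"
  have "continuous_map T (prod_topology T T) (\<lambda>x. (g, x))"
    using g topspace_eq_carrier by (simp add: continuous_map_pairedI)
  from continuous_map_compose[OF this mult_continuous] show ?thesis by (simp add: o_def)
qed


abbreviation left_field_cplx :: "'e \<times> 'e \<Rightarrow> 'a vfield \<times> 'a vfield" where
  "left_field_cplx \<equiv> map_prod left_field left_field"

lemma left_field_zero: "left_field 0 = 0"
  using left_field_linear(2)[of 0 0] by (simp add: vf_scale_def fun_eq_iff)

lemma left_field_diff: "left_field (v - w) = left_field v - left_field w"
  using left_field_linear(1)[of "v - w" w] by (simp add: algebra_simps)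

lemma left_field_cplx_diff: "left_field_cplx (v - w) = left_field_cplx v - left_field_cplx w"
  by (cases v; cases w) (simp add: left_field_diff)

lemma left_field_cplx_scale: "left_field_cplx (pair_scale z v) = vf_cplx_scale z (left_field_cplx v)"
  by (cases v) (simp add: vf_cplx_scale_def cplx_scale_def left_field_linear left_field_diff)

lemma left_field_cplx_eq_iff: "left_field_cplx v = left_field_cplx w \<longleftrightarrow> v = w"
  by (cases v; cases w) (auto dest: injD[OF left_field_inj])

lemma left_field_cplx_zero: "left_field_cplx v = 0 \<longleftrightarrow> v = 0"
  using left_field_cplx_eq_iff[of v 0] by (simp add: left_field_zero zero_prod_def)

lemma lie_algebra_cplx_eq: "lie_algebra_cplx G T A = range left_field_cplx"
  unfolding lie_algebra_cplx_def lie_algebra_eq_left_fields by (auto simp: map_prod_def image_iff)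

end

text \<open>
  Keeping the inverse \<open>\<gamma>\<close> as a parameter makes the situation symmetric: the expanding case is the
  contracting case with \<open>\<delta>\<close> and \<open>\<gamma>\<close> exchanged.
\<close>

locale lie_group_chart_automorphism = lie_group_chart G T A U \<phi>
  for G :: "('a, 'm) monoid_scheme" (structure) and T and A :: "('a, 'e::real_normed_vector) chart set" and U \<phi> +
  fixes \<delta> \<gamma> :: "'a \<Rightarrow> 'a"
  assumes \<delta>: "smooth_map T A T A \<delta>" "\<delta> \<in> hom G G" and \<gamma>: "smooth_map T A T A \<gamma>" "\<gamma> \<in> hom G G"
    and \<gamma>_\<delta>: "\<And>x. x \<in> carrier G \<Longrightarrow> \<gamma> (\<delta> x) = x" and \<delta>_\<gamma>: "\<And>x. x \<in> carrier G \<Longrightarrow> \<delta> (\<gamma> x) = x"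
begin

lemma inverse_automorphism: "lie_group_chart_automorphism G T A U \<phi> \<gamma> \<delta>"
  by unfold_locales (use \<delta> \<gamma> \<gamma>_\<delta> \<delta>_\<gamma> in auto)

lemma \<delta>_fixes_one: "\<delta> \<one> = \<one>" using hom_one[OF \<delta>(2)] is_group by auto

text \<open>
  Translating the chart so that the identity has coordinate \<open>0\<close> and shrinking the radius combines the
  first order estimate for the product and the second order estimate for \<open>\<delta>\<close>.
\<close>

lemma chart_group_automorphism_at_one:
  "\<exists>r M. chart_group_automorphism G T U (\<lambda>x. \<phi> x - \<phi> \<one>) r \<delta> \<gamma> (linear_part \<delta>) M"
proof -
  let ?\<psi> = "\<lambda>x. \<phi> x - \<phi> \<one>"
  obtain r1 where r1: "r1 > 0" "cball (\<phi> \<one>) r1 \<subseteq> \<phi> ` U"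
    and multU: "\<And>x y. x \<in> U \<Longrightarrow> y \<in> U \<Longrightarrow> norm (?\<psi> x) \<le> r1 \<Longrightarrow> norm (?\<psi> y) \<le> r1 \<Longrightarrow> x \<otimes> y \<in> U"
    and mult: "\<And>x y. x \<in> U \<Longrightarrow> y \<in> U \<Longrightarrow> norm (?\<psi> x) \<le> r1 \<Longrightarrow> norm (?\<psi> y) \<le> r1 \<Longrightarrow>
      norm (?\<psi> (x \<otimes> y) - ?\<psi> x - ?\<psi> y) \<le> norm (?\<psi> y) / 2"
    using mult_first_order by blast
  obtain r2 M where r2: "r2 > 0" "M \<ge> 0"
    and \<delta>U: "\<And>x. x \<in> U \<Longrightarrow> norm (?\<psi> x) \<le> r2 \<Longrightarrow> \<delta> x \<in> U"
    and \<delta>2: "\<And>x. x \<in> U \<Longrightarrow> norm (?\<psi> x) \<le> r2 \<Longrightarrow>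
      norm (?\<psi> (\<delta> x) - linear_part \<delta> (?\<psi> x)) \<le> M * (norm (?\<psi> x))\<^sup>2"
    using endomorphism_second_order[OF \<delta>(1) \<delta>_fixes_one] by blast
  interpret t: topological_chart T U ?\<psi>
    by (rule topological_chart_translate) (rule identity_chart.topological_chart_axioms)
  interpret bl: bounded_linear "linear_part \<delta>"
    using linear_part_has_derivative[OF \<delta>(1) \<delta>_fixes_one] by (rule has_derivative_bounded_linear)
  have "chart_group_automorphism G T U ?\<psi> (min r1 r2) \<delta> \<gamma> (linear_part \<delta>) M"
  proof unfold_locales
    show "topspace T = carrier G" by (rule topspace_eq_carrier)
    show "continuous_map T T (\<lambda>x. g \<otimes> x)" if "g \<in> carrier G" for g by (rule left_mult_continuous[OF that])
    show "continuous_map T T (\<lambda>x. inv x)" using smooth_inv by (simp add: smooth_map_def)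
    show "\<one> \<in> U" by (rule one_U)
    show "min r1 r2 > 0" using r1 r2 by simp
    show "cball 0 (min r1 r2) \<subseteq> ?\<psi> ` U"
    proof
      fix v :: 'e assume "v \<in> cball 0 (min r1 r2)"
      then have "v + \<phi> \<one> \<in> cball (\<phi> \<one>) r1" by (simp add: dist_norm)
      then have "v + \<phi> \<one> \<in> \<phi> ` U" using r1(2) by blast
      then obtain x where x: "x \<in> U" "\<phi> x = v + \<phi> \<one>" by fastforce
      then have "v = ?\<psi> x" by simp
      then show "v \<in> ?\<psi> ` U" using x(1) by (rule image_eqI)
    qed
    show "continuous_map T T \<delta>" "continuous_map T T \<gamma>" using \<delta>(1) \<gamma>(1) by (simp_all add: smooth_map_def)
  qed (use multU mult \<delta>U \<delta>2 r2(2) \<delta>(2) \<gamma>(2) \<gamma>_\<delta> \<delta>_\<gamma> in auto)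
  then show ?thesis by blast
qed

theorem dilated_distance_iff_powers_bounded:
  assumes c: "0 < c" "c < 1"
  shows "(\<exists>d. admissible_distance G T d \<and> (\<forall>x\<in>carrier G. \<forall>y\<in>carrier G. d (\<delta> x) (\<delta> y) = c * d x y)) \<longleftrightarrow>
    connected_space T \<and> simply_connected_space T \<and>
    (\<exists>C. \<forall>n v. norm ((linear_part \<delta> ^^ n) v) \<le> C * c ^ n * norm v)"
proof -
  obtain r M where "chart_group_automorphism G T U (\<lambda>x. \<phi> x - \<phi> \<one>) r \<delta> \<gamma> (linear_part \<delta>) M"
    using chart_group_automorphism_at_one by blast
  then interpret cga: chart_group_automorphism G T U "\<lambda>x. \<phi> x - \<phi> \<one>" r \<delta> \<gamma> "linear_part \<delta>" M .
  show ?thesis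
  proof
    assume "\<exists>d. admissible_distance G T d \<and> (\<forall>x\<in>carrier G. \<forall>y\<in>carrier G. d (\<delta> x) (\<delta> y) = c * d x y)"
    then obtain d where d: "admissible_distance G T d"
      "\<And>x y. x \<in> carrier G \<Longrightarrow> y \<in> carrier G \<Longrightarrow> d (\<delta> x) (\<delta> y) = c * d x y" by blast
    interpret cm: contracted_metric G T U "\<lambda>x. \<phi> x - \<phi> \<one>" r \<delta> \<gamma> "linear_part \<delta>" M d c
      by unfold_locales (use d c in \<open>auto simp: admissible_distance_def Metric_space_def\<close>)
    show "connected_space T \<and> simply_connected_space T \<and>
        (\<exists>C. \<forall>n v. norm ((linear_part \<delta> ^^ n) v) \<le> C * c ^ n * norm v)"
      using cm.connected_space_T cm.simply_connected_space_T cm.linear_part_powers_bounded by blast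
  next
    assume R: "connected_space T \<and> simply_connected_space T \<and>
        (\<exists>C. \<forall>n v. norm ((linear_part \<delta> ^^ n) v) \<le> C * c ^ n * norm v)"
    then obtain C where C: "\<And>n v. norm ((linear_part \<delta> ^^ n) v) \<le> C * c ^ n * norm v" by blast
    interpret cca: contracting_chart_automorphism G T U "\<lambda>x. \<phi> x - \<phi> \<one>" r \<delta> \<gamma> "linear_part \<delta>" M "max C 1" c
    proof unfold_locales
      fix n and v :: 'e
      have "C * c ^ n * norm v \<le> max C 1 * c ^ n * norm v" using c by (intro mult_right_mono) auto
      then show "norm ((linear_part \<delta> ^^ n) v) \<le> max C 1 * c ^ n * norm v" using C[of n v] by linarith
    qed (use R c in auto)
    show "\<exists>d. admissible_distance G T d \<and> (\<forall>x\<in>carrier G. \<forall>y\<in>carrier G. d (\<delta> x) (\<delta> y) = c * d x y)"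
      unfolding admissible_distance_def using cca.ex_dilated_distance by blast
  qed
qed

section \<open>Transfer of the spectral conditions to the Lie algebra\<close>

abbreviation L2 :: "'e \<times> 'e \<Rightarrow> 'e \<times> 'e" where "L2 \<equiv> map_prod (linear_part \<delta>) (linear_part \<delta>)"

lemma linear_linear_part: "linear (linear_part \<delta>)"
  using linear_part_has_derivative[OF \<delta>(1) \<delta>_fixes_one] by (rule has_derivative_linear)

lemma induced_aut_cplx_left_field: "induced_aut_cplx G \<delta> (left_field_cplx v) = left_field_cplx (L2 v)"
proof -
  have "inv_into (carrier G) \<delta> x = \<gamma> x" if x: "x \<in> carrier G" for x
  proof (rule inv_into_f_eq)
    show "inj_on \<delta> (carrier G)" by (rule inj_on_inverseI[of _ \<gamma>]) (rule \<gamma>_\<delta>)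
    show "\<gamma> x \<in> carrier G" using hom_in_carrier[OF \<gamma>(2) x] .
  qed (rule \<delta>_\<gamma>[OF x])
  then have "induced_aut G \<delta> (left_field w) = left_field (linear_part \<delta> w)" for w
    using hom_in_carrier[OF \<gamma>(2)] by (intro induced_aut_left_field[OF \<delta> \<gamma>(1)]) (auto simp: \<delta>_\<gamma>)
  then show ?thesis by (cases v) (simp add: induced_aut_cplx_def)
qed

lemma complex_operator_induced_aut: "complex_operator vf_cplx_scale (induced_aut_cplx G \<delta>)"
proof -
  interpret vector_space "vf_cplx_scale :: complex \<Rightarrow> 'a vfield \<times> 'a vfield \<Rightarrow> _"
    by (rule vector_space_vf_cplx_scale)
  have add: "induced_aut G \<delta> (X + Y) = induced_aut G \<delta> X + induced_aut G \<delta> Y" for X Y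
    by (auto simp: induced_aut_def fun_eq_iff)
  have diff: "induced_aut G \<delta> (X - Y) = induced_aut G \<delta> X - induced_aut G \<delta> Y" for X Y
    by (auto simp: induced_aut_def fun_eq_iff)
  have scale: "induced_aut G \<delta> (vf_scale a X) = vf_scale a (induced_aut G \<delta> X)" for a X
    by (auto simp: induced_aut_def fun_eq_iff vf_scale_def)
  show ?thesis
  proof
    show "induced_aut_cplx G \<delta> (x + y) = induced_aut_cplx G \<delta> x + induced_aut_cplx G \<delta> y" for x y
      by (cases x; cases y) (simp add: induced_aut_cplx_def add)
    show "induced_aut_cplx G \<delta> (vf_cplx_scale z x) = vf_cplx_scale z (induced_aut_cplx G \<delta> x)" for z x
      by (cases x) (simp add: induced_aut_cplx_def vf_cplx_scale_def cplx_scale_def add diff scale)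
  qed
qed

lemma eigenvalue_iff:
  "eigenvalue_on vf_cplx_scale (lie_algebra_cplx G T A) (induced_aut_cplx G \<delta>) z \<longleftrightarrow>
    (\<exists>v. v \<noteq> 0 \<and> L2 v = pair_scale z v)"
  unfolding eigenvalue_on_def lie_algebra_cplx_eq
  by (simp add: induced_aut_cplx_left_field left_field_cplx_scale[symmetric] left_field_cplx_eq_iff left_field_cplx_zero)

text \<open>
  The complexified \<open>left_field\<close> is an isomorphism carrying \<open>L\<close> to the induced automorphism, so the condition
  on Jordan chains can be read in the model space.
\<close>

lemma diagonalizable_iff:
  "diagonalizable_on vf_cplx_scale
     (generalized_eigenspace vf_cplx_scale (lie_algebra_cplx G T A) (induced_aut_cplx G \<delta>) z)
     (induced_aut_cplx G \<delta>) \<longleftrightarrow>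
   (\<forall>v. L2 (L2 v - pair_scale z v) - pair_scale z (L2 v - pair_scale z v) = 0 \<longrightarrow> L2 v - pair_scale z v = 0)"
proof -
  interpret op: complex_operator vf_cplx_scale "induced_aut_cplx G \<delta>" by (rule complex_operator_induced_aut)
  have shift: "induced_aut_cplx G \<delta> (left_field_cplx v) - vf_cplx_scale z (left_field_cplx v) =
      left_field_cplx (L2 v - pair_scale z v)" for v
    by (simp add: induced_aut_cplx_left_field left_field_cplx_diff left_field_cplx_scale)
  have sub: "op.subspace (lie_algebra_cplx G T A)"
    unfolding op.subspace_def lie_algebra_cplx_eq
  proof (intro conjI ballI allI)
    show "0 \<in> range left_field_cplx" using left_field_cplx_zero[of 0] by (metis rangeI)
    fix x y assume "x \<in> range left_field_cplx" "y \<in> range left_field_cplx"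
    then obtain v where v: "x = left_field_cplx v" by (elim rangeE)
    obtain w where w: "y = left_field_cplx w" using \<open>y \<in> range left_field_cplx\<close> by (elim rangeE)
    have "x + y = left_field_cplx (v + w)" unfolding v w by (cases v; cases w) (simp add: left_field_linear)
    then show "x + y \<in> range left_field_cplx" by (rule range_eqI)
  next
    fix c x assume "x \<in> range left_field_cplx"
    then obtain v where "x = left_field_cplx v" by (elim rangeE)
    then have "vf_cplx_scale c x = left_field_cplx (pair_scale c v)" by (simp add: left_field_cplx_scale)
    then show "vf_cplx_scale c x \<in> range left_field_cplx" by (rule range_eqI)
  qed
  have inv: "induced_aut_cplx G \<delta> v \<in> lie_algebra_cplx G T A" if "v \<in> lie_algebra_cplx G T A" for v
  proof -
    obtain w where v: "v = left_field_cplx w" using \<open>v \<in> _\<close> unfolding lie_algebra_cplx_eq by (elim rangeE)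
    show ?thesis unfolding v induced_aut_cplx_left_field lie_algebra_cplx_eq by (rule rangeI)
  qed
  have "diagonalizable_on vf_cplx_scale
     (generalized_eigenspace vf_cplx_scale (lie_algebra_cplx G T A) (induced_aut_cplx G \<delta>) z)
     (induced_aut_cplx G \<delta>) \<longleftrightarrow>
   (\<forall>x\<in>lie_algebra_cplx G T A. op.shifted z (op.shifted z x) = 0 \<longrightarrow> op.shifted z x = 0)"
    using inv by (rule op.diagonalizable_generalized_eigenspace_iff[OF sub])
  also have "\<dots> \<longleftrightarrow> (\<forall>v. L2 (L2 v - pair_scale z v) - pair_scale z (L2 v - pair_scale z v) = 0 \<longrightarrow>
      L2 v - pair_scale z v = 0)"
    unfolding lie_algebra_cplx_eq by (simp only: ball_simps ball_UNIV shift left_field_cplx_zero)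
  finally show ?thesis .
qed

lemma linear_part_inverse: "linear_part \<delta> (linear_part \<gamma> w) = w"
proof -
  have one: "\<gamma> \<one> = \<one>" using hom_one[OF \<gamma>(2)] is_group by auto
  obtain N where N: "open N" "\<phi> \<one> \<in> N" "N \<subseteq> \<phi> ` U" "\<forall>u\<in>N. \<gamma> (q u) \<in> U"
    "smooth_on N (\<lambda>u. \<phi> (\<gamma> (q u)))" using endomorphism_in_chart[OF \<gamma>(1) one] .
  have d1: "((\<lambda>u. \<phi> (\<gamma> (q u))) has_derivative linear_part \<gamma>) (at (\<phi> \<one>))"
    by (rule linear_part_has_derivative[OF \<gamma>(1) one])
  have d2: "((\<lambda>u. \<phi> (\<delta> (q u))) has_derivative linear_part \<delta>) (at (\<phi> (\<gamma> (q (\<phi> \<one>)))))"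
    using linear_part_has_derivative[OF \<delta>(1) \<delta>_fixes_one] by (simp add: q_one one)
  have "((\<lambda>u. u) has_derivative (\<lambda>w. linear_part \<delta> (linear_part \<gamma> w))) (at (\<phi> \<one>))"
  proof (rule has_derivative_transform_within_open[OF has_derivative_compose[OF d1 d2] N(1,2)])
    fix u assume u: "u \<in> N"
    have "q (\<phi> (\<gamma> (q u))) = \<gamma> (q u)" using bspec[OF N(4) u] chart_inv[OF U] by blast
    moreover have "u \<in> \<phi> ` U" using u N(3) by blast
    ultimately show "\<phi> (\<delta> (q (\<phi> (\<gamma> (q u))))) = u" by (simp add: \<delta>_\<gamma> q_carrier f_inv_into_f)
  qed
  then show ?thesis using fun_cong[OF has_derivative_unique[OF _ has_derivative_ident]] by blast
qed

section \<open>Contracting and expanding automorphisms\<close>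

text \<open>
  At a number \<open>z\<close> that is not an eigenvalue the condition on Jordan chains holds trivially; this reconciles
  the quantification over all \<open>z\<close> of modulus \<open>c\<close> with the one over eigenvalues.
\<close>

theorem contracting_dilation_iff:
  assumes c: "0 < c" "c < 1"
  shows "(\<exists>d. admissible_distance G T d \<and> (\<forall>x\<in>carrier G. \<forall>y\<in>carrier G. d (\<delta> x) (\<delta> y) = c * d x y)) \<longleftrightarrow>
    connected_space T \<and> simply_connected_space T \<and>
    (\<forall>z. eigenvalue_on vf_cplx_scale (lie_algebra_cplx G T A) (induced_aut_cplx G \<delta>) z \<longrightarrow> cmod z \<le> c) \<and>
    (\<forall>z. eigenvalue_on vf_cplx_scale (lie_algebra_cplx G T A) (induced_aut_cplx G \<delta>) z \<and> cmod z = c \<longrightarrow>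
      diagonalizable_on vf_cplx_scale
        (generalized_eigenspace vf_cplx_scale (lie_algebra_cplx G T A) (induced_aut_cplx G \<delta>) z)
        (induced_aut_cplx G \<delta>))"
proof -
  obtain B :: "'e set" where B: "finite_basis B" using ex_model_basis by blast
  let ?L = "map_prod (linear_part \<delta>) (linear_part \<delta>)"
  let ?E = "\<lambda>z. \<exists>v. v \<noteq> 0 \<and> ?L v = pair_scale z v"
  let ?J = "\<lambda>z. \<forall>v. ?L (?L v - pair_scale z v) - pair_scale z (?L v - pair_scale z v) = 0 \<longrightarrow> ?L v - pair_scale z v = 0"
  have J: "?J z" if "\<not> ?E z" for z
  proof (intro allI impI)
    fix v assume "?L (?L v - pair_scale z v) - pair_scale z (?L v - pair_scale z v) = 0"
    then have "?L (?L v - pair_scale z v) = pair_scale z (?L v - pair_scale z v)" by simp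
    then show "?L v - pair_scale z v = 0" using that by blast
  qed
  have "(\<exists>C. \<forall>n v. norm ((linear_part \<delta> ^^ n) v) \<le> C * c ^ n * norm v) \<longleftrightarrow>
      (\<forall>z v. v \<noteq> 0 \<longrightarrow> ?L v = pair_scale z v \<longrightarrow> cmod z \<le> c) \<and>
      (\<forall>z v. cmod z = c \<longrightarrow> ?L (?L v - pair_scale z v) - pair_scale z (?L v - pair_scale z v) = 0 \<longrightarrow>
         ?L v - pair_scale z v = 0)"
    by (rule powers_bounded_iff_spectral[OF B linear_linear_part c(1)])
  also have "\<dots> \<longleftrightarrow> (\<forall>z. ?E z \<longrightarrow> cmod z \<le> c) \<and> (\<forall>z. ?E z \<and> cmod z = c \<longrightarrow> ?J z)"
  proof (rule arg_cong2[where f="(\<and>)"])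
    show "(\<forall>z v. v \<noteq> 0 \<longrightarrow> ?L v = pair_scale z v \<longrightarrow> cmod z \<le> c) \<longleftrightarrow> (\<forall>z. ?E z \<longrightarrow> cmod z \<le> c)"
      by blast
    show "(\<forall>z v. cmod z = c \<longrightarrow> ?L (?L v - pair_scale z v) - pair_scale z (?L v - pair_scale z v) = 0 \<longrightarrow>
        ?L v - pair_scale z v = 0) \<longleftrightarrow> (\<forall>z. ?E z \<and> cmod z = c \<longrightarrow> ?J z)" (is "?A \<longleftrightarrow> ?B")
    proof
      show ?B if ?A using that by blast
      show ?A if B: ?B
      proof (intro allI impI)
        fix z v assume z: "cmod z = c" and v: "?L (?L v - pair_scale z v) - pair_scale z (?L v - pair_scale z v) = 0"
        have "?J z"
        proof (cases "?E z")
          case True then show ?thesis using B z by blast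
        qed (rule J)
        from this[rule_format, OF v] show "?L v - pair_scale z v = 0" .
      qed
    qed
  qed
  finally show ?thesis
    unfolding dilated_distance_iff_powers_bounded[OF c] eigenvalue_iff diagonalizable_iff by (rule arg_cong)
qed

lemma linear_part_pair_inverse: "L2 (map_prod (linear_part \<gamma>) (linear_part \<gamma>) v) = v"
  by (cases v) (simp add: linear_part_inverse)

text \<open>
  The inverse automorphism is contracting with factor \<open>1 / c\<close>. Its linear part is the inverse of that of \<open>\<delta>\<close>,
  so its eigenvalues are the reciprocals and its Jordan chains correspond.
\<close>

theorem expanding_dilation_iff:
  assumes c: "1 < c"
  shows "(\<exists>d. admissible_distance G T d \<and> (\<forall>x\<in>carrier G. \<forall>y\<in>carrier G. d (\<delta> x) (\<delta> y) = c * d x y)) \<longleftrightarrow>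
    connected_space T \<and> simply_connected_space T \<and>
    (\<forall>z. eigenvalue_on vf_cplx_scale (lie_algebra_cplx G T A) (induced_aut_cplx G \<delta>) z \<longrightarrow> cmod z \<ge> c) \<and>
    (\<forall>z. eigenvalue_on vf_cplx_scale (lie_algebra_cplx G T A) (induced_aut_cplx G \<delta>) z \<and> cmod z = c \<longrightarrow>
      diagonalizable_on vf_cplx_scale
        (generalized_eigenspace vf_cplx_scale (lie_algebra_cplx G T A) (induced_aut_cplx G \<delta>) z)
        (induced_aut_cplx G \<delta>))"
proof -
  let ?L = "map_prod (linear_part \<delta>) (linear_part \<delta>)" and ?K = "map_prod (linear_part \<gamma>) (linear_part \<gamma>)"
  let ?E = "\<lambda>L z. \<exists>v. v \<noteq> 0 \<and> L v = pair_scale z v"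
  let ?J = "\<lambda>L z. \<forall>v. L (L v - pair_scale z v) - pair_scale z (L v - pair_scale z v) = 0 \<longrightarrow> L v - pair_scale z v = 0"
  interpret inverse: lie_group_chart_automorphism G T A U \<phi> \<gamma> \<delta> by (rule inverse_automorphism)
  note iff = eigenvalue_iff diagonalizable_iff and iff' = inverse.eigenvalue_iff inverse.diagonalizable_iff
  have LK: "?L (?K v) = v" and KL: "?K (?L v) = v" for v
    by (rule linear_part_pair_inverse) (rule inverse.linear_part_pair_inverse)
  interpret L: normed_complex_operator pair_scale ?L 4 1
    by (rule normed_complex_operator_pair[OF linear_linear_part zero_less_one])
  interpret K: normed_complex_operator pair_scale ?K 4 1
    by (rule normed_complex_operator_pair[OF inverse.linear_linear_part zero_less_one])
  have E: "?E ?K (1 / z) \<longleftrightarrow> ?E ?L z" if "z \<noteq> 0" for z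
    using L.inverse_eigenvector_iff[OF K.complex_operator_axioms LK KL that] by blast
  have E0: "\<not> ?E ?L 0" "\<not> ?E ?K 0"
    using L.inverse_no_kernel[OF K.complex_operator_axioms KL] K.inverse_no_kernel[OF L.complex_operator_axioms LK] by blast+
  have J: "?J ?K (1 / z) \<longleftrightarrow> ?J ?L z" if z: "z \<noteq> 0" for z
  proof
    show "?J ?K (1 / z)" if "?J ?L z"
      using L.inverse_no_jordan[OF K.complex_operator_axioms LK KL z] that by blast
    show "?J ?L z" if "?J ?K (1 / z)"
      using K.inverse_no_jordan[OF L.complex_operator_axioms KL LK, of "1 / z"] that z by simp
  qed
  have S1: "(\<forall>z. ?E ?K z \<longrightarrow> cmod z \<le> 1 / c) \<longleftrightarrow> (\<forall>z. ?E ?L z \<longrightarrow> cmod z \<ge> c)"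
  proof (intro iffI allI impI)
    fix z assume A: "\<forall>z. ?E ?K z \<longrightarrow> cmod z \<le> 1 / c" and z: "?E ?L z"
    then have nz: "z \<noteq> 0" using E0 by blast
    then have "?E ?K (1 / z)" using E z by blast
    then have "cmod (1 / z) \<le> 1 / c" using A by blast
    then show "cmod z \<ge> c" using nz c by (simp add: norm_divide field_simps)
  next
    fix z assume A: "\<forall>z. ?E ?L z \<longrightarrow> cmod z \<ge> c" and z: "?E ?K z"
    then have nz: "z \<noteq> 0" using E0 by blast
    then have "?E ?L (1 / z)" using E[of "1 / z"] z by simp
    then have "cmod (1 / z) \<ge> c" using A by blast
    then show "cmod z \<le> 1 / c" using nz c by (simp add: norm_divide field_simps)
  qed
  have S2: "(\<forall>z. ?E ?K z \<and> cmod z = 1 / c \<longrightarrow> ?J ?K z) \<longleftrightarrow> (\<forall>z. ?E ?L z \<and> cmod z = c \<longrightarrow> ?J ?L z)"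
  proof (intro iffI allI impI)
    fix z v assume A: "\<forall>z. ?E ?K z \<and> cmod z = 1 / c \<longrightarrow> ?J ?K z" and z: "?E ?L z \<and> cmod z = c"
    then have nz: "z \<noteq> 0" using E0 by blast
    have "?E ?K (1 / z)" using E[OF nz] z by blast
    moreover have "cmod (1 / z) = 1 / c" using z by (simp add: norm_divide)
    ultimately have "?J ?K (1 / z)" using A by blast
    then have J': "?J ?L z" using J[OF nz] by blast
    assume "?L (?L v - pair_scale z v) - pair_scale z (?L v - pair_scale z v) = 0"
    then show "?L v - pair_scale z v = 0" using J' by blast
  next
    fix z v assume A: "\<forall>z. ?E ?L z \<and> cmod z = c \<longrightarrow> ?J ?L z" and z: "?E ?K z \<and> cmod z = 1 / c"
    then have nz: "z \<noteq> 0" using E0 by blast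
    have "?E ?L (1 / z)" using E[of "1 / z"] nz z by simp
    moreover have "cmod (1 / z) = c" using z by (simp add: norm_divide)
    ultimately have "?J ?L (1 / z)" using A by blast
    then have J': "?J ?K z" using J[of "1 / z"] nz by simp
    assume "?K (?K v - pair_scale z v) - pair_scale z (?K v - pair_scale z v) = 0"
    then show "?K v - pair_scale z v = 0" using J' by blast
  qed
  have "(\<forall>x\<in>carrier G. \<forall>y\<in>carrier G. d (\<delta> x) (\<delta> y) = c * d x y) \<longleftrightarrow>
      (\<forall>x\<in>carrier G. \<forall>y\<in>carrier G. d (\<gamma> x) (\<gamma> y) = 1 / c * d x y)" for d :: "'a \<Rightarrow> 'a \<Rightarrow> real"
  proof (intro iffI ballI)
    fix x y assume A: "\<forall>x\<in>carrier G. \<forall>y\<in>carrier G. d (\<delta> x) (\<delta> y) = c * d x y" and xy: "x \<in> carrier G" "y \<in> carrier G"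
    have "d (\<delta> (\<gamma> x)) (\<delta> (\<gamma> y)) = c * d (\<gamma> x) (\<gamma> y)" using A xy hom_in_carrier[OF \<gamma>(2)] by blast
    then show "d (\<gamma> x) (\<gamma> y) = 1 / c * d x y" using c xy by (simp add: \<delta>_\<gamma>)
  next
    fix x y assume A: "\<forall>x\<in>carrier G. \<forall>y\<in>carrier G. d (\<gamma> x) (\<gamma> y) = 1 / c * d x y" and xy: "x \<in> carrier G" "y \<in> carrier G"
    have "d (\<gamma> (\<delta> x)) (\<gamma> (\<delta> y)) = 1 / c * d (\<delta> x) (\<delta> y)" using A xy hom_in_carrier[OF \<delta>(2)] by blast
    then show "d (\<delta> x) (\<delta> y) = c * d x y" using c xy by (simp add: \<gamma>_\<delta>)
  qed
  then have 1: "(\<exists>d. admissible_distance G T d \<and> (\<forall>x\<in>carrier G. \<forall>y\<in>carrier G. d (\<delta> x) (\<delta> y) = c * d x y)) \<longleftrightarrow>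
      (\<exists>d. admissible_distance G T d \<and> (\<forall>x\<in>carrier G. \<forall>y\<in>carrier G. d (\<gamma> x) (\<gamma> y) = 1 / c * d x y))" by simp
  have "0 < 1 / c" "1 / c < 1" using c by auto
  note 2 = inverse.contracting_dilation_iff[OF this]
  show ?thesis unfolding 1 2 unfolding iff iff' S1 S2 ..
qed

end

theorem theorem1p4:
  fixes G :: "('a, 'm) monoid_scheme"
    and T :: "'a topology"
    and A :: "('a, 'e::real_normed_vector) chart set"
    and \<delta> :: "'a \<Rightarrow> 'a"
    and c :: real
  assumes "lie_group G T A"
    and "lie_group_automorphism G T A \<delta>"
    and "0 < c" and "c \<noteq> 1"
  shows "(\<exists>d. admissible_distance G T d \<and> dilation (carrier G) d c \<delta>) \<longleftrightarrow>
         connected_space T \<and> simply_connected_space T \<and>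
         (c < 1 \<longrightarrow>
           (\<forall>z. eigenvalue_on vf_cplx_scale (lie_algebra_cplx G T A) (induced_aut_cplx G \<delta>) z
                \<longrightarrow> cmod z \<le> c)) \<and>
         (c > 1 \<longrightarrow>
           (\<forall>z. eigenvalue_on vf_cplx_scale (lie_algebra_cplx G T A) (induced_aut_cplx G \<delta>) z
                \<longrightarrow> cmod z \<ge> c)) \<and>
         (\<forall>z. eigenvalue_on vf_cplx_scale (lie_algebra_cplx G T A) (induced_aut_cplx G \<delta>) z \<and>
              cmod z = c \<longrightarrow>
            diagonalizable_on vf_cplx_scale
              (generalized_eigenspace vf_cplx_scale (lie_algebra_cplx G T A)
                 (induced_aut_cplx G \<delta>) z)
              (induced_aut_cplx G \<delta>))"
proof -
  interpret lie_group G T A by fact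
  obtain U \<phi> where U: "(U, \<phi>) \<in> A" "\<one>\<^bsub>G\<^esub> \<in> U"
    using chart_at[of "\<one>\<^bsub>G\<^esub>"] topspace_eq_carrier by auto
  define \<gamma> where "\<gamma> = inv_into (carrier G) \<delta>"
  have iso: "\<delta> \<in> iso G G" and smooth: "smooth_map T A T A \<delta>" "smooth_map T A T A \<gamma>"
    using assms(2) by (auto simp: lie_group_automorphism_def \<gamma>_def)
  have bij: "bij_betw \<delta> (carrier G) (carrier G)" and hom: "\<delta> \<in> hom G G" using iso by (auto simp: iso_def)
  have "\<gamma> \<in> iso G G" unfolding \<gamma>_def by (rule iso_set_sym[OF iso])
  then have hom': "\<gamma> \<in> hom G G" by (auto simp: iso_def)
  have inv: "\<gamma> (\<delta> x) = x" "\<delta> (\<gamma> x) = x" if "x \<in> carrier G" for x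
    using that bij by (auto simp: \<gamma>_def bij_betw_inv_into_left bij_betw_inv_into_right)
  interpret lie_group_chart_automorphism G T A U \<phi> \<delta> \<gamma>
    by unfold_locales (use U smooth hom hom' inv in auto)
  have dil: "dilation (carrier G) d c \<delta> \<longleftrightarrow> (\<forall>x\<in>carrier G. \<forall>y\<in>carrier G. d (\<delta> x) (\<delta> y) = c * d x y)" for d
    using bij by (simp add: dilation_def)
  show ?thesis
  proof (cases "c < 1")
    case True
    then show ?thesis
      using contracting_dilation_iff[OF assms(3) True] unfolding dil by simp
  next
    case False
    then have c: "1 < c" using assms(4) by simp
    then show ?thesis
      using expanding_dilation_iff[OF c] unfolding dil by simp
  qed
qed

end
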